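(* Let $\{X^k\}_{k\ge0}$ be the iterates generated by the algorithm RSSM (described in the context) with stepsizes $\{\gamma_k\}_{k\ge0}$ satisfying $\gamma_k \in (0,\frac{1}{L})$ for all $k\ge0$, $\sum_{k\ge0} \gamma_k = \infty$, and $\sum_{k\ge0} \gamma_k^2 < \infty$. Then, for any $\lambda \in \bigl(0, \frac{\ell}{2(\tau + (2\ell-1)L)}\bigr)$, we have $\lim_{k\to \infty} \Theta_{\lambda f}^{\mathfrak C}(X^k) = 0$ almost surely. Hence, almost surely, every accumulation point of $\{X^k\}_k$ is a stationary point of the problem $\min\{f(X): X\in \mathrm{St}(n,p)\}$, i.e. a point $X \in \mathrm{St}(n,p)$ with $0\in\partial_{\mathrm{St}(n,p)}f(X)$.
   Context: Let $n\ge p\ge 1$ be integers, $\mathrm{St}(n,p)=\{X\in\mathbb{R}^{n\times p}: X^\top X=I\}$, $[p]=\{1,\dots,p\}$. Matrix spaces carry the Frobenius inner product $\langle\xi,\eta\rangle=\mathrm{tr}(\xi^\top\eta)$ and norm $\|\cdot\|$. Let $f:\mathbb{R}^{n\times p}\to\mathbb{R}$ be $\tau$-weakly convex (i.e. $f(\cdot)+\frac{\tau}{2}\|\cdot\|^2$ is convex) and $L$-Lipschitz continuous on some bounded convex neighborhood $\Omega$ of $\mathrm{St}(n,p)$, where $\tau\ge 0$ and $L>0$. $\partial f$ is the Clarke subdifferential; $T_X\mathrm{St}(n,p)=\{\xi\in\mathbb{R}^{n\times p}:\xi^\top X+X^\top\xi=0\}$ and $\partial_{\mathrm{St}(n,p)}f(X)=\{\mathcal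 P_{T_X\mathrm{St}(n,p)}(G):G\in\partial f(X)\}$. Column blocks. Let $\mathfrak C=\{C_1,\dots,C_\ell\}$ be a partition of $[p]$ with $\ell\ge 2$; $\binom{[\ell]}{2}$ is the set of unordered pairs of distinct elements of $\{1,\dots,\ell\}$. For $C\subseteq[p]$, $X_C$ is the submatrix of $X$ formed by the columns with indices in $C$; $I_C$ is the corresponding submatrix of the $p\times p$ identity, so $X_C=XI_C$. For $\{i,j\}\in\binom{[\ell]}{2}$ put $C_{ij}=C_i\cup C_j$, $p_{ij}=|C_{ij}|$, $X_{ij}=X_{C_{ij}}$, $I_{ij}=I_{C_{ij}}$, $X_{-ij}=X_{[p]\setminus C_{ij}}$ and, for $X \in \mathrm{St}(n,p)$, $\mathcal M_{X_{-ij}}=\{Y\in\mathrm{St}(n,p_{ij}): X_{-ij}^\top Y=0\}$ (a smooth submanifold), with tangent space $T_{X_{ij}}\mathcal M_{X_{-ij}}=\{\xi\in\mathbb{R}^{n\times p_{ij}}:\xi^\top X_{ij}+X_{ij}^\top\xi=0,\ X_{-ij}^\top\xi=0\}$. $\mathcal P_S$ denotes the nearest-point projection onto a set $S$ in the Frobenius norm. Algorithm RSSM. Input: $X^0\in\mathrm{St}(n,p)$ (deterministic), the partition $\mathfrak C$, deterministic stepsizes $\gamma_k\in(0,\frac1L)$. At iteration $k$: a subgradient $\widetilde\nabla f(X^k)\in\partial f(X^k)$ is selected (before the random draw of iteration $k$); a pair $\{i,j\}$ is drawn uniformly from $\binom{[\ell]}{2}$, independently of the past; set $G=\mathcal P_{T_{X^k_{ij}}\mathcal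 M_{X^k_{-ij}}}(\widetilde\nabla f(X^k)I_{ij})$; and update $X^{k+1}_{ij}=\mathcal P_{\mathcal M_{X^k_{-ij}}}(X^k_{ij}-\gamma_k G)=\mathcal P_{\mathrm{St}(n,p_{ij})}(X^k_{ij}-\gamma_kG)$ (these projections are unique and equal), $X^{k+1}_{-ij}=X^k_{-ij}$. "Almost surely" refers to the product probability measure on the space of infinite sequences of pairs in $\binom{[\ell]}{2}$ induced by the uniform distribution. Averaging operator. For $X\in\mathrm{St}(n,p)$, $\mathcal A_X:\mathbb{R}^{n\times p}\to\mathbb{R}^{n\times p}$ is the linear operator $\mathcal A_X(\xi)=\binom{\ell}{2}^{-1}\sum_{\{i,j\}\in\binom{[\ell]}{2}}(I-X_{-ij}X_{-ij}^\top)\xi_{ij}I_{ij}^\top$, with $\xi_{ij}=\xi I_{ij}$. It is self-adjoint and positive definite; $\|\xi\|_{\mathcal A_X^{-1}}=\sqrt{\langle\mathcal A_X^{-1}(\xi),\xi\rangle}$. For $X\in\mathrm{St}(n,p)$: $P_{\lambda f}^{\mathfrak C}(X)=\mathrm{argmin}_{Y\in\mathrm{St}(n,p)}\{f(Y)+\frac1{2\lambda}\|Y-X\|_{\mathcal A_X^{-1}}^2\}$ (single-valued for $\lambda$ in the range considered) and $\Theta_{\lambda f}^{\mathfrak C}(X)=\frac1\lambda\|P_{\lambda f}^{\mathfrak C}(X)-X\|_{\mathcal A_X^{-1}}$. *)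

theory Defs
  imports "HOL-Probability.Probability"
begin

text \<open>
  An \<open>n \<times> p\<close> matrix has type \<open>real^'p^'n\<close>; the library inner product and norm on
  this type are the Frobenius ones, and \<open>closest_point S\<close> is the nearest-point projection onto \<open>S\<close>.
\<close>

definition stiefel :: "(real^'p^'n) set" where
  "stiefel = {X. transpose X ** X = mat 1}"

definition stiefel_tangent :: "real^'p^'n \<Rightarrow> (real^'p^'n) set" where
  "stiefel_tangent X = {\<xi>. transpose \<xi> ** X + transpose X ** \<xi> = 0}"


text \<open>
  Clarke's generalized directional derivative
  \<open>f\<degree>(x; v) = limsup {(f (y + t v) - f y) / t | y \<rightarrow> x, t \<down> 0}\<close>, where
  \<open>y = x\<close> is allowed, and the Clarke subdifferential
  \<open>{g. \<forall>v. g \<bullet> v \<le> f\<degree>(x; v)}\<close>.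
\<close>

definition clarke_dd :: "('a::real_inner \<Rightarrow> real) \<Rightarrow> 'a \<Rightarrow> 'a \<Rightarrow> ereal" where
  "clarke_dd f x v =
     Limsup (nhds x \<times>\<^sub>F at_right (0::real)) (\<lambda>(y, t). ereal ((f (y + t *\<^sub>R v) - f y) / t))"

definition clarke_subdiff :: "('a::real_inner \<Rightarrow> real) \<Rightarrow> 'a \<Rightarrow> 'a set" where
  "clarke_subdiff f x = {g. \<forall>v. ereal (g \<bullet> v) \<le> clarke_dd f x v}"

definition stiefel_subdiff :: "(real^'p^'n \<Rightarrow> real) \<Rightarrow> real^'p^'n \<Rightarrow> (real^'p^'n) set" where
  "stiefel_subdiff f X = closest_point (stiefel_tangent X) ` clarke_subdiff f X"

definition stationary :: "(real^'p^'n \<Rightarrow> real) \<Rightarrow> real^'p^'n \<Rightarrow> bool" where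
  "stationary f X \<longleftrightarrow> X \<in> stiefel \<and> 0 \<in> stiefel_subdiff f X"


text \<open>
  Column submatrices.  Since the number of columns of \<open>X\<^sub>C = X I\<^sub>C\<close> depends on the set
  \<open>C\<close>, an \<open>n \<times> |C|\<close> matrix \<open>Y\<close> is represented by the \<open>n \<times> p\<close> matrix
  \<open>Y I\<^sub>C\<^sup>T\<close>, i.e. it is extended by zero columns outside \<open>C\<close>.  This is a linear isometry onto
  \<open>col_space C\<close>, so it preserves nearest-point projections.  Under it, \<open>X\<^sub>C\<close> becomes
  \<open>X I\<^sub>C I\<^sub>C\<^sup>T\<close>, a product \<open>A\<^sup>T B\<close> of submatrices becomes
  \<open>I\<^sub>C A\<^sup>T B I\<^sub>D\<^sup>T\<close>, a product \<open>A A\<^sup>T\<close> is unchanged, and the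
  \<open>|C| \<times> |C|\<close> identity becomes \<open>I\<^sub>C I\<^sub>C\<^sup>T\<close>.
\<close>

definition col_proj :: "'p set \<Rightarrow> real^'p^'p" where  \<comment> \<open>\<open>I\<^sub>C I\<^sub>C\<^sup>T\<close>\<close>
  "col_proj C = (\<chi> i j. if i = j \<and> i \<in> C then 1 else 0)"

definition col_sub :: "'p set \<Rightarrow> real^'p^'n \<Rightarrow> real^'p^'n" where  \<comment> \<open>\<open>X\<^sub>C\<close>\<close>
  "col_sub C X = X ** col_proj C"

definition col_space :: "'p set \<Rightarrow> (real^'p^'n) set" where  \<comment> \<open>\<open>n \<times> |C|\<close> matrices\<close>
  "col_space C = {Y. \<forall>r. \<forall>c. c \<notin> C \<longrightarrow> Y $ r $ c = 0}"

definition stiefel_cols :: "'p set \<Rightarrow> (real^'p^'n) set" where  \<comment> \<open>\<open>St(n, |C|)\<close>\<close>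
  "stiefel_cols C = {Y \<in> col_space C. transpose Y ** Y = col_proj C}"

text \<open>For \<open>C = C\<^sub>i\<^sub>j\<close>, these are the submanifold determined by the fixed columns
  \<open>X\<^sub>-\<^sub>i\<^sub>j = col_sub (- C) X\<close> and its tangent space at \<open>X\<^sub>i\<^sub>j = col_sub C X\<close>.\<close>

definition block_manifold :: "'p set \<Rightarrow> real^'p^'n \<Rightarrow> (real^'p^'n) set" where
  "block_manifold C X = {Y \<in> stiefel_cols C. transpose (col_sub (- C) X) ** Y = 0}"

definition block_tangent :: "'p set \<Rightarrow> real^'p^'n \<Rightarrow> (real^'p^'n) set" where
  "block_tangent C X =
     {\<xi> \<in> col_space C. transpose \<xi> ** col_sub C X + transpose (col_sub C X) ** \<xi> = 0 \<and>
                      transpose (col_sub (- C) X) ** \<xi> = 0}"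


definition pairs :: "nat \<Rightarrow> nat set set" where
  "pairs l = {P. P \<subseteq> {1..l} \<and> card P = 2}"

definition column_partition :: "nat \<Rightarrow> (nat \<Rightarrow> 'p set) \<Rightarrow> bool" where
  "column_partition l C \<longleftrightarrow> inj_on C {1..l} \<and> partition_on UNIV (C ` {1..l})"

definition pair_cols :: "(nat \<Rightarrow> 'p set) \<Rightarrow> nat set \<Rightarrow> 'p set" where  \<comment> \<open>\<open>C\<^sub>i\<^sub>j\<close>\<close>
  "pair_cols C P = \<Union> (C ` P)"

definition draws :: "nat \<Rightarrow> (nat \<Rightarrow> nat set) measure" where
  "draws l = (\<Pi>\<^sub>M k\<in>UNIV. uniform_count_measure (pairs l))"


text \<open>One update with stepsize \<open>\<gamma>\<close>, selected subgradient \<open>V\<close> and column block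
  \<open>C = C\<^sub>i\<^sub>j\<close>: columns outside \<open>C\<close> are kept.\<close>

definition rssm_step :: "'p set \<Rightarrow> real \<Rightarrow> real^'p^'n \<Rightarrow> real^'p^'n \<Rightarrow> real^'p^'n" where
  "rssm_step C \<gamma> V X =
     (let G = closest_point (block_tangent C X) (col_sub C V)
      in closest_point (block_manifold C X) (col_sub C X - \<gamma> *\<^sub>R G) + col_sub (- C) X)"

text \<open>
  \<open>X k \<omega>\<close> is the \<open>k\<close>-th iterate when the pairs \<open>\<omega> 0, \<omega> 1, \<dots>\<close> are drawn, and \<open>V k \<omega>\<close> the
  subgradient selected at iteration \<open>k\<close>.  The selection precedes the draw of \<open>\<omega> k\<close>, so \<open>V k\<close>
  may depend, arbitrarily, on \<open>\<omega> 0, \<dots>, \<omega> (k - 1)\<close> only.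
\<close>

definition rssm ::
  "(real^'p^'n \<Rightarrow> real) \<Rightarrow> nat \<Rightarrow> (nat \<Rightarrow> 'p set) \<Rightarrow> (nat \<Rightarrow> real) \<Rightarrow> real^'p^'n \<Rightarrow>
   (nat \<Rightarrow> (nat \<Rightarrow> nat set) \<Rightarrow> real^'p^'n) \<Rightarrow> (nat \<Rightarrow> (nat \<Rightarrow> nat set) \<Rightarrow> real^'p^'n) \<Rightarrow> bool" where
  "rssm f l C \<gamma> X0 V X \<longleftrightarrow>
     X0 \<in> stiefel \<and>
     (\<forall>\<omega>\<in>space (draws l). X 0 \<omega> = X0) \<and>
     (\<forall>k. \<forall>\<omega>\<in>space (draws l). V k \<omega> \<in> clarke_subdiff f (X k \<omega>)) \<and>
     (\<forall>k. \<forall>\<omega>\<in>space (draws l). \<forall>\<omega>'\<in>space (draws l).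
        (\<forall>j<k. \<omega> j = \<omega>' j) \<longrightarrow> V k \<omega> = V k \<omega>') \<and>
     (\<forall>k. \<forall>\<omega>\<in>space (draws l).
        X (Suc k) \<omega> = rssm_step (pair_cols C (\<omega> k)) (\<gamma> k) (V k \<omega>) (X k \<omega>))"


definition avg_op :: "nat \<Rightarrow> (nat \<Rightarrow> 'p set) \<Rightarrow> real^'p^'n \<Rightarrow> real^'p^'n \<Rightarrow> real^'p^'n" where
  "avg_op l C X \<xi> =
     inverse (real (l choose 2)) *\<^sub>R
       (\<Sum>P\<in>pairs l.
          (let Z = col_sub (- pair_cols C P) X
           in (mat 1 - Z ** transpose Z) ** col_sub (pair_cols C P) \<xi>))"

definition avg_inv_norm :: "nat \<Rightarrow> (nat \<Rightarrow> 'p set) \<Rightarrow> real^'p^'n \<Rightarrow> real^'p^'n \<Rightarrow> real" where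
  "avg_inv_norm l C X \<xi> = sqrt (inv (avg_op l C X) \<xi> \<bullet> \<xi>)"

definition prox ::
  "(real^'p^'n \<Rightarrow> real) \<Rightarrow> nat \<Rightarrow> (nat \<Rightarrow> 'p set) \<Rightarrow> real \<Rightarrow> real^'p^'n \<Rightarrow> real^'p^'n" where
  "prox f l C lam X =
     arg_min (\<lambda>Y. f Y + 1 / (2 * lam) * (avg_inv_norm l C X (Y - X))\<^sup>2) (\<lambda>Y. Y \<in> stiefel)"

definition Theta ::
  "(real^'p^'n \<Rightarrow> real) \<Rightarrow> nat \<Rightarrow> (nat \<Rightarrow> 'p set) \<Rightarrow> real \<Rightarrow> real^'p^'n \<Rightarrow> real" where
  "Theta f l C lam X = 1 / lam * avg_inv_norm l C X (prox f l C lam X - X)"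

definition accumulation_point :: "(nat \<Rightarrow> 'a::topological_space) \<Rightarrow> 'a \<Rightarrow> bool" where
  "accumulation_point x a \<longleftrightarrow> (\<exists>r. strict_mono r \<and> (x \<circ> r) \<longlonglongrightarrow> a)"

end

theory Submission
  imports Defs
begin

text \<open>
  For \<open>X, Y\<close> on the Stiefel manifold, \<open>\<parallel>Y - X\<parallel>\<^sup>2\<close> in the norm of \<open>\<A>\<^sub>X\<^sup>-\<^sup>1\<close> equals
  \<open>D(X, Y) = (l/2) (\<parallel>Y - X\<parallel>\<^sup>2 + (l - 2) \<parallel>off (X\<^sup>T Y)\<parallel>\<^sup>2)\<close>, where \<open>off\<close> deletes the diagonal
  blocks; in particular it is symmetric in \<open>X\<close> and \<open>Y\<close>. Up to an error of order \<open>\<parallel>Y - X\<parallel>\<^sup>2\<close>, half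
  of the gradient of \<open>D(\<cdot>, Y)\<close> at \<open>X\<close> is \<open>-\<A>\<^sub>X\<^sup>-\<^sup>1\<close> of the tangential part of \<open>Y - X\<close>, and averaging
  the block gradients over the pairs applies \<open>\<A>\<^sub>X\<close>. So in expectation one step changes \<open>D(X, Y)\<close>
  by \<open>2 \<gamma> \<langle>Y - X, V\<rangle>\<close> up to \<open>O(\<gamma> \<parallel>Y - X\<parallel>\<^sup>2 + \<gamma>\<^sup>2)\<close>. With weak convexity it follows, for one small \<open>\<lambda>\<close>,
  that the envelope \<open>F(X) = min\<^sub>Y (f(Y) + D(X, Y) / (2 \<lambda>))\<close> decreases in expectation by a multiple of
  \<open>\<gamma> (f(X) - F(X))\<close> up to \<open>O(\<gamma>\<^sup>2)\<close>. Taking total expectations, \<open>\<Sum> \<gamma>\<^sub>k (f(X\<^sup>k) - F(X\<^sup>k))\<close> is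
  almost surely finite. As the gap \<open>f - F\<close> is Lipschitz on the manifold, it tends to zero along the
  iterates, and its zeros are stationary points. Conversely, a stationary point is the unique
  minimizer of its own proximal problem for every \<open>\<lambda>\<close> in the stated range, so by compactness
  \<open>\<Theta>\<close> tends to zero for all these \<open>\<lambda>\<close>.
\<close>

subsection \<open>Matrix algebra\<close>

lemma matrix_add_rdistrib: "(A + B) ** C = A ** C + B ** (C :: real^'a^'b)"
  by (vector matrix_matrix_mult_def algebra_simps sum.distrib)

lemma matrix_diff_ldistrib: "A ** (B - C) = A ** B - A ** (C :: real^'a^'b)"
  by (vector matrix_matrix_mult_def algebra_simps sum_subtractf)

lemma matrix_diff_rdistrib: "(A - B) ** C = A ** C - B ** (C :: real^'a^'b)"
  by (vector matrix_matrix_mult_def algebra_simps sum_subtractf)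

lemma matrix_minus_left: "(- A) ** B = - (A ** (B :: real^'a^'b))"
  by (vector matrix_matrix_mult_def sum_negf)

lemma matrix_minus_right: "A ** (- B) = - (A ** (B :: real^'a^'b))"
  by (vector matrix_matrix_mult_def sum_negf)

lemma matrix_scaleR_left: "(c *\<^sub>R A) ** B = c *\<^sub>R (A ** (B :: real^'a^'b))"
  by (vector matrix_matrix_mult_def sum_distrib_left mult.assoc)

lemma matrix_scaleR_right: "A ** (c *\<^sub>R B) = c *\<^sub>R (A ** (B :: real^'a^'b))"
  by (vector matrix_matrix_mult_def sum_distrib_left mult_ac)

lemma transpose_add: "transpose (A + B) = transpose A + transpose (B :: real^'a^'b)"
  by (vector transpose_def)

lemma transpose_diff: "transpose (A - B) = transpose A - transpose (B :: real^'a^'b)"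
  by (vector transpose_def)

lemma transpose_minus: "transpose (- A) = - transpose (A :: real^'a^'b)"
  by (vector transpose_def)

lemma transpose_scaleR: "transpose (c *\<^sub>R A) = c *\<^sub>R transpose (A :: real^'a^'b)"
  by (vector transpose_def)

lemma transpose_zero: "transpose (0 :: real^'a^'b) = 0"
  by (vector transpose_def)

lemmas matrix_algebra =
  matrix_add_ldistrib matrix_add_rdistrib matrix_diff_ldistrib matrix_diff_rdistrib
  matrix_minus_left matrix_minus_right matrix_scaleR_left matrix_scaleR_right
  scaleR_right_distrib scaleR_right_diff_distrib
  transpose_add transpose_diff transpose_minus transpose_scaleR transpose_zero
  transpose_transpose transpose_mat matrix_transpose_mul times0_left times0_right
  matrix_mul_assoc[symmetric] matrix_mul_lid matrix_mul_rid

lemma inner_matrix_def: "(A :: real^'a^'b) \<bullet> B = (\<Sum>i\<in>UNIV. \<Sum>j\<in>UNIV. A$i$j * B$i$j)"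
  by (simp add: inner_vec_def)

lemma inner_transpose: "transpose A \<bullet> transpose B = A \<bullet> (B :: real^'a^'b)"
  unfolding inner_matrix_def by (simp add: transpose_def) (rule sum.swap)

lemma inner_matrix_mult_left: "(A ** B) \<bullet> C = B \<bullet> (transpose A ** C)"
  for A :: "real^'c^'b" and B :: "real^'a^'c"
proof -
  let ?t = "\<lambda>i k j. A$i$k * B$k$j * C$i$j"
  have "(A ** B) \<bullet> C = (\<Sum>i\<in>UNIV. \<Sum>j\<in>UNIV. \<Sum>k\<in>UNIV. ?t i k j)"
    by (simp add: inner_matrix_def matrix_matrix_mult_def sum_distrib_right)
  also have "\<dots> = (\<Sum>i\<in>UNIV. \<Sum>k\<in>UNIV. \<Sum>j\<in>UNIV. ?t i k j)"
    by (rule sum.cong[OF refl], rule sum.swap)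
  also have "\<dots> = (\<Sum>k\<in>UNIV. \<Sum>i\<in>UNIV. \<Sum>j\<in>UNIV. ?t i k j)"
    by (rule sum.swap)
  also have "\<dots> = (\<Sum>k\<in>UNIV. \<Sum>j\<in>UNIV. \<Sum>i\<in>UNIV. ?t i k j)"
    by (rule sum.cong[OF refl], rule sum.swap)
  also have "\<dots> = B \<bullet> (transpose A ** C)"
    by (simp add: inner_matrix_def matrix_matrix_mult_def transpose_def sum_distrib_left mult_ac)
  finally show ?thesis .
qed

lemma inner_matrix_mult_right: "(A ** B) \<bullet> C = A \<bullet> (C ** transpose B)"
  for A :: "real^'c^'b" and B :: "real^'a^'c"
  using inner_matrix_mult_left[of "transpose B" "transpose A" "transpose C"]
    inner_transpose[of "A ** B" C] inner_transpose[of A "C ** transpose B"]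
  by (simp add: matrix_transpose_mul transpose_transpose)

lemma norm_transpose: "norm (transpose A) = norm (A :: real^'a^'b)"
  by (simp add: norm_eq_sqrt_inner inner_transpose)

text \<open>Each entry of the product pairs a row of \<open>A\<close> with a column of
  \<open>B\<close>, so Cauchy-Schwarz bounds its square by a product whose double sum
  factorizes.\<close>

lemma norm_matrix_mult_le: "norm (A ** B) \<le> norm A * norm B"
  for A :: "real^'c^'b" and B :: "real^'a^'c"
proof -
  have nsq: "(norm M)\<^sup>2 = (\<Sum>i\<in>UNIV. (norm (M$i))\<^sup>2)" for M :: "real^'x^'y"
    by (simp add: power2_norm_eq_inner inner_vec_def)
  have entry: "(A ** B)$i$j = A$i \<bullet> transpose B$j" for i j
    by (simp add: matrix_matrix_mult_def transpose_def inner_vec_def)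
  have "(norm (A ** B))\<^sup>2 = (\<Sum>i\<in>UNIV. \<Sum>j\<in>UNIV. ((A ** B)$i$j)\<^sup>2)"
    by (simp only: power2_norm_eq_inner inner_matrix_def) (simp add: power2_eq_square)
  also have "\<dots> \<le> (\<Sum>i\<in>UNIV. \<Sum>j\<in>UNIV. (norm (A$i))\<^sup>2 * (norm (transpose B$j))\<^sup>2)"
    unfolding entry by (intro sum_mono) (metis Cauchy_Schwarz_ineq power2_norm_eq_inner)
  also have "\<dots> = (norm A)\<^sup>2 * (norm (transpose B))\<^sup>2"
    by (simp add: nsq sum_product)
  also have "\<dots> = (norm A * norm B)\<^sup>2"
    by (simp add: norm_transpose power_mult_distrib)
  finally show ?thesis
    by (rule power2_le_imp_le) simp
qed

lemma norm_matrix_mult_le_trans: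
  fixes A :: "real^'c^'b" and B :: "real^'a^'c"
  assumes "norm A \<le> a" "norm B \<le> b"
  shows "norm (A ** B) \<le> a * b"
  using norm_matrix_mult_le[of A B] mult_mono[OF assms] assms norm_ge_zero order_trans
  by (metis norm_ge_zero order_trans)

subsection \<open>The Stiefel manifold\<close>

lemma stiefel_mult: "X \<in> stiefel \<Longrightarrow> transpose X ** X = mat 1"
  by (simp add: stiefel_def)

lemma stiefel_mult_assoc:
  fixes X :: "real^'p^'n" and A :: "real^'q^'p"
  shows "X \<in> stiefel \<Longrightarrow> transpose X ** (X ** A) = A"
  by (simp add: matrix_mul_assoc stiefel_mult)

lemma norm_stiefel_mult:
  fixes X :: "real^'p^'n" and A :: "real^'q^'p"
  assumes "X \<in> stiefel"
  shows "norm (X ** A) = norm A"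
  by (simp add: norm_eq_sqrt_inner inner_matrix_mult_left stiefel_mult_assoc[OF assms])

lemma norm_stiefel:
  fixes X :: "real^'p^'n"
  assumes "X \<in> stiefel"
  shows "norm X = norm (mat 1 :: real^'p^'p)"
  using norm_stiefel_mult[OF assms, of "mat 1"] by simp

lemma continuous_on_matrix_mult [continuous_intros]:
  fixes f :: "'a::topological_space \<Rightarrow> real^'c^'b" and g :: "'a \<Rightarrow> real^'d^'c"
  assumes "continuous_on S f" "continuous_on S g"
  shows "continuous_on S (\<lambda>x. f x ** g x)"
  unfolding matrix_matrix_mult_def using assms by (auto intro!: continuous_intros)

lemma continuous_on_transpose [continuous_intros]:
  fixes f :: "'a::topological_space \<Rightarrow> real^'c^'b"
  assumes "continuous_on S f"
  shows "continuous_on S (\<lambda>x. transpose (f x))"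
  unfolding transpose_def using assms by (auto intro!: continuous_intros)

lemma compact_stiefel: "compact (stiefel :: (real^'p^'n) set)"
proof -
  have "closed (stiefel :: (real^'p^'n) set)"
    unfolding stiefel_def by (intro closed_Collect_eq continuous_intros)
  moreover have "bounded (stiefel :: (real^'p^'n) set)"
    by (auto simp: bounded_iff norm_stiefel intro!: exI[of _ "norm (mat 1 :: real^'p^'p)"])
  ultimately show ?thesis by (simp add: compact_eq_bounded_closed)
qed

section \<open>Tangent vectors, secants and a retraction\<close>

lemma subspace_stiefel_tangent: "subspace (stiefel_tangent X)"
  unfolding subspace_def stiefel_tangent_def
proof (safe, goal_cases)
  case 1
  then show ?case by (simp add: matrix_algebra)
next
  case (2 x y)
  have "transpose (x + y) ** X + transpose X ** (x + y) =
     (transpose x ** X + transpose X ** x) + (transpose y ** X + transpose X ** y)"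
    by (simp add: matrix_algebra)
  then show ?case using 2 by simp
next
  case (3 c x)
  have "transpose (c *\<^sub>R x) ** X + transpose X ** (c *\<^sub>R x) = c *\<^sub>R (transpose x ** X + transpose X ** x)"
    by (simp add: matrix_algebra scaleR_right_distrib)
  then show ?case using 3 by simp
qed

text \<open>Expanding \<open>transpose Y ** Y = mat 1\<close> around \<open>X\<close> shows that a
  secant fails to be tangent only by a quadratic term.\<close>

lemma stiefel_secant:
  fixes X Y :: "real^'p^'n"
  assumes "X \<in> stiefel" "Y \<in> stiefel"
  shows "transpose X ** (Y - X) + transpose (Y - X) ** X = - (transpose (Y - X) ** (Y - X))"
  using assms by (simp add: matrix_algebra stiefel_mult)

text \<open>By \<open>stiefel_secant\<close> the added term cancels the symmetric part of
  \<open>transpose X ** (Y - X)\<close>. The vector obtained is the orthogonal projection of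
  \<open>Y - X\<close> onto the tangent space.\<close>

lemma stiefel_tangent_secant:
  fixes X Y :: "real^'p^'n"
  assumes "X \<in> stiefel" "Y \<in> stiefel"
  shows "(Y - X) + (1/2) *\<^sub>R (X ** (transpose (Y - X) ** (Y - X))) \<in> stiefel_tangent X"
proof -
  let ?W = "Y - X"
  have "transpose (?W + (1/2) *\<^sub>R (X ** (transpose ?W ** ?W))) ** X
     + transpose X ** (?W + (1/2) *\<^sub>R (X ** (transpose ?W ** ?W)))
     = (transpose ?W ** X + transpose X ** ?W)
       + (1/2) *\<^sub>R (transpose ?W ** ?W) + (1/2) *\<^sub>R (transpose ?W ** ?W)"
    using assms by (simp add: matrix_add_ldistrib matrix_add_rdistrib transpose_add transpose_scaleR
      matrix_scaleR_left matrix_scaleR_right matrix_transpose_mul transpose_transpose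
      matrix_mul_assoc[symmetric] stiefel_mult stiefel_mult_assoc)
  also have "\<dots> = (transpose X ** ?W + transpose ?W ** X) + transpose ?W ** ?W"
    using scaleR_left_distrib[of "1/2" "1/2" "transpose ?W ** ?W"] by (simp add: add_ac)
  also have "\<dots> = 0"
    using stiefel_secant[OF assms] by simp
  finally show ?thesis by (simp add: stiefel_tangent_def)
qed

text \<open>A tangent vector is the initial velocity of a rotation of the ambient space applied to
  \<open>X\<close>. The norm bound, uniform in \<open>X\<close>, later makes the retraction error
  quadratic.\<close>

lemma skew_extension:
  fixes X \<xi> :: "real^'p^'n"
  assumes X: "X \<in> stiefel" and \<xi>: "\<xi> \<in> stiefel_tangent X"
  obtains S :: "real^'n^'n" where "transpose S = - S" "S ** X = \<xi>"
    "norm S \<le> 2 * (norm (mat 1 :: real^'n^'n) + (norm (mat 1 :: real^'p^'p))\<^sup>2) * norm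
        (mat 1 :: real^'p^'p) * norm \<xi>"
proof -
  \<comment> \<open>As \<open>P ** X = (1/2) *\<^sub>R X\<close>, tangency lets the second summand
    of \<open>S ** X\<close> restore the half of \<open>X ** transpose X ** \<xi>\<close> that the
    first one removes from \<open>\<xi>\<close>.\<close>
  define P where "P = mat 1 - (1/2) *\<^sub>R (X ** transpose X)"
  define S where "S = P ** \<xi> ** transpose X - X ** transpose \<xi> ** P"
  have tP: "transpose P = P" by (simp add: P_def matrix_algebra)
  have tan: "transpose \<xi> ** X = - (transpose X ** \<xi>)"
    using \<xi> by (simp add: stiefel_tangent_def eq_neg_iff_add_eq_0)
  have skew: "transpose S = - S" by (simp add: S_def matrix_algebra tP)
  have SX: "S ** X = \<xi>"
    by (simp add: S_def P_def matrix_algebra stiefel_mult[OF X] stiefel_mult_assoc[OF X] tan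
        scaleR_right_diff_distrib flip: scaleR_left_distrib)
  let ?n = "norm (mat 1 :: real^'n^'n)" and ?p = "norm (mat 1 :: real^'p^'p)"
  have "norm (X ** transpose X) \<le> ?p\<^sup>2"
    using norm_matrix_mult_le[of X "transpose X"]
    by (simp add: norm_transpose norm_stiefel[OF X] power2_eq_square)
  then have "norm ((1/2) *\<^sub>R (X ** transpose X)) \<le> ?p\<^sup>2"
    by (rule order_trans[rotated]) simp
  then have P: "norm P \<le> ?n + ?p\<^sup>2"
    unfolding P_def using norm_triangle_ineq4[of "mat 1" "(1/2) *\<^sub>R (X ** transpose X)"] by linarith
  have "norm (P ** \<xi> ** transpose X) \<le> (?n + ?p\<^sup>2) * norm \<xi> * ?p"
    by (intro norm_matrix_mult_le_trans P order_refl) (simp add: norm_transpose norm_stiefel[OF X])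
  moreover have "norm (X ** transpose \<xi> ** P) \<le> ?p * norm \<xi> * (?n + ?p\<^sup>2)"
    by (intro norm_matrix_mult_le_trans P order_refl) (simp_all add: norm_transpose norm_stiefel[OF X])
  ultimately have "norm S \<le> 2 * (?n + ?p\<^sup>2) * ?p * norm \<xi>"
    unfolding S_def using norm_triangle_ineq4[of "P ** \<xi> ** transpose X" "X ** transpose \<xi> ** P"]
    by (simp add: algebra_simps)
  with skew SX that show thesis by blast
qed

text \<open>The Cayley transform of the skew matrix \<open>S\<close> with \<open>S X = \<xi>\<close> gives a retraction that
  moves only the columns in which \<open>\<xi>\<close> is nonzero.\<close>

lemma stiefel_cayley:
  fixes X \<xi> :: "real^'p^'n"
  assumes X: "X \<in> stiefel" and \<xi>: "\<xi> \<in> stiefel_tangent X"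
  obtains Y where "Y \<in> stiefel"
    "norm (Y - (X + \<xi>)) \<le> (norm (mat 1 :: real^'n^'n) + (norm (mat 1 :: real^'p^'p))\<^sup>2) * norm
        (mat 1 :: real^'p^'p) * (norm \<xi>)\<^sup>2"
    "norm (Y - X) \<le> norm \<xi>" "\<And>C. \<xi> \<in> col_space C \<Longrightarrow> Y - X \<in> col_space C"
proof -
  obtain S :: "real^'n^'n" where skew: "transpose S = - S" and SX: "S ** X = \<xi>"
    and nS: "norm S \<le> 2 * (norm (mat 1 :: real^'n^'n) + (norm (mat 1 :: real^'p^'p))\<^sup>2) * norm
        (mat 1 :: real^'p^'p) * norm \<xi>"
    using skew_extension[OF X \<xi>] by blast
  \<comment> \<open>The point sought solves \<open>M ** Y = N ** X\<close>.\<close>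
  define M where "M = mat 1 - (1/2) *\<^sub>R S"
  define N where "N = mat 1 + (1/2) *\<^sub>R S"
  have tM: "transpose M = N" "transpose N = M"
    by (simp_all add: M_def N_def matrix_algebra skew)
  have comm: "M ** N = N ** M"
  proof -
    have "(mat 1 - H) ** (mat 1 + H) = (mat 1 + H) ** (mat 1 - H)" for H :: "real^'n^'n"
      by (simp add: matrix_algebra)
    then show ?thesis by (simp add: M_def N_def)
  qed
  have skew0: "A \<bullet> (S ** A) = 0" for A :: "real^'q^'n"
    using inner_matrix_mult_left[of S A A] inner_commute[of A "S ** A"]
    by (simp add: skew matrix_minus_left)
  \<comment> \<open>Skewness removes the cross term, so \<open>M\<close> never shrinks a norm. This
    gives invertibility and replaces an estimate of the inverse.\<close>
  have expand: "norm A \<le> norm (M ** A)" for A :: "real^'q^'n"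
  proof -
    have "M ** A = A - (1/2) *\<^sub>R (S ** A)"
      by (simp add: M_def matrix_diff_rdistrib matrix_scaleR_left)
    then have "(norm (M ** A))\<^sup>2 = (norm A)\<^sup>2 + (1/4) * (norm (S ** A))\<^sup>2"
      using skew0[of A] inner_commute[of A "S ** A"]
      by (simp add: power2_norm_eq_inner inner_diff_left inner_diff_right)
    then show ?thesis
      using power2_le_imp_le[of "norm A" "norm (M ** A)"] by simp
  qed
  have "\<forall>v. M *v v = 0 \<longrightarrow> v = 0"
  proof safe
    fix v assume v: "M *v v = 0"
    \<comment> \<open>A vector is read as a one-column matrix so that \<open>expand\<close>
      applies.\<close>
    let ?A = "(\<chi> i j. v $ i) :: real^1^'n"
    have "M ** ?A = 0"
      using v by (simp add: vec_eq_iff matrix_matrix_mult_def matrix_vector_mult_def)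
    then have "?A = 0" using expand[of ?A] by simp
    then show "v = 0" by (simp add: vec_eq_iff)
  qed
  then obtain K where KM: "K ** M = mat 1"
    using matrix_left_invertible_ker by blast
  then have MK: "M ** K = mat 1"
    by (simp add: matrix_left_right_inverse)
  have tK: "N ** transpose K = mat 1" "transpose K ** N = mat 1"
    using arg_cong[OF KM, of transpose] arg_cong[OF MK, of transpose] by (simp_all add: matrix_algebra tM)
  define Y where "Y = K ** (N ** X)"
  have MY: "M ** Y = N ** X"
    by (simp add: Y_def matrix_mul_assoc MK)
  \<comment> \<open>\<open>M\<close> commutes with \<open>N\<close>, hence with its inverse
    \<open>transpose K\<close>; this makes \<open>K ** N\<close> orthogonal.\<close>
  have "M ** transpose K = transpose K ** (N ** M) ** transpose K"
    by (simp add: matrix_mul_assoc tK)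
  also have "\<dots> = transpose K ** M"
    unfolding comm[symmetric] by (simp add: matrix_mul_assoc[symmetric] tK)
  finally have KN: "M ** (transpose K ** (K ** N)) = mat 1"
    by (simp add: matrix_mul_assoc) (simp add: matrix_mul_assoc[symmetric] MK tK)
  have "transpose Y ** Y = transpose X ** ((M ** (transpose K ** (K ** N))) ** X)"
    by (simp add: Y_def matrix_algebra tM)
  also have "\<dots> = mat 1" by (simp add: KN stiefel_mult[OF X])
  finally have "Y \<in> stiefel" by (simp add: stiefel_def)
  \<comment> \<open>The terms of order zero and one cancel because \<open>S ** X = \<xi>\<close>.
    The remainder is quadratic, as \<open>norm S\<close> is bounded by a multiple of
    \<open>norm \<xi>\<close>.\<close>
  have "M ** (Y - (X + \<xi>)) = (1/2) *\<^sub>R (S ** \<xi>)"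
    by (simp add: matrix_diff_ldistrib MY)
      (simp add: M_def N_def matrix_algebra SX scaleR_right_distrib flip: scaleR_left_distrib)
  then have "norm (Y - (X + \<xi>)) \<le> (1/2) * norm (S ** \<xi>)"
    using expand[of "Y - (X + \<xi>)"] by simp
  also have "\<dots> \<le> (1/2) * (norm S * norm \<xi>)"
    using norm_matrix_mult_le[of S \<xi>] by simp
  also have "\<dots> \<le> (1/2) * (2 * (norm (mat 1 :: real^'n^'n) + (norm (mat 1 :: real^'p^'p))\<^sup>2) * norm
      (mat 1 :: real^'p^'p) * norm \<xi> * norm \<xi>)"
    by (intro mult_left_mono mult_right_mono nS) auto
  finally have err: "norm (Y - (X + \<xi>))
      \<le> (norm (mat 1 :: real^'n^'n) + (norm (mat 1 :: real^'p^'p))\<^sup>2) * norm (mat 1 :: real^'p^'p) *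
          (norm \<xi>)\<^sup>2"
    by (simp add: power2_eq_square algebra_simps)
  have MYX: "M ** (Y - X) = \<xi>"
    by (simp add: matrix_diff_ldistrib MY)
      (simp add: M_def N_def matrix_algebra SX flip: scaleR_left_distrib)
  \<comment> \<open>Left multiplication acts column by column, so zero columns of
    \<open>\<xi>\<close> stay zero in \<open>Y - X\<close>.\<close>
  then have YX: "Y - X = K ** \<xi>"
    by (metis KM matrix_mul_assoc matrix_mul_lid)
  have "norm (Y - X) \<le> norm \<xi>"
    using expand[of "Y - X"] by (simp add: MYX)
  have "Y - X \<in> col_space C" if "\<xi> \<in> col_space C" for C
    using that by (auto simp: YX col_space_def matrix_matrix_mult_def)
  with \<open>Y \<in> stiefel\<close> err \<open>norm (Y - X) \<le> norm \<xi>\<close> that show thesis by blast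
qed

text \<open>One constant serves the whole manifold, since the Cayley estimates involve only norms of
  identity matrices. The clause on \<open>col_space\<close> lets the retracted point compete in the
  block projection.\<close>

lemma stiefel_retraction:
  "\<exists>K>0. \<forall>X\<in>(stiefel :: (real^'p^'n) set). \<forall>\<xi>\<in>stiefel_tangent X. \<exists>Y\<in>stiefel.
     norm (Y - (X + \<xi>)) \<le> K * (norm \<xi>)\<^sup>2 \<and> norm (Y - X) \<le> norm \<xi>
         \<and> (\<forall>C. \<xi> \<in> col_space C \<longrightarrow> Y - X \<in> col_space C)"
proof -
  let ?n = "norm (mat 1 :: real^'n^'n)" and ?p = "norm (mat 1 :: real^'p^'p)"
  let ?K = "(?n + ?p\<^sup>2) * ?p + 1"
  have "0 < ?K" by (intro add_nonneg_pos mult_nonneg_nonneg add_nonneg_nonneg) auto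
  moreover have "\<exists>Y\<in>stiefel. norm (Y - (X + \<xi>)) \<le> ?K * (norm \<xi>)\<^sup>2 \<and> norm (Y - X) \<le> norm \<xi>
      \<and> (\<forall>C. \<xi> \<in> col_space C \<longrightarrow> Y - X \<in> col_space C)"
    if "X \<in> stiefel" "\<xi> \<in> stiefel_tangent X" for X \<xi> :: "real^'p^'n"
  proof -
    obtain Y where Y: "Y \<in> stiefel" "norm (Y - (X + \<xi>)) \<le> (?n + ?p\<^sup>2) * ?p * (norm \<xi>)\<^sup>2"
      "norm (Y - X) \<le> norm \<xi>" "\<And>C. \<xi> \<in> col_space C \<Longrightarrow> Y - X \<in> col_space C"
      using stiefel_cayley[OF \<open>X \<in> stiefel\<close> \<open>\<xi> \<in> stiefel_tangent X\<close>] by blast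
    have "(?n + ?p\<^sup>2) * ?p * (norm \<xi>)\<^sup>2 \<le> ?K * (norm \<xi>)\<^sup>2"
      by (rule mult_right_mono) auto
    with Y show ?thesis by (meson order_trans)
  qed
  ultimately show ?thesis by blast
qed

subsection \<open>Column blocks and the averaging operator\<close>

lemma col_sub_nth: "col_sub C X $ r $ c = (if c \<in> C then X $ r $ c else 0)"
proof -
  have "col_sub C X $ r $ c = (\<Sum>k\<in>UNIV. if k = c then (if c \<in> C then X $ r $ c else 0) else 0)"
    unfolding col_sub_def col_proj_def matrix_matrix_mult_def vec_lambda_beta
    by (rule sum.cong[OF refl]) auto
  then show ?thesis by simp
qed

lemma col_sub_in_col_space: "col_sub C X \<in> col_space C"
  by (simp add: col_space_def col_sub_nth)

lemma col_sub_add_compl: "col_sub C X + col_sub (- C) X = X"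
  by (simp add: vec_eq_iff col_sub_nth)

lemma col_sub_ident: "X \<in> col_space C \<Longrightarrow> col_sub C X = X"
  by (auto simp: vec_eq_iff col_sub_nth col_space_def)

lemma inner_col_sub_left: "\<zeta> \<in> col_space C \<Longrightarrow> col_sub C X \<bullet> \<zeta> = X \<bullet> \<zeta>"
  unfolding inner_matrix_def by (intro sum.cong refl) (auto simp: col_sub_nth col_space_def)

lemma transpose_col_proj: "transpose (col_proj C) = col_proj C"
  by (auto simp: vec_eq_iff transpose_def col_proj_def)

lemma col_proj_mult: "col_proj C ** col_proj D = col_proj (C \<inter> D)"
  by (simp add: vec_eq_iff col_sub_nth[unfolded col_sub_def]) (auto simp: col_proj_def)

lemma col_proj_mult_assoc: "col_proj C ** (col_proj D ** A) = col_proj (C \<inter> D) ** A"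
  by (simp add: matrix_mul_assoc col_proj_mult)

lemma col_proj_empty: "col_proj {} = 0"
  by (simp add: vec_eq_iff col_proj_def)

definition block :: "nat \<Rightarrow> (nat \<Rightarrow> 'p set) \<Rightarrow> 'p \<Rightarrow> nat" where
  "block l C c = (THE a. a \<in> {1..l} \<and> c \<in> C a)"

lemma block_unique:
  assumes "column_partition l C" "a \<in> {1..l}" "c \<in> C a" "b \<in> {1..l}" "c \<in> C b"
  shows "a = b"
proof -
  have "disjoint (C ` {1..l})" and inj: "inj_on C {1..l}"
    using assms(1) by (auto simp: column_partition_def partition_on_def)
  then have "C a = C b"
    using assms by (metis IntI disjointD empty_iff imageI)
  then show ?thesis using inj assms by (auto dest: inj_onD)
qed

lemma block:
  assumes "column_partition l C"
  shows "block l C c \<in> {1..l} \<and> c \<in> C (block l C c)"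
proof -
  have "c \<in> \<Union> (C ` {1..l})"
    using assms by (auto simp: column_partition_def partition_on_def)
  then obtain a where "a \<in> {1..l}" "c \<in> C a" by blast
  then have "\<exists>!a. a \<in> {1..l} \<and> c \<in> C a"
    using block_unique[OF assms] by blast
  then show ?thesis unfolding block_def by (rule theI')
qed

text \<open>Block indices turn sums over pairs into counting problems for two-element sets.\<close>

lemma mem_pair_cols:
  assumes "column_partition l C" "P \<in> pairs l"
  shows "c \<in> pair_cols C P \<longleftrightarrow> block l C c \<in> P"
proof -
  have "P \<subseteq> {1..l}" using assms(2) by (simp add: pairs_def)
  then show ?thesis
    using block[OF assms(1), of c] block_unique[OF assms(1)] unfolding pair_cols_def by blast
qed

lemma finite_pairs: "finite (pairs l)"
  unfolding pairs_def by (rule finite_subset[of _ "Pow {1..l}"]) auto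

lemma card_pairs: "card (pairs l) = l choose 2"
  using n_subsets[of "{1..l}" 2] by (simp add: pairs_def)

lemma card_pairs_mem:
  assumes "a \<in> {1..l}"
  shows "card {P \<in> pairs l. a \<in> P} = l - 1"
proof -
  have "{P \<in> pairs l. a \<in> P} = (\<lambda>b. {a, b}) ` ({1..l} - {a})"
    using assms by (auto simp: pairs_def card_2_iff image_iff)
  moreover have "inj_on (\<lambda>b. {a, b}) ({1..l} - {a})"
    by (auto simp: inj_on_def doubleton_eq_iff)
  ultimately show ?thesis using assms by (simp add: card_image)
qed

text \<open>Of the \<open>l - 1\<close> pairs through \<open>a\<close>, exactly
  \<open>{a, b}\<close> also contains \<open>b\<close>.\<close>

lemma card_pairs_mem_not_mem:
  assumes "a \<in> {1..l}" "b \<in> {1..l}" "a \<noteq> b"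
  shows "card {P \<in> pairs l. a \<in> P \<and> b \<notin> P} = l - 2"
proof -
  have "{P \<in> pairs l. a \<in> P \<and> b \<in> P} = {{a, b}}"
    using assms by (auto simp: pairs_def card_2_iff)
  moreover have "{P \<in> pairs l. a \<in> P \<and> b \<notin> P} = {P \<in> pairs l. a \<in> P} - {P \<in> pairs l. a \<in> P \<and> b \<in> P}"
    by auto
  ultimately show ?thesis
    using card_pairs_mem[OF assms(1)] assms by (simp add: card_Diff_singleton pairs_def)
qed

section \<open>Off-diagonal blocks and the closed form of the averaging operator\<close>

definition off_block :: "nat \<Rightarrow> (nat \<Rightarrow> 'p set) \<Rightarrow> real^'p^'p \<Rightarrow> real^'p^'p" where
  "off_block l C M = (\<chi> i j. if block l C i = block l C j then 0 else M $ i $ j)"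

lemma off_block_simps:
  "off_block l C (A + B) = off_block l C A + off_block l C B"
  "off_block l C (A - B) = off_block l C A - off_block l C B"
  "off_block l C (- A) = - off_block l C A"
  "off_block l C (c *\<^sub>R A) = c *\<^sub>R off_block l C A"
  "off_block l C (off_block l C A) = off_block l C A"
  "off_block l C (mat 1) = 0"
  "off_block l C 0 = 0"
  by (auto simp: vec_eq_iff off_block_def mat_def)

lemma transpose_off_block: "transpose (off_block l C A) = off_block l C (transpose A)"
  by (auto simp: vec_eq_iff off_block_def transpose_def)

lemma inner_off_block: "off_block l C A \<bullet> off_block l C B = off_block l C A \<bullet> B"
  unfolding inner_matrix_def by (intro sum.cong refl) (auto simp: off_block_def)

lemma norm_off_block_le: "norm (off_block l C A) \<le> norm A"
proof -
  have "off_block l C A \<bullet> off_block l C A \<le> A \<bullet> A"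
    unfolding inner_matrix_def by (intro sum_mono) (auto simp: off_block_def)
  then show ?thesis by (simp add: norm_eq_sqrt_inner)
qed

text \<open>Counted entry by entry: column \<open>d\<close> of \<open>\<xi>\<close> is kept by the
  \<open>l - 1\<close> pairs containing its block. The product of \<open>X$r$c\<close> and
  \<open>?m$c$d\<close> is subtracted for the pairs that contain the block of \<open>d\<close> but
  not that of \<open>c\<close>: \<open>l - 2\<close> of them for distinct blocks, none for equal
  ones.\<close>

lemma avg_op_eq:
  fixes X \<xi> :: "real^'p^'n"
  assumes "2 \<le> l" and part: "column_partition l C"
  shows "avg_op l C X \<xi> = (2 / real l) *\<^sub>R \<xi>
    - (2 * (real l - 2) / (real l * (real l - 1))) *\<^sub>R (X ** off_block l C (transpose X ** \<xi>))"
proof -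
  let ?m = "transpose X ** \<xi>" and ?b = "block l C"
  define T where "T = (\<lambda>P. let Z = col_sub (- pair_cols C P) X
           in (mat 1 - Z ** transpose Z) ** col_sub (pair_cols C P) \<xi>)"
  have T: "T P $ r $ d = (if ?b d \<in> P then \<xi>$r$d else 0) -
        (\<Sum>c\<in>UNIV. X$r$c * ?m$c$d * (if ?b d \<in> P \<and> ?b c \<notin> P then 1 else 0))"
    if "P \<in> pairs l" for P r d
  proof -
    let ?Z = "col_sub (- pair_cols C P) X"
    have m: "(transpose ?Z ** col_sub (pair_cols C P) \<xi>)$c$d
        = (if ?b d \<in> P \<and> ?b c \<notin> P then ?m$c$d else 0)" for c
      by (auto simp: matrix_matrix_mult_def transpose_def col_sub_nth mem_pair_cols[OF part that])
    have "T P = col_sub (pair_cols C P) \<xi> - ?Z ** (transpose ?Z ** col_sub (pair_cols C P) \<xi>)"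
      by (simp add: T_def Let_def matrix_diff_rdistrib matrix_mul_assoc)
    then have "T P $ r $ d = col_sub (pair_cols C P) \<xi> $ r $ d
       - (\<Sum>c\<in>UNIV. ?Z$r$c * (transpose ?Z ** col_sub (pair_cols C P) \<xi>)$c$d)"
      by (simp add: matrix_matrix_mult_def[of ?Z])
    also have "\<dots> = (if ?b d \<in> P then \<xi>$r$d else 0) -
        (\<Sum>c\<in>UNIV. X$r$c * ?m$c$d * (if ?b d \<in> P \<and> ?b c \<notin> P then 1 else 0))"
      unfolding m by (intro arg_cong2[where f="(-)"] sum.cong refl)
        (auto simp: col_sub_nth mem_pair_cols[OF part that])
    finally show ?thesis .
  qed
  have count1: "(\<Sum>P\<in>pairs l. if ?b d \<in> P then x else 0) = (real l - 1) * x" for d and x :: real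
  proof -
    have "(\<Sum>P\<in>pairs l. if ?b d \<in> P then x else 0) = real (card {P \<in> pairs l. ?b d \<in> P}) * x"
      by (simp add: sum.If_cases finite_pairs Int_def)
    then show ?thesis using card_pairs_mem block[OF part, of d] assms(1) by (simp add: of_nat_diff)
  qed
  have count2: "(\<Sum>P\<in>pairs l. if ?b d \<in> P \<and> ?b c \<notin> P then 1 else 0)
      = (if ?b c = ?b d then 0 else real l - 2)" for c d
  proof (cases "?b c = ?b d")
    case False
    have "(\<Sum>P\<in>pairs l. if ?b d \<in> P \<and> ?b c \<notin> P then 1 else 0) = real (card {P \<in> pairs l. ?b d \<in> P
        \<and> ?b c \<notin> P})"
      by (simp add: sum.If_cases finite_pairs Int_def)
    then show ?thesis
      using card_pairs_mem_not_mem[of "?b d" l "?b c"] block[OF part, of d] block[OF part, of c]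
          assms(1) False
      by (simp add: of_nat_diff)
  qed (auto intro!: sum.neutral)
  have "(\<Sum>P\<in>pairs l. T P) = (real l - 1) *\<^sub>R \<xi> - (real l - 2) *\<^sub>R (X ** off_block l C ?m)"
  proof (simp only: vec_eq_iff, intro allI)
    fix r d
    have "(\<Sum>P\<in>pairs l. T P) $ r $ d = (\<Sum>P\<in>pairs l. (if ?b d \<in> P then \<xi>$r$d else 0) -
        (\<Sum>c\<in>UNIV. X$r$c * ?m$c$d * (if ?b d \<in> P \<and> ?b c \<notin> P then 1 else 0)))"
      by (simp add: sum_component T)
    also have "\<dots> = (real l - 1) * \<xi>$r$d -
        (\<Sum>c\<in>UNIV. \<Sum>P\<in>pairs l. X$r$c * ?m$c$d * (if ?b d \<in> P \<and> ?b c \<notin> P then 1 else 0))"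
      by (simp only: sum_subtractf count1 sum.swap[of _ UNIV "pairs l"])
    also have "\<dots> = (real l - 1) * \<xi>$r$d -
        (\<Sum>c\<in>UNIV. X$r$c * ?m$c$d * (if ?b c = ?b d then 0 else real l - 2))"
      by (simp only: sum_distrib_left[symmetric] count2)
    also have "(\<Sum>c\<in>UNIV. X$r$c * ?m$c$d * (if ?b c = ?b d then 0 else real l - 2))
       = (real l - 2) * (X ** off_block l C ?m)$r$d"
      unfolding matrix_matrix_mult_def[of X "off_block l C ?m"]
      by (auto simp: sum_distrib_left off_block_def intro!: sum.cong)
    finally show "(\<Sum>P\<in>pairs l. T P) $ r $ d
      = ((real l - 1) *\<^sub>R \<xi> - (real l - 2) *\<^sub>R (X ** off_block l C ?m)) $ r $ d"
      by simp
  qed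
  then have "avg_op l C X \<xi> = inverse (real (l choose 2)) *\<^sub>R
      ((real l - 1) *\<^sub>R \<xi> - (real l - 2) *\<^sub>R (X ** off_block l C ?m))"
    by (simp add: avg_op_def T_def)
  moreover have "real (l choose 2) = real l * (real l - 1) / 2"
    using assms(1) by (simp add: choose_two real_of_nat_div of_nat_diff)
  moreover have "inverse (real l * (real l - 1) / 2) * (real l - 1) = 2 / real l"
    "inverse (real l * (real l - 1) / 2) * (real l - 2) = 2 * (real l - 2) / (real l * (real l - 1))"
    using assms(1) by (simp_all add: field_simps)
  ultimately show ?thesis
    by (simp only: scaleR_right_diff_distrib scaleR_scaleR)
qed

text \<open>On the Stiefel manifold E, mapping \<open>\<xi>\<close> to
  \<open>X ** off_block l C (transpose X ** \<xi>)\<close>, is idempotent. So a I - b E has the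
  inverse (1/a) I + (b / (a (a - b))) E, evaluated here for the coefficients a, b of
  \<open>avg_op_eq\<close>.\<close>

definition avg_inv :: "nat \<Rightarrow> (nat \<Rightarrow> 'p set) \<Rightarrow> real^'p^'n \<Rightarrow> real^'p^'n \<Rightarrow> real^'p^'n" where
  "avg_inv l C X \<xi> = (real l / 2) *\<^sub>R (\<xi> + (real l - 2) *\<^sub>R (X ** off_block l C (transpose X ** \<xi>)))"

lemma
  fixes X \<xi> :: "real^'p^'n"
  assumes "2 \<le> l" "column_partition l C" "X \<in> stiefel"
  shows avg_op_avg_inv: "avg_op l C X (avg_inv l C X \<xi>) = \<xi>"
    and avg_inv_avg_op: "avg_inv l C X (avg_op l C X \<xi>) = \<xi>"
proof -
  let ?E = "X ** off_block l C (transpose X ** \<xi>)"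
  have l: "real l > 1" using assms(1) by simp
  have "X ** off_block l C (transpose X ** avg_inv l C X \<xi>) = (real l / 2 * (1 + (real l - 2))) *\<^sub>R ?E"
    using assms(3)
    by (simp add: avg_inv_def off_block_simps matrix_algebra stiefel_mult_assoc flip: scaleR_left_distrib)
      (simp add: algebra_simps)
  moreover have "2 * (real l - 2) / (real l * (real l - 1)) * (real l / 2 * (1 + (real l - 2)))
      = real l - 2"
    using l by (simp add: field_simps)
  ultimately show "avg_op l C X (avg_inv l C X \<xi>) = \<xi>"
    using l unfolding avg_op_eq[OF assms(1,2)] by (simp add: avg_inv_def)
  have "X ** off_block l C (transpose X ** avg_op l C X \<xi>)
     = (2 / real l - 2 * (real l - 2) / (real l * (real l - 1))) *\<^sub>R ?E"
    using assms(3) unfolding avg_op_eq[OF assms(1,2)]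
    by (simp add: off_block_simps matrix_algebra stiefel_mult_assoc scaleR_left_diff_distrib)
  moreover have "real l / 2 * ((real l - 2) * (2 / real l - 2 * (real l - 2) / (real l * (real l - 1))))
     = real l / 2 * (2 * (real l - 2) / (real l * (real l - 1)))"
    using l by (simp add: field_simps)
  ultimately show "avg_inv l C X (avg_op l C X \<xi>) = \<xi>"
    using l unfolding avg_inv_def by (simp only: scaleR_right_distrib scaleR_scaleR)
     (simp add: avg_op_eq[OF assms(1,2)] scaleR_right_diff_distrib)
qed

text \<open>Stated for arbitrary matrices: with \<open>Y\<close> fixed it is a quadratic polynomial
  in \<open>X\<close>, which can be expanded exactly in the ambient space.\<close>

definition block_dist :: "nat \<Rightarrow> (nat \<Rightarrow> 'p set) \<Rightarrow> real^'p^'n \<Rightarrow> real^'p^'n \<Rightarrow> real" where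
  "block_dist l C X Y = real l / 2 *
     ((norm (X - Y))\<^sup>2 + (real l - 2) * (norm (off_block l C (transpose X ** Y)))\<^sup>2)"

text \<open>\<open>transpose X ** X\<close> is the identity and has no off-diagonal blocks, so
  \<open>Y - X\<close> and \<open>Y\<close> give the same off-diagonal part. The radicand is
  nonnegative, hence squaring undoes the root.\<close>

lemma avg_inv_norm_sq:
  fixes X Y :: "real^'p^'n"
  assumes "2 \<le> l" "column_partition l C" "X \<in> stiefel"
  shows "(avg_inv_norm l C X (Y - X))\<^sup>2 = block_dist l C X Y"
    and "0 \<le> avg_inv_norm l C X (Y - X)"
proof -
  let ?o = "off_block l C (transpose X ** (Y - X))"
  have "inv (avg_op l C X) = avg_inv l C X"
    by (rule inv_equality) (simp_all add: avg_op_avg_inv[OF assms] avg_inv_avg_op[OF assms])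
  moreover have "avg_inv l C X (Y - X) \<bullet> (Y - X)
     = real l / 2 * ((norm (Y - X))\<^sup>2 + (real l - 2) * (norm ?o)\<^sup>2)"
    by (simp add: avg_inv_def inner_add_left inner_matrix_mult_left power2_norm_eq_inner inner_off_block)
  moreover have "?o = off_block l C (transpose X ** Y)"
    using assms(3) by (simp add: matrix_diff_ldistrib off_block_simps stiefel_mult)
  ultimately have *: "inv (avg_op l C X) (Y - X) \<bullet> (Y - X) = block_dist l C X Y"
    by (simp add: block_dist_def norm_minus_commute)
  moreover have "0 \<le> block_dist l C X Y"
    using assms(1) by (simp add: block_dist_def)
  ultimately show "(avg_inv_norm l C X (Y - X))\<^sup>2 = block_dist l C X Y"
    "0 \<le> avg_inv_norm l C X (Y - X)"
    by (simp_all add: avg_inv_norm_def)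
qed

subsection \<open>One step of the algorithm\<close>

text \<open>The variational inequality of the projection, tested at the projected point plus and
  minus \<open>z\<close>, gives orthogonality of the residual.\<close>

lemma closest_point_subspace:
  fixes S :: "'a::euclidean_space set"
  assumes "subspace S"
  shows "closest_point S a \<in> S"
    and "z \<in> S \<Longrightarrow> closest_point S a \<bullet> z = a \<bullet> z"
proof -
  let ?c = "closest_point S a"
  have S: "closed S" "convex S" "S \<noteq> {}"
    using assms by (auto simp: closed_subspace subspace_imp_convex subspace_def)
  show c: "?c \<in> S" by (rule closest_point_in_set) (use S in auto)
  have orth: "?c \<bullet> z = a \<bullet> z" if "z \<in> S" for z
  proof -
    have "?c + z \<in> S" "?c - z \<in> S"
      using assms c that by (simp_all add: subspace_add subspace_diff)
    then have "(a - ?c) \<bullet> (?c + z - ?c) \<le> 0" "(a - ?c) \<bullet> (?c - z - ?c) \<le> 0"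
      using closest_point_dot[OF S(2,1)] by blast+
    then show ?thesis by (simp add: inner_diff_left)
  qed
  then show "z \<in> S \<Longrightarrow> ?c \<bullet> z = a \<bullet> z" .
qed

lemma col_space_col_proj:
  assumes "\<xi> \<in> col_space C"
  shows "\<xi> ** col_proj C = \<xi>" "\<xi> ** col_proj (- C) = 0"
    "col_proj C ** transpose \<xi> = transpose \<xi>" "col_proj (- C) ** transpose \<xi> = 0"
proof -
  show 1: "\<xi> ** col_proj C = \<xi>" using col_sub_ident[OF assms] by (simp add: col_sub_def)
  show 2: "\<xi> ** col_proj (- C) = 0"
    using assms by (auto simp: vec_eq_iff col_sub_nth[unfolded col_sub_def] col_space_def)
  show "col_proj C ** transpose \<xi> = transpose \<xi>" "col_proj (- C) ** transpose \<xi> = 0"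
    using arg_cong[OF 1, of transpose] arg_cong[OF 2, of transpose]
    by (simp_all add: matrix_algebra transpose_col_proj)
qed

text \<open>For \<open>\<xi>\<close> supported on \<open>C\<close>, the two block conditions are the
  diagonal and the mixed block of \<open>transpose \<xi> ** X + transpose X ** \<xi> = 0\<close>;
  compressing with \<open>col_proj\<close> isolates them.\<close>

lemma block_tangent_eq: "block_tangent C X = stiefel_tangent X \<inter> col_space C"
proof (intro equalityI subsetI)
  fix \<xi> assume "\<xi> \<in> block_tangent C X"
  then have cs: "\<xi> \<in> col_space C"
    and t: "transpose \<xi> ** col_sub C X + transpose (col_sub C X) ** \<xi> = 0"
    and z: "transpose (col_sub (- C) X) ** \<xi> = 0"
    by (auto simp: block_tangent_def)
  have z': "transpose \<xi> ** col_sub (- C) X = 0"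
    using arg_cong[OF z, of transpose] by (simp add: matrix_algebra)
  have "transpose \<xi> ** X + transpose X ** \<xi> =
     transpose \<xi> ** (col_sub C X + col_sub (- C) X) + transpose (col_sub C X + col_sub (- C) X) ** \<xi>"
    by (simp add: col_sub_add_compl)
  also have "\<dots> = 0"
    using t by (simp add: matrix_add_ldistrib matrix_add_rdistrib transpose_add z z')
  finally show "\<xi> \<in> stiefel_tangent X \<inter> col_space C"
    using cs by (simp add: stiefel_tangent_def)
next
  fix \<xi> assume "\<xi> \<in> stiefel_tangent X \<inter> col_space C"
  then have cs: "\<xi> \<in> col_space C" and t: "transpose \<xi> ** X + transpose X ** \<xi> = 0"
    by (auto simp: stiefel_tangent_def)
  note P = col_space_col_proj[OF cs]
  have P': "col_proj C ** (transpose \<xi> ** A) = transpose \<xi> ** A"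
    "col_proj (- C) ** (transpose \<xi> ** A) = 0" for A :: "real^'q^'b"
    by (simp_all add: matrix_mul_assoc P)
  have "transpose \<xi> ** col_sub C X + transpose (col_sub C X) ** \<xi>
      = col_proj C ** (transpose \<xi> ** X + transpose X ** \<xi>) ** col_proj C"
    by (simp add: col_sub_def matrix_algebra transpose_col_proj P P')
  then have 1: "transpose \<xi> ** col_sub C X + transpose (col_sub C X) ** \<xi> = 0" by (simp add: t)
  have "transpose (col_sub (- C) X) ** \<xi> = col_proj (- C) ** (transpose \<xi> ** X + transpose X ** \<xi>)"
    by (simp add: col_sub_def matrix_algebra transpose_col_proj P P')
  then have "transpose (col_sub (- C) X) ** \<xi> = 0" by (simp add: t)
  with 1 cs show "\<xi> \<in> block_tangent C X"
    by (simp add: block_tangent_def)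
qed

lemma subspace_col_space: "subspace (col_space C)"
  by (auto simp: subspace_def col_space_def)

lemma subspace_block_tangent: "subspace (block_tangent C X)"
  unfolding block_tangent_eq by (intro subspace_inter subspace_stiefel_tangent subspace_col_space)

text \<open>The Gram matrix of \<open>Y + col_sub (- C) X\<close> splits into blocks along
  \<open>C\<close> and its complement; the complementary diagonal block is inherited from
  \<open>X\<close>. Hence exchanging the block columns keeps the iterate feasible.\<close>

lemma block_manifold_iff:
  assumes X: "X \<in> stiefel"
  shows "Y \<in> block_manifold C X \<longleftrightarrow> Y \<in> col_space C \<and> Y + col_sub (- C) X \<in> stiefel"
proof -
  let ?Z = "col_sub (- C) X"
  have ZZ: "transpose ?Z ** ?Z = col_proj (- C)"
    using X by (simp add: col_sub_def matrix_algebra transpose_col_proj stiefel_mult_assoc col_proj_mult)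
  have one: "col_proj C + col_proj (- C) = mat 1"
    by (auto simp: vec_eq_iff col_proj_def mat_def)
  show ?thesis
  proof (intro iffI conjI)
    assume Y: "Y \<in> block_manifold C X"
    then show "Y \<in> col_space C" by (simp add: block_manifold_def stiefel_cols_def)
    have YY: "transpose Y ** Y = col_proj C" and ZY: "transpose ?Z ** Y = 0"
      using Y by (auto simp: block_manifold_def stiefel_cols_def)
    have "transpose Y ** ?Z = 0" using arg_cong[OF ZY, of transpose] by (simp add: matrix_algebra)
    then show "Y + ?Z \<in> stiefel"
      by (simp add: stiefel_def matrix_add_ldistrib matrix_add_rdistrib transpose_add YY ZY ZZ one)
  next
    assume "Y \<in> col_space C \<and> Y + ?Z \<in> stiefel"
    then have cs: "Y \<in> col_space C" and S: "Y + ?Z \<in> stiefel" by auto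
    have Y: "Y = (Y + ?Z) ** col_proj C" and Z: "?Z = (Y + ?Z) ** col_proj (- C)"
      using col_space_col_proj[OF cs]
      by (simp_all add: matrix_add_rdistrib) (simp_all add: col_sub_def matrix_algebra col_proj_mult
          col_proj_empty)
    have "transpose Y ** Y = transpose ((Y + ?Z) ** col_proj C) ** ((Y + ?Z) ** col_proj C)"
      using Y by simp
    also have "\<dots> = col_proj C"
      by (simp only: matrix_transpose_mul transpose_col_proj matrix_mul_assoc[symmetric]
          stiefel_mult_assoc[OF S] col_proj_mult Int_absorb)
    finally have YY: "transpose Y ** Y = col_proj C" .
    have "transpose ?Z ** Y = transpose ((Y + ?Z) ** col_proj (- C)) ** ((Y + ?Z) ** col_proj C)"
      using Y Z by simp
    also have "\<dots> = 0"
      by (simp only: matrix_transpose_mul transpose_col_proj matrix_mul_assoc[symmetric]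
          stiefel_mult_assoc[OF S] col_proj_mult)
        (simp add: col_proj_empty)
    finally show "Y \<in> block_manifold C X"
      using cs YY by (simp add: block_manifold_def stiefel_cols_def)
  qed
qed

lemma closed_block_manifold: "closed (block_manifold C (X :: real^'p^'n))"
proof -
  have "block_manifold C X = col_space C \<inter> {Y. transpose Y ** Y = col_proj C}
      \<inter> {Y. transpose (col_sub (- C) X) ** Y = 0}"
    by (auto simp: block_manifold_def stiefel_cols_def)
  moreover have "closed (col_space C :: (real^'p^'n) set)"
    by (intro closed_subspace subspace_col_space)
  ultimately show ?thesis
    by (simp only:) (intro closed_Int closed_Collect_eq continuous_intros)
qed

definition block_grad :: "'p set \<Rightarrow> real^'p^'n \<Rightarrow> real^'p^'n \<Rightarrow> real^'p^'n" where
  "block_grad C X V = closest_point (block_tangent C X) (col_sub C V)"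

lemma
  shows block_grad_in: "block_grad C X V \<in> block_tangent C X"
    and inner_block_grad: "\<zeta> \<in> block_tangent C X \<Longrightarrow> block_grad C X V \<bullet> \<zeta> = V \<bullet> \<zeta>"
    and norm_block_grad_le: "norm (block_grad C X V) \<le> norm V"
proof -
  show G: "block_grad C X V \<in> block_tangent C X"
    unfolding block_grad_def by (rule closest_point_subspace[OF subspace_block_tangent])
  show i: "block_grad C X V \<bullet> \<zeta> = V \<bullet> \<zeta>" if "\<zeta> \<in> block_tangent C X" for \<zeta>
    using closest_point_subspace(2)[OF subspace_block_tangent that] that
    by (simp add: block_grad_def inner_col_sub_left block_tangent_def)
  have "norm (block_grad C X V) * norm (block_grad C X V) \<le> norm V * norm (block_grad C X V)"
    using i[OF G] norm_cauchy_schwarz[of V "block_grad C X V"]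
    by (simp add: power2_norm_eq_inner flip: power2_eq_square)
  then show "norm (block_grad C X V) \<le> norm V"
    by (cases "block_grad C X V = 0") auto
qed

text \<open>The projected block is at least as close to the trial point as the retracted one, whose
  error is quadratic with a uniform constant.\<close>

lemma rssm_step_near:
  "\<exists>K>0. \<forall>X\<in>(stiefel :: (real^'p^'n) set). \<forall>C V \<gamma>. rssm_step C \<gamma> V X \<in> stiefel \<and>
     norm (rssm_step C \<gamma> V X - (X - \<gamma> *\<^sub>R block_grad C X V)) \<le> K * \<gamma>\<^sup>2 * (norm V)\<^sup>2"
proof -
  obtain K where K: "K > 0" "\<And>X \<xi> :: real^'p^'n. X \<in> stiefel \<Longrightarrow> \<xi> \<in> stiefel_tangent X \<Longrightarrow>
     \<exists>Y\<in>stiefel. norm (Y - (X + \<xi>)) \<le> K * (norm \<xi>)\<^sup>2 \<and> (\<forall>C. \<xi> \<in> col_space C \<longrightarrow> Y - X \<in> col_space C)"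
    using stiefel_retraction[where 'p='p and 'n='n] by blast
  have "rssm_step C \<gamma> V X \<in> stiefel \<and>
     norm (rssm_step C \<gamma> V X - (X - \<gamma> *\<^sub>R block_grad C X V)) \<le> K * \<gamma>\<^sup>2 * (norm V)\<^sup>2"
    if X: "X \<in> stiefel" for X :: "real^'p^'n" and C V \<gamma>
  proof -
    let ?G = "block_grad C X V" and ?Z = "col_sub (- C) X"
    let ?a = "col_sub C X - \<gamma> *\<^sub>R ?G"
    let ?N = "closest_point (block_manifold C X) ?a"
    have "- \<gamma> *\<^sub>R ?G \<in> block_tangent C X"
      using block_grad_in subspace_block_tangent by (rule subspace_scale[rotated])
    then have T: "- \<gamma> *\<^sub>R ?G \<in> stiefel_tangent X" "- \<gamma> *\<^sub>R ?G \<in> col_space C"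
      by (auto simp: block_tangent_eq)
    obtain Y where Y: "Y \<in> stiefel" "norm (Y - (X + - \<gamma> *\<^sub>R ?G)) \<le> K * (norm (- \<gamma> *\<^sub>R ?G))\<^sup>2"
      "Y - X \<in> col_space C"
      using K(2)[OF X T(1)] T(2) by blast
    have "Y - ?Z = (Y - X) + col_sub C X"
      using col_sub_add_compl[of C X] by (simp add: algebra_simps)
    then have "Y - ?Z \<in> col_space C"
      using subspace_add[OF subspace_col_space Y(3) col_sub_in_col_space] by (simp only:)
    \<comment> \<open>The retraction changes only columns in \<open>C\<close>. It thus proves the
      block manifold nonempty, so that the closest point is attained, and supplies the
      competitor.\<close>
    then have YM: "Y - ?Z \<in> block_manifold C X"
      using Y(1) by (simp add: block_manifold_iff[OF X])
    have N: "?N \<in> block_manifold C X"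
      by (rule closest_point_in_set[OF closed_block_manifold]) (use YM in blast)
    have step: "rssm_step C \<gamma> V X = ?N + ?Z"
      by (simp add: rssm_step_def Let_def block_grad_def)
    have aX: "?a + ?Z = X - \<gamma> *\<^sub>R ?G"
      using col_sub_add_compl[of C X] by (simp add: algebra_simps)
    have "norm (rssm_step C \<gamma> V X - (X - \<gamma> *\<^sub>R ?G)) = dist ?a ?N"
      unfolding step aX[symmetric] by (simp add: dist_norm norm_minus_commute)
    also have "\<dots> \<le> dist ?a (Y - ?Z)"
      by (rule closest_point_le[OF closed_block_manifold YM])
    also have "\<dots> = norm ((?a + ?Z) - Y)"
      by (simp add: dist_norm algebra_simps)
    also have "\<dots> = norm (Y - (X + - \<gamma> *\<^sub>R ?G))"
      unfolding aX by (simp add: norm_minus_commute)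
    also have "\<dots> \<le> K * (norm (- \<gamma> *\<^sub>R ?G))\<^sup>2" by (rule Y(2))
    also have "\<dots> = K * \<gamma>\<^sup>2 * (norm ?G)\<^sup>2" by (simp add: power_mult_distrib)
    also have "\<dots> \<le> K * \<gamma>\<^sup>2 * (norm V)\<^sup>2"
      using K(1) by (intro mult_left_mono power_mono norm_block_grad_le) auto
    finally show ?thesis
      using N by (simp add: step block_manifold_iff[OF X])
  qed
  with K(1) show ?thesis by blast
qed

section \<open>The average of the block gradients\<close>

text \<open>\<open>R\<close> is a summand of the averaging operator applied to \<open>H\<close>. For
  tangent \<open>H\<close> it is the orthogonal projection of \<open>H\<close> onto the block
  tangent space: the fixed columns are projected away and the \<open>C\<close>-block of
  \<open>transpose X ** H\<close> stays skew.\<close>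

lemma
  fixes X H :: "real^'p^'n" and C :: "'p set"
  defines "R \<equiv> (mat 1 - col_sub (- C) X ** transpose (col_sub (- C) X)) ** col_sub C H"
  assumes X: "X \<in> stiefel"
  shows block_tangent_projection: "H \<in> stiefel_tangent X \<Longrightarrow> R \<in> block_tangent C X"
    and inner_block_tangent_projection: "G \<in> block_tangent C X \<Longrightarrow> R \<bullet> G = H \<bullet> G"
proof -
  let ?Z = "col_sub (- C) X"
  have ZZ: "transpose ?Z ** ?Z = col_proj (- C)"
    using X by (simp add: col_sub_def matrix_algebra transpose_col_proj stiefel_mult_assoc col_proj_mult)
  have R: "R = col_sub C H - ?Z ** (transpose ?Z ** col_sub C H)"
    by (simp add: R_def matrix_diff_rdistrib matrix_mul_assoc)
  show "R \<bullet> G = H \<bullet> G" if G: "G \<in> block_tangent C X"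
  proof -
    have "transpose ?Z ** G = 0" "G \<in> col_space C" using G by (auto simp: block_tangent_def)
    then show ?thesis
      unfolding R by (simp add: inner_diff_left inner_matrix_mult_left inner_col_sub_left)
  qed
  assume H: "H \<in> stiefel_tangent X"
  have ZR: "transpose ?Z ** R = 0"
    unfolding R by (simp add: matrix_diff_ldistrib matrix_mul_assoc ZZ)
      (simp add: col_sub_def matrix_algebra transpose_col_proj col_proj_mult_assoc)
  have cs: "R \<in> col_space C"
    by (simp add: R_def col_sub_def matrix_mul_assoc)
      (simp add: col_sub_in_col_space[unfolded col_sub_def] matrix_mul_assoc)
  have XZ: "transpose (col_sub C X) ** (?Z ** A) = 0" for A :: "real^'q^'p"
    using X by (simp add: col_sub_def matrix_algebra transpose_col_proj stiefel_mult_assoc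
        col_proj_mult_assoc col_proj_empty)
  have XR: "transpose (col_sub C X) ** R = col_proj C ** (transpose X ** H) ** col_proj C"
    unfolding R by (simp add: matrix_diff_ldistrib XZ) (simp add: col_sub_def matrix_algebra
        transpose_col_proj)
  have "transpose R ** col_sub C X = transpose (transpose (col_sub C X) ** R)"
    by (simp add: matrix_algebra)
  also have "\<dots> = col_proj C ** (transpose H ** X) ** col_proj C"
    unfolding XR by (simp add: matrix_algebra transpose_col_proj)
  finally have "transpose R ** col_sub C X + transpose (col_sub C X) ** R
     = col_proj C ** (transpose H ** X + transpose X ** H) ** col_proj C"
    unfolding XR by (simp add: matrix_add_ldistrib matrix_add_rdistrib)
  also have "\<dots> = 0" using H by (simp add: stiefel_tangent_def)
  finally show "R \<in> block_tangent C X"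
    using ZR cs by (simp add: block_tangent_def)
qed

text \<open>\<open>transpose X ** \<xi>\<close> is skew, so its off-diagonal part is skew, and
  \<open>X\<close> times a skew matrix is tangent.\<close>

lemma avg_inv_tangent:
  assumes X: "X \<in> stiefel" and \<xi>: "\<xi> \<in> stiefel_tangent X"
  shows "avg_inv l C X \<xi> \<in> stiefel_tangent X"
proof -
  let ?o = "off_block l C (transpose X ** \<xi>)"
  have skew: "transpose (transpose X ** \<xi>) = - (transpose X ** \<xi>)"
    using \<xi> by (simp add: stiefel_tangent_def matrix_algebra eq_neg_iff_add_eq_0)
  have "transpose ?o = - ?o"
    by (simp add: transpose_off_block skew off_block_simps)
  then have "X ** ?o \<in> stiefel_tangent X"
    by (simp add: stiefel_tangent_def matrix_algebra stiefel_mult_assoc[OF X] stiefel_mult[OF X])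
  then show ?thesis
    unfolding avg_inv_def using \<xi>
    by (intro subspace_scale subspace_add subspace_stiefel_tangent)
qed

text \<open>Self-adjointness moves each block projection from \<open>V\<close> to
  \<open>avg_inv l C X \<xi>\<close>. The projections then sum to a multiple of the averaging
  operator, which undoes its inverse; this is why the inverse operator is the right metric for
  uniformly drawn pairs.\<close>

lemma sum_inner_block_grad:
  fixes X V \<xi> :: "real^'p^'n"
  assumes l: "2 \<le> l" and part: "column_partition l C" and X: "X \<in> stiefel" and \<xi>: "\<xi> \<in> stiefel_tangent X"
  shows "(\<Sum>P\<in>pairs l. avg_inv l C X \<xi> \<bullet> block_grad (pair_cols C P) X V) = real (l choose 2) * (\<xi> \<bullet> V)"
proof -
  let ?H = "avg_inv l C X \<xi>"
  define R where "R P = (mat 1 - col_sub (- pair_cols C P) X ** transpose (col_sub (- pair_cols C P)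
      X)) ** col_sub (pair_cols C P) ?H" for P
  have "?H \<bullet> block_grad (pair_cols C P) X V = R P \<bullet> V" for P
    using inner_block_tangent_projection[OF X block_grad_in[of "pair_cols C P" X V], where H = ?H]
      inner_block_grad[OF block_tangent_projection[OF X avg_inv_tangent[OF X \<xi>]],
        where C = "pair_cols C P" and V = V]
    by (simp add: R_def inner_commute)
  then have "(\<Sum>P\<in>pairs l. ?H \<bullet> block_grad (pair_cols C P) X V) = (\<Sum>P\<in>pairs l. R P) \<bullet> V"
    by (simp add: inner_sum_left)
  also have "(\<Sum>P\<in>pairs l. R P) = real (l choose 2) *\<^sub>R avg_op l C X ?H"
    using l by (simp add: avg_op_def R_def Let_def)
  finally show ?thesis by (simp add: avg_op_avg_inv[OF l part X])
qed

subsection \<open>The block distance\<close>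

definition block_dist_grad :: "nat \<Rightarrow> (nat \<Rightarrow> 'p set) \<Rightarrow> real^'p^'n \<Rightarrow> real^'p^'n \<Rightarrow> real^'p^'n" where
  "block_dist_grad l C X Y
      = real l *\<^sub>R (X - Y + (real l - 2) *\<^sub>R (Y ** off_block l C (transpose Y ** X)))"

text \<open>The second-order Taylor expansion of a quadratic polynomial is exact;
  \<open>block_dist_grad\<close> is its ambient gradient in the first argument.\<close>

lemma block_dist_expand:
  "block_dist l C (X + \<Delta>) Y = block_dist l C X Y + block_dist_grad l C X Y \<bullet> \<Delta>
     + real l / 2 * ((norm \<Delta>)\<^sup>2 + (real l - 2) * (norm (off_block l C (transpose \<Delta> ** Y)))\<^sup>2)"
proof -
  let ?a = "off_block l C (transpose X ** Y)" and ?b = "off_block l C (transpose \<Delta> ** Y)"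
  \<comment> \<open>Self-adjointness of \<open>off_block\<close> and of the matrix products rewrites
    the mixed term as an inner product with \<open>\<Delta>\<close>.\<close>
  have "?a \<bullet> ?b = ?b \<bullet> (transpose X ** Y)"
    by (subst inner_commute) (simp add: inner_off_block)
  also have "\<dots> = ?a \<bullet> (transpose \<Delta> ** Y)"
    by (metis inner_commute inner_off_block)
  also have "\<dots> = (transpose \<Delta> ** Y) \<bullet> ?a" by (rule inner_commute)
  also have "\<dots> = \<Delta> \<bullet> (Y ** transpose ?a)"
    using inner_matrix_mult_left[of "transpose \<Delta>" Y ?a] inner_matrix_mult_right[of \<Delta> ?a Y]
    by (simp add: transpose_transpose inner_commute)
  also have "\<dots> = (Y ** off_block l C (transpose Y ** X)) \<bullet> \<Delta>"
    by (simp add: transpose_off_block matrix_transpose_mul transpose_transpose inner_commute)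
  finally have ab: "(Y ** off_block l C (transpose Y ** X)) \<bullet> \<Delta> = ?a \<bullet> ?b" by simp
  have "X + \<Delta> - Y = (X - Y) + \<Delta>" by simp
  then have 1: "(norm (X + \<Delta> - Y))\<^sup>2 = (norm (X - Y))\<^sup>2 + 2 * ((X - Y) \<bullet> \<Delta>) + (norm \<Delta>)\<^sup>2"
    by (simp only:) (simp add: power2_norm_eq_inner inner_add_left inner_add_right inner_commute)
  have "off_block l C (transpose (X + \<Delta>) ** Y) = ?a + ?b"
    by (simp add: transpose_add matrix_add_rdistrib off_block_simps)
  then have 2: "(norm (off_block l C (transpose (X + \<Delta>) ** Y)))\<^sup>2 = (norm ?a)\<^sup>2 + 2 * (?a \<bullet> ?b)
      + (norm ?b)\<^sup>2"
    by (simp only:) (simp add: power2_norm_eq_inner inner_add_left inner_add_right inner_commute)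
  have 3: "block_dist_grad l C X Y \<bullet> \<Delta> = real l * ((X - Y) \<bullet> \<Delta> + (real l - 2) * (?a \<bullet> ?b))"
    by (simp add: block_dist_grad_def inner_add_left ab)
  show ?thesis unfolding block_dist_def 1 2 3 by (simp add: algebra_simps)
qed

lemma block_dist_self:
  assumes "X \<in> stiefel"
  shows "block_dist l C X X = 0"
  using assms by (simp add: block_dist_def stiefel_mult off_block_simps)

lemma block_dist_ge:
  assumes "2 \<le> l"
  shows "real l / 2 * (norm (X - Y))\<^sup>2 \<le> block_dist l C X Y"
  using assms by (simp add: block_dist_def)

lemma norm_block_dist_grad_le:
  fixes X Y :: "real^'p^'n"
  assumes "2 \<le> l" "X \<in> stiefel" "Y \<in> stiefel"
  defines "c \<equiv> norm (mat 1 :: real^'p^'p)"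
  shows "norm (block_dist_grad l C X Y) \<le> real l * (2 * c + (real l - 2) * c\<^sup>2)"
proof -
  have "norm (Y ** off_block l C (transpose Y ** X)) \<le> norm (transpose Y ** X)"
    using norm_off_block_le by (simp add: norm_stiefel_mult[OF assms(3)])
  also have "\<dots> \<le> c\<^sup>2"
    using norm_matrix_mult_le[of "transpose Y" X] assms
    by (simp add: norm_transpose norm_stiefel power2_eq_square)
  finally have "norm ((real l - 2) *\<^sub>R (Y ** off_block l C (transpose Y ** X))) \<le> (real l - 2) * c\<^sup>2"
    using assms(1) by (simp add: mult_left_mono)
  moreover have "norm (X - Y) \<le> 2 * c"
    using norm_triangle_ineq4[of X Y] assms by (simp add: norm_stiefel)
  ultimately have "norm (X - Y + (real l - 2) *\<^sub>R (Y ** off_block l C (transpose Y ** X)))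
      \<le> 2 * c + (real l - 2) * c\<^sup>2"
    by (rule norm_triangle_mono[rotated])
  then show ?thesis by (simp add: block_dist_grad_def mult_left_mono)
qed

lemma block_dist_diff_le:
  fixes X Y \<Delta> :: "real^'p^'n"
  assumes "2 \<le> l" "Y \<in> stiefel"
  defines "c \<equiv> norm (mat 1 :: real^'p^'p)"
  shows "block_dist l C (X + \<Delta>) Y \<le> block_dist l C X Y + block_dist_grad l C X Y \<bullet> \<Delta>
     + real l / 2 * (1 + (real l - 2) * c\<^sup>2) * (norm \<Delta>)\<^sup>2"
proof -
  have "norm (off_block l C (transpose \<Delta> ** Y)) \<le> norm \<Delta> * c"
    using norm_off_block_le[of l C "transpose \<Delta> ** Y"] norm_matrix_mult_le[of "transpose \<Delta>" Y] assms
    by (simp add: norm_transpose norm_stiefel)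
  then have "(norm (off_block l C (transpose \<Delta> ** Y)))\<^sup>2 \<le> (norm \<Delta> * c)\<^sup>2"
    by (rule power_mono) simp
  then have "(real l - 2) * (norm (off_block l C (transpose \<Delta> ** Y)))\<^sup>2 \<le> (real l - 2) * (norm \<Delta> * c)\<^sup>2"
    using assms(1) by (intro mult_left_mono) auto
  then have "real l / 2 * ((norm \<Delta>)\<^sup>2 + (real l - 2) * (norm (off_block l C (transpose \<Delta> ** Y)))\<^sup>2)
     \<le> real l / 2 * ((norm \<Delta>)\<^sup>2 + (real l - 2) * (norm \<Delta> * c)\<^sup>2)"
    by (intro mult_left_mono) auto
  also have "\<dots> = real l / 2 * (1 + (real l - 2) * c\<^sup>2) * (norm \<Delta>)\<^sup>2"
    by (simp add: power_mult_distrib algebra_simps)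
  finally show ?thesis by (simp add: block_dist_expand)
qed

text \<open>The gradient is bounded on the manifold, and the distance bound \<open>2 * c\<close>
  between its points makes the quadratic remainder linear. The extra \<open>1\<close> in the
  constant secures positivity.\<close>

lemma block_dist_lipschitz:
  assumes l: "2 \<le> l"
  shows "\<exists>K>0. \<forall>X\<in>(stiefel :: (real^'p^'n) set). \<forall>X'\<in>stiefel. \<forall>Y\<in>stiefel.
     block_dist l C X' Y \<le> block_dist l C X Y + K * norm (X' - X)"
proof -
  define c where "c = norm (mat 1 :: real^'p^'p)"
  define a where "a = real l * (2 * c + (real l - 2) * c\<^sup>2)"
  define b where "b = real l / 2 * (1 + (real l - 2) * c\<^sup>2)"
  have c: "c \<ge> 0" by (simp add: c_def)
  have nn: "a \<ge> 0" "b \<ge> 0" using l c by (auto simp: a_def b_def)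
  have "block_dist l C X' Y \<le> block_dist l C X Y + (a + b * (2 * c) + 1) * norm (X' - X)"
    if "X \<in> stiefel" "X' \<in> stiefel" "Y \<in> stiefel" for X X' Y :: "real^'p^'n"
  proof -
    let ?D = "X' - X"
    have "norm ?D \<le> 2 * c"
      using norm_triangle_ineq4[of X' X] that by (simp add: norm_stiefel c_def)
    then have "(norm ?D)\<^sup>2 \<le> 2 * c * norm ?D"
      by (simp add: power2_eq_square mult_right_mono)
    then have "b * (norm ?D)\<^sup>2 \<le> b * (2 * c) * norm ?D"
      using mult_left_mono[OF _ nn(2)] by (simp only: mult.assoc)
    moreover have "block_dist_grad l C X Y \<bullet> ?D \<le> a * norm ?D"
      using norm_cauchy_schwarz[of "block_dist_grad l C X Y" ?D] norm_block_dist_grad_le[OF l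
          that(1,3), of C]
      by (smt (verit) a_def c_def mult_right_mono norm_ge_zero)
    ultimately show ?thesis
      using block_dist_diff_le[OF l that(3), of C X ?D]
      by (simp add: algebra_simps b_def c_def) (smt (verit) norm_ge_zero)
  qed
  moreover have "0 < a + b * (2 * c) + 1" using nn c by (simp add: add_nonneg_pos)
  ultimately show ?thesis by blast
qed

text \<open>On the Stiefel manifold \<open>X\<^sup>T W + W\<^sup>T X = - W\<^sup>T W\<close> for \<open>W = Y - X\<close>, so the derivative of
  the operator \<open>\<A>\<^sub>X\<^sup>-\<^sup>1\<close> along the manifold contributes only at second order in \<open>W\<close>.\<close>

lemma block_dist_grad_approx:
  fixes X Y :: "real^'p^'n"
  assumes l: "2 \<le> l" and X: "X \<in> stiefel" and Y: "Y \<in> stiefel"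
  defines "W \<equiv> Y - X" and "c \<equiv> norm (mat 1 :: real^'p^'p)"
  defines "\<xi> \<equiv> W + (1/2) *\<^sub>R (X ** (transpose W ** W))"
  shows "norm (block_dist_grad l C X Y + 2 *\<^sub>R avg_inv l C X \<xi>)
      \<le> real l * (1 + (real l - 2) * (c + 1)) * (norm W)\<^sup>2"
proof -
  let ?off = "off_block l C"
  let ?Q = "transpose W ** W"
  have WW: "norm ?Q \<le> (norm W)\<^sup>2"
    using norm_matrix_mult_le[of "transpose W" W] by (simp add: norm_transpose power2_eq_square)
  have sec: "?off (transpose X ** W) + ?off (transpose W ** X) = - ?off ?Q"
    using arg_cong[OF stiefel_secant[OF X Y], of ?off] by (simp add: W_def off_block_simps)
  have YX: "?off (transpose Y ** X) = ?off (transpose W ** X)"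
    by (simp add: W_def matrix_diff_rdistrib transpose_diff off_block_simps stiefel_mult[OF X])
  have X\<xi>: "?off (transpose X ** \<xi>) = ?off (transpose X ** W) + (1/2) *\<^sub>R ?off ?Q"
    by (simp add: \<xi>_def matrix_algebra off_block_simps stiefel_mult_assoc[OF X])
  have "Y ** ?off (transpose Y ** X) + X ** ?off (transpose X ** \<xi>)
     = W ** ?off (transpose W ** X)
       + X ** (?off (transpose X ** W) + ?off (transpose W ** X)) + (1/2) *\<^sub>R (X ** ?off ?Q)"
    unfolding YX X\<xi> by (simp add: W_def matrix_algebra)
  also have "\<dots> = W ** ?off (transpose W ** X) - (1/2) *\<^sub>R (X ** ?off ?Q)"
    unfolding sec using scaleR_left_distrib[of "1/2" "1/2" "X ** ?off ?Q"]
    by (simp add: matrix_minus_right)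
  finally have E: "Y ** ?off (transpose Y ** X) + X ** ?off (transpose X ** \<xi>)
     = W ** ?off (transpose W ** X) - (1/2) *\<^sub>R (X ** ?off ?Q)" .
  let ?R = "W ** ?off (transpose W ** X) - (1/2) *\<^sub>R (X ** ?off ?Q)"
  have "block_dist_grad l C X Y + 2 *\<^sub>R avg_inv l C X \<xi>
     = real l *\<^sub>R ((\<xi> - W) + (real l - 2) *\<^sub>R (Y ** ?off (transpose Y ** X) + X ** ?off
         (transpose X ** \<xi>)))"
    by (simp add: block_dist_grad_def avg_inv_def W_def algebra_simps)
  then have eq: "block_dist_grad l C X Y + 2 *\<^sub>R avg_inv l C X \<xi>
     = real l *\<^sub>R ((1/2) *\<^sub>R (X ** ?Q) + (real l - 2) *\<^sub>R ?R)"
    unfolding E by (simp add: \<xi>_def)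
  have "norm (W ** ?off (transpose W ** X)) \<le> norm W * (norm W * c)"
    using norm_off_block_le[of l C "transpose W ** X"] norm_matrix_mult_le[of "transpose W" X]
    by (intro norm_matrix_mult_le_trans order_refl) (simp add: norm_transpose norm_stiefel[OF X] c_def)
  then have "norm (W ** ?off (transpose W ** X)) \<le> c * (norm W)\<^sup>2"
    by (simp add: power2_eq_square mult_ac)
  moreover have "norm (X ** ?off ?Q) \<le> (norm W)\<^sup>2"
    using norm_off_block_le[of l C ?Q] WW by (simp add: norm_stiefel_mult[OF X])
  ultimately have "norm ?R \<le> (c + 1) * (norm W)\<^sup>2"
    using norm_triangle_ineq4[of "W ** ?off (transpose W ** X)" "(1/2) *\<^sub>R (X ** ?off ?Q)"]
    by (simp add: distrib_right) (use zero_le_power2[of "norm W"] in linarith)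
  then have "norm ((real l - 2) *\<^sub>R ?R) \<le> (real l - 2) * ((c + 1) * (norm W)\<^sup>2)"
    using l by (simp add: mult_left_mono)
  moreover have "norm ((1/2) *\<^sub>R (X ** ?Q)) \<le> (norm W)\<^sup>2"
    using WW by (simp add: norm_stiefel_mult[OF X]) (use zero_le_power2[of "norm W"] in linarith)
  ultimately have "norm ((1/2) *\<^sub>R (X ** ?Q) + (real l - 2) *\<^sub>R ?R)
      \<le> (norm W)\<^sup>2 + (real l - 2) * ((c + 1) * (norm W)\<^sup>2)"
    by (intro norm_triangle_mono)
  also have "\<dots> = (1 + (real l - 2) * (c + 1)) * (norm W)\<^sup>2" by (simp add: algebra_simps)
  finally show ?thesis
    unfolding eq by (simp add: mult_left_mono mult.assoc)
qed

section \<open>Expected change of the block distance in one step\<close>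

lemma rssm_step_dist:
  assumes L: "0 < L"
  shows "\<exists>K>0. \<forall>X\<in>(stiefel :: (real^'p^'n) set). \<forall>C V \<gamma>. norm V \<le> L \<and> 0 < \<gamma> \<and> \<gamma> < 1 / L \<longrightarrow>
     rssm_step C \<gamma> V X \<in> stiefel \<and> norm (rssm_step C \<gamma> V X - X) \<le> K * \<gamma> \<and>
     norm (rssm_step C \<gamma> V X - X + \<gamma> *\<^sub>R block_grad C X V) \<le> K * \<gamma>\<^sup>2"
proof -
  obtain K where K: "K > 0" "\<And>(X :: real^'p^'n) C V \<gamma>. X \<in> stiefel \<Longrightarrow> rssm_step C \<gamma> V X \<in> stiefel \<and>
     norm (rssm_step C \<gamma> V X - (X - \<gamma> *\<^sub>R block_grad C X V)) \<le> K * \<gamma>\<^sup>2 * (norm V)\<^sup>2"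
    using rssm_step_near[where 'p='p and 'n='n] by blast
  \<comment> \<open>\<open>L + K * L\<close> bounds the displacement per unit of
    \<open>\<gamma>\<close>, where \<open>\<gamma> * L \<le> 1\<close> absorbs one factor of the
    quadratic error; \<open>K * L\<^sup>2\<close> bounds the remainder per
    \<open>\<gamma>\<^sup>2\<close>.\<close>
  let ?K = "L + K * L + K * L\<^sup>2"
  have "rssm_step C \<gamma> V X \<in> stiefel \<and> norm (rssm_step C \<gamma> V X - X) \<le> ?K * \<gamma> \<and>
     norm (rssm_step C \<gamma> V X - X + \<gamma> *\<^sub>R block_grad C X V) \<le> ?K * \<gamma>\<^sup>2"
    if X: "X \<in> stiefel" and V: "norm V \<le> L" "0 < \<gamma>" "\<gamma> < 1 / L" for X V :: "real^'p^'n" and C \<gamma>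
  proof -
    let ?D = "rssm_step C \<gamma> V X - X" and ?G = "block_grad C X V"
    have gL: "\<gamma> * L \<le> 1" using V L by (simp add: field_simps)
    have "norm (?D + \<gamma> *\<^sub>R ?G) \<le> K * \<gamma>\<^sup>2 * (norm V)\<^sup>2"
      using K(2)[OF X, of C \<gamma> V] by (simp add: algebra_simps)
    also have "\<dots> \<le> K * \<gamma>\<^sup>2 * L\<^sup>2"
      using K(1) V by (intro mult_left_mono power_mono) auto
    finally have R: "norm (?D + \<gamma> *\<^sub>R ?G) \<le> K * L\<^sup>2 * \<gamma>\<^sup>2" by (simp add: mult_ac)
    moreover have "K * L\<^sup>2 * \<gamma>\<^sup>2 = K * L * \<gamma> * (\<gamma> * L)" by (simp add: power2_eq_square)
    moreover have "K * L * \<gamma> * (\<gamma> * L) \<le> K * L * \<gamma> * 1"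
      using K(1) L V gL by (intro mult_left_mono) auto
    moreover have "norm (\<gamma> *\<^sub>R ?G) \<le> L * \<gamma>"
      using norm_block_grad_le[of C X V] V by (simp add: mult.commute[of L] mult_left_mono)
    moreover have "norm ?D \<le> norm (?D + \<gamma> *\<^sub>R ?G) + norm (\<gamma> *\<^sub>R ?G)"
      using norm_triangle_ineq4[of "?D + \<gamma> *\<^sub>R ?G" "\<gamma> *\<^sub>R ?G"] by simp
    moreover have "0 \<le> K * L\<^sup>2 * \<gamma>" "0 \<le> (L + K * L) * \<gamma>\<^sup>2" using K(1) L V by auto
    ultimately have "norm ?D \<le> ?K * \<gamma>" "norm (?D + \<gamma> *\<^sub>R ?G) \<le> ?K * \<gamma>\<^sup>2"
      unfolding distrib_right by linarith+
    then show ?thesis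
      using K(2)[OF X] by blast
  qed
  moreover have "0 < ?K" using K(1) L by (intro add_pos_pos) auto
  ultimately show ?thesis by blast
qed

text \<open>Up to second order the gradient is \<open>- 2 *\<^sub>R avg_inv l C X \<xi>\<close>,
  whose pairing with the block gradients averages to the pairing of \<open>\<xi>\<close> with
  \<open>V\<close>. Errors come from approximating the gradient, from replacing \<open>\<xi>\<close>
  by \<open>Y - X\<close>, and from the size of the step.\<close>

lemma avg_block_dist_step:
  fixes C :: "nat \<Rightarrow> 'p::finite set"
  assumes l: "2 \<le> l" and part: "column_partition l C" and L: "0 < L"
  shows "\<exists>K>0. \<forall>X\<in>(stiefel :: (real^'p^'n) set). \<forall>Y\<in>stiefel. \<forall>V \<gamma>. norm V \<le> L \<and> 0 < \<gamma> \<and> \<gamma> < 1 / L \<longrightarrow>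
     (\<Sum>P\<in>pairs l. block_dist l C (rssm_step (pair_cols C P) \<gamma> V X) Y) / card (pairs l)
       \<le> block_dist l C X Y + 2 * \<gamma> * (V \<bullet> (Y - X)) + K * \<gamma> * (norm (Y - X))\<^sup>2 + K * \<gamma>\<^sup>2"
proof -
  obtain K where K: "K > 0" "\<And>(X :: real^'p^'n) V C \<gamma>. X \<in> stiefel \<Longrightarrow> norm V \<le> L \<Longrightarrow> 0 < \<gamma> \<Longrightarrow> \<gamma> < 1 / L \<Longrightarrow>
     rssm_step C \<gamma> V X \<in> stiefel \<and> norm (rssm_step C \<gamma> V X - X) \<le> K * \<gamma> \<and>
     norm (rssm_step C \<gamma> V X - X + \<gamma> *\<^sub>R block_grad C X V) \<le> K * \<gamma>\<^sup>2"
    using rssm_step_dist[OF L, where 'p='p and 'n='n] by blast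
  define c where "c = norm (mat 1 :: real^'p^'p)"
  \<comment> \<open>\<open>a\<close> bounds the gradient, \<open>b\<close> the second-order
    coefficient and \<open>e\<close> the gradient approximation; \<open>c\<close> is the common norm
    of Stiefel matrices.\<close>
  define a where "a = real l * (2 * c + (real l - 2) * c\<^sup>2)"
  define b where "b = real l / 2 * (1 + (real l - 2) * c\<^sup>2)"
  define e where "e = real l * (1 + (real l - 2) * (c + 1))"
  define M where "M = (a * K + b * K\<^sup>2) + (e * L + L) + 1"
  have c: "c \<ge> 0" by (simp add: c_def)
  have nn: "a \<ge> 0" "b \<ge> 0" "e \<ge> 0" using l c by (auto simp: a_def b_def e_def)
  then have M: "M > 0" "a * K + b * K\<^sup>2 \<le> M" "e * L + L \<le> M" using K(1) L
      by (auto simp: M_def intro!: add_nonneg_pos)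
  let ?N = "real (card (pairs l))"
  have N: "?N > 0" "?N = real (l choose 2)" using l by (auto simp: card_pairs zero_less_binomial)
  have "(\<Sum>P\<in>pairs l. block_dist l C (rssm_step (pair_cols C P) \<gamma> V X) Y) / ?N
       \<le> block_dist l C X Y + 2 * \<gamma> * (V \<bullet> (Y - X)) + M * \<gamma> * (norm (Y - X))\<^sup>2 + M * \<gamma>\<^sup>2"
    if X: "X \<in> stiefel" and Y: "Y \<in> stiefel" and V: "norm V \<le> L" "0 < \<gamma>" "\<gamma> < 1 / L"
    for X Y V :: "real^'p^'n" and \<gamma>
  proof -
    let ?W = "Y - X"
    define \<xi> where "\<xi> = ?W + (1/2) *\<^sub>R (X ** (transpose ?W ** ?W))"
    have \<xi>: "\<xi> \<in> stiefel_tangent X"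
      unfolding \<xi>_def by (rule stiefel_tangent_secant[OF X Y])
    let ?H = "avg_inv l C X \<xi>" and ?g = "block_dist_grad l C X Y"
    have gH: "norm (?g + 2 *\<^sub>R ?H) \<le> e * (norm ?W)\<^sup>2"
      using block_dist_grad_approx[OF l X Y, of C] by (simp add: \<xi>_def e_def c_def)
    have one: "block_dist l C (rssm_step (pair_cols C P) \<gamma> V X) Y \<le> (block_dist l C X Y
        + \<gamma> * (e * L) * (norm ?W)\<^sup>2 + (a * K + b * K\<^sup>2) * \<gamma>\<^sup>2) + 2 * \<gamma> *
            (?H \<bullet> block_grad (pair_cols C P) X V)" for P
    proof -
      let ?D = "rssm_step (pair_cols C P) \<gamma> V X - X" and ?G = "block_grad (pair_cols C P) X V"
      note S = K(2)[OF X V, of "pair_cols C P"]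
      have "block_dist l C (X + ?D) Y \<le> block_dist l C X Y + ?g \<bullet> ?D + b * (norm ?D)\<^sup>2"
        using block_dist_diff_le[OF l Y, of C X ?D] by (simp add: b_def c_def)
      moreover have "b * (norm ?D)\<^sup>2 \<le> b * (K * \<gamma>)\<^sup>2"
        using S nn by (intro mult_left_mono power_mono) auto
      \<comment> \<open>The first two terms are errors; only the last one survives with its exact
        value, and it is the one that can be averaged.\<close>
      moreover have "?g \<bullet> ?D = ?g \<bullet> (?D + \<gamma> *\<^sub>R ?G) - \<gamma> * ((?g + 2 *\<^sub>R ?H) \<bullet> ?G) + 2 * \<gamma> * (?H \<bullet> ?G)"
        by (simp add: inner_add_left inner_add_right algebra_simps)
      moreover have "?g \<bullet> (?D + \<gamma> *\<^sub>R ?G) \<le> a * (K * \<gamma>\<^sup>2)"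
        using S norm_cauchy_schwarz[of ?g "?D + \<gamma> *\<^sub>R ?G"] norm_block_dist_grad_le[OF l X Y, of C] nn
        by (smt (verit) a_def c_def mult_mono norm_ge_zero)
      moreover have "- \<gamma> * ((?g + 2 *\<^sub>R ?H) \<bullet> ?G) \<le> \<gamma> * (e * (norm ?W)\<^sup>2 * L)"
      proof -
        have "- ((?g + 2 *\<^sub>R ?H) \<bullet> ?G) \<le> norm (?g + 2 *\<^sub>R ?H) * norm ?G"
          using norm_cauchy_schwarz[of "- (?g + 2 *\<^sub>R ?H)" ?G]
              by (simp only: inner_minus_left norm_minus_cancel)
        also have "\<dots> \<le> e * (norm ?W)\<^sup>2 * L"
          using gH norm_block_grad_le[of "pair_cols C P" X V] V nn by (intro mult_mono) auto
        finally show ?thesis using V mult_left_mono[of "- ((?g + 2 *\<^sub>R ?H) \<bullet> ?G)" _ \<gamma>] by simp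
      qed
      ultimately show ?thesis
        by (simp add: algebra_simps power_mult_distrib)
    qed
    have "(\<Sum>P\<in>pairs l. block_dist l C (rssm_step (pair_cols C P) \<gamma> V X) Y)
        \<le> (\<Sum>P\<in>pairs l. (block_dist l C X Y
        + \<gamma> * (e * L) * (norm ?W)\<^sup>2 + (a * K + b * K\<^sup>2) * \<gamma>\<^sup>2) + 2 * \<gamma> *
            (?H \<bullet> block_grad (pair_cols C P) X V))"
      by (rule sum_mono) (rule one)
    also have "\<dots> = ?N * (block_dist l C X Y
        + \<gamma> * (e * L) * (norm ?W)\<^sup>2 + (a * K + b * K\<^sup>2) * \<gamma>\<^sup>2) + 2 * \<gamma> * (?N * (\<xi> \<bullet> V))"
      using sum_inner_block_grad[OF l part X \<xi>, of V]
      by (simp add: sum.distrib N(2) flip: sum_distrib_left)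
    also have "\<dots> = (block_dist l C X Y
        + \<gamma> * (e * L) * (norm ?W)\<^sup>2 + (a * K + b * K\<^sup>2) * \<gamma>\<^sup>2 + 2 * \<gamma> * (\<xi> \<bullet> V)) * ?N"
      by (simp add: algebra_simps)
    finally have "(\<Sum>P\<in>pairs l. block_dist l C (rssm_step (pair_cols C P) \<gamma> V X) Y) / ?N
      \<le> block_dist l C X Y + \<gamma> * (e * L) * (norm ?W)\<^sup>2 + (a * K + b * K\<^sup>2) * \<gamma>\<^sup>2 + 2 * \<gamma> * (\<xi> \<bullet> V)"
      using N(1) by (simp only: pos_divide_le_eq)
    moreover have "2 * \<gamma> * (\<xi> \<bullet> V) \<le> 2 * \<gamma> * (V \<bullet> ?W) + \<gamma> * L * (norm ?W)\<^sup>2"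
    proof -
      have "(X ** (transpose ?W ** ?W)) \<bullet> V \<le> norm (X ** (transpose ?W ** ?W)) * norm V"
        by (rule norm_cauchy_schwarz)
      also have "\<dots> \<le> (norm ?W)\<^sup>2 * L"
        using norm_matrix_mult_le[of "transpose ?W" ?W] V L
        by (intro mult_mono) (auto simp: norm_transpose norm_stiefel_mult[OF X] power2_eq_square)
      finally have "\<xi> \<bullet> V \<le> V \<bullet> ?W + 1/2 * ((norm ?W)\<^sup>2 * L)"
        by (simp add: \<xi>_def inner_add_left inner_add_right inner_commute[of V])
      then have "2 * \<gamma> * (\<xi> \<bullet> V) \<le> 2 * \<gamma> * (V \<bullet> ?W + 1/2 * ((norm ?W)\<^sup>2 * L))"
        using V by (intro mult_left_mono) auto
      then show ?thesis by (simp add: algebra_simps)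
    qed
    moreover have "(a * K + b * K\<^sup>2) * \<gamma>\<^sup>2 \<le> M * \<gamma>\<^sup>2"
      using M by (intro mult_right_mono) auto
    moreover have "(e * L + L) * (\<gamma> * (norm ?W)\<^sup>2) \<le> M * (\<gamma> * (norm ?W)\<^sup>2)"
      using M V by (intro mult_right_mono) auto
    ultimately show ?thesis by (simp add: algebra_simps)
  qed
  with M(1) show ?thesis by blast
qed

subsection \<open>Clarke subgradients of weakly convex functions\<close>

text \<open>Every neighbourhood of \<open>x\<close> contains \<open>x\<close>, so the joint upper
  limit dominates the limit with the base point frozen.\<close>

lemma Limsup_nhds_prod_at_right_ge:
  fixes q :: "'a::topological_space \<times> real \<Rightarrow> ereal"
  assumes lim: "(u \<longlongrightarrow> a) (at_right 0)" and le: "\<forall>\<^sub>F t in at_right 0. u t \<le> q (x, t)"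
  shows "a \<le> Limsup (nhds x \<times>\<^sub>F at_right 0) q"
proof (rule Limsup_greatest)
  fix P assume "eventually P (nhds x \<times>\<^sub>F at_right (0::real))"
  then obtain Q R where Q: "eventually Q (nhds x)" and R: "eventually R (at_right (0::real))"
    and P: "\<And>y t. Q y \<Longrightarrow> R t \<Longrightarrow> P (y, t)"
    unfolding eventually_prod_filter by blast
  have "Q x" using Q by (rule eventually_nhds_x_imp_x)
  have "\<forall>\<^sub>F t in at_right 0. u t \<le> (SUP z\<in>Collect P. q z)"
    using le R
  proof eventually_elim
    case (elim t)
    have "q (x, t) \<le> (SUP z\<in>Collect P. q z)"
      by (rule SUP_upper) (use P[OF \<open>Q x\<close> \<open>R t\<close>] in simp)
    with elim show ?case by simp
  qed
  then show "a \<le> (SUP z\<in>Collect P. q z)"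
    by (rule tendsto_upperbound[OF lim]) simp
qed

locale weakly_convex_lipschitz =
  fixes f :: "'a::euclidean_space \<Rightarrow> real" and \<Omega> :: "'a set" and \<tau> L :: real
  assumes convex: "convex \<Omega>"
    and wconvex: "convex_on \<Omega> (\<lambda>Y. f Y + \<tau> / 2 * (norm Y)\<^sup>2)"
    and lipschitz: "L-lipschitz_on \<Omega> f"
begin

lemma continuous_on_f: "continuous_on \<Omega> f"
  using lipschitz by (rule lipschitz_on_continuous_on)

lemma isCont_f: "x \<in> interior \<Omega> \<Longrightarrow> isCont f x"
  using continuous_on_f by (simp add: continuous_on_interior)

text \<open>Recentring the quadratic changes it by an affine function of \<open>Y\<close>
  only.\<close>

lemma convex_on_shifted: "convex_on \<Omega> (\<lambda>Y. f Y + \<tau> / 2 * (norm (Y - x))\<^sup>2)"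
proof -
  have "convex_on \<Omega> (\<lambda>Y. \<tau> / 2 * (norm x)\<^sup>2 - \<tau> * (Y \<bullet> x))"
    by (auto simp: convex_on_def convex inner_add_left algebra_simps simp flip: distrib_right)
  then have "convex_on \<Omega> (\<lambda>Y. (f Y + \<tau> / 2 * (norm Y)\<^sup>2) + (\<tau> / 2 * (norm x)\<^sup>2 - \<tau> * (Y \<bullet> x)))"
    by (rule convex_on_add[OF wconvex])
  then show ?thesis
    by (simp add: power2_norm_eq_inner inner_diff_left inner_diff_right inner_commute algebra_simps)
qed

lemma difference_quotient_le:
  assumes "y \<in> \<Omega>" "y + v \<in> \<Omega>" "0 < t" "t < 1"
  shows "(f (y + t *\<^sub>R v) - f y) / t \<le> f (y + v) - f y + \<tau> / 2 * (1 - t) * (norm v)\<^sup>2"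
proof -
  have "y + t *\<^sub>R v = (1 - t) *\<^sub>R y + t *\<^sub>R (y + v)" by (simp add: algebra_simps)
  then have "f (y + t *\<^sub>R v) + \<tau> / 2 * (norm (y + t *\<^sub>R v - y))\<^sup>2
     \<le> (1 - t) * (f y + \<tau> / 2 * (norm (y - y))\<^sup>2) + t * (f (y + v) + \<tau> / 2 * (norm (y + v - y))\<^sup>2)"
    using convex_onD[OF convex_on_shifted[of y], of t y "y + v"] assms by simp
  then have "f (y + t *\<^sub>R v) - f y \<le> t * (f (y + v) - f y + \<tau> / 2 * (1 - t) * (norm v)\<^sup>2)"
    using assms by (simp add: algebra_simps power2_eq_square abs_of_pos diff_divide_distrib)
  then show ?thesis using assms by (simp add: pos_divide_le_eq mult.commute)
qed

text \<open>\<open>difference_quotient_le\<close> dominates the quotients at all nearby base points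
  by a function that is continuous in base point and stepsize, so its limit bounds the Clarke
  derivative in direction \<open>y - x\<close>.\<close>

lemma clarke_subdiff_ineq:
  assumes x: "x \<in> interior \<Omega>" and y: "y \<in> interior \<Omega>" and g: "g \<in> clarke_subdiff f x"
  shows "f x + g \<bullet> (y - x) \<le> f y + \<tau> / 2 * (norm (y - x))\<^sup>2"
proof -
  let ?v = "y - x" and ?F = "nhds x \<times>\<^sub>F at_right (0::real)"
  let ?u = "\<lambda>(z, t). f (z + ?v) - f z + \<tau> / 2 * (1 - t) * (norm ?v)\<^sup>2"
  have z: "(fst \<longlongrightarrow> x) ?F" by (rule filterlim_fst)
  have "filterlim snd (at_right 0) ?F" by (rule filterlim_snd)
  then have t: "(snd \<longlongrightarrow> 0) ?F" by (rule filterlim_mono) (auto simp: at_within_le_nhds)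
  have 1: "((\<lambda>p. f (fst p)) \<longlongrightarrow> f x) ?F"
    using isCont_tendsto_compose[OF isCont_f[OF x] z] .
  have zy: "((\<lambda>p. fst p + ?v) \<longlongrightarrow> y) ?F"
    using tendsto_add[OF z tendsto_const[of ?v]] by simp
  have 2: "((\<lambda>p. f (fst p + ?v)) \<longlongrightarrow> f y) ?F"
    using isCont_tendsto_compose[OF isCont_f[OF y] zy] .
  have "((\<lambda>p. f (fst p + ?v) - f (fst p) + \<tau> / 2 * (1 - snd p) * (norm ?v)\<^sup>2)
      \<longlongrightarrow> f y - f x + \<tau> / 2 * (1 - 0) * (norm ?v)\<^sup>2) ?F"
    by (intro tendsto_intros 1 2 t)
  then have lim: "((\<lambda>p. ereal (?u p)) \<longlongrightarrow> ereal (f y - f x + \<tau> / 2 * (norm ?v)\<^sup>2)) ?F"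
    by (simp add: case_prod_unfold)
  have nt: "\<not> trivial_limit ?F"
    by (simp add: prod_filter_eq_bot nhds_neq_bot)
  have "eventually (\<lambda>p. fst p \<in> interior \<Omega>) ?F" "eventually (\<lambda>p. fst p + ?v \<in> interior \<Omega>) ?F"
    using topological_tendstoD[OF z open_interior x] topological_tendstoD[OF zy open_interior y] by auto
  moreover have "eventually (\<lambda>p. 0 < snd p \<and> snd p < 1) ?F"
  proof -
    have "eventually (\<lambda>t::real. 0 < t \<and> t < 1) (at_right 0)"
      by (auto simp: eventually_at_right_field intro: exI[of _ 1])
    then show ?thesis
      by (rule eventually_compose_filterlim) (rule filterlim_snd)
  qed
  ultimately have "\<forall>\<^sub>F p in ?F. (case p of (z, t) \<Rightarrow> ereal ((f (z + t *\<^sub>R ?v) - f z) / t)) \<le> ereal (?u p)"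
  proof eventually_elim
    case (elim p)
    then show ?case
      using difference_quotient_le[of "fst p" ?v "snd p"] interior_subset
      by (auto simp: case_prod_unfold)
  qed
  then have "clarke_dd f x ?v \<le> Limsup ?F (\<lambda>p. ereal (?u p))"
    unfolding clarke_dd_def by (rule Limsup_mono)
  also have "\<dots> = ereal (f y - f x + \<tau> / 2 * (norm ?v)\<^sup>2)"
    by (rule lim_imp_Limsup[OF nt lim])
  finally have "clarke_dd f x ?v \<le> ereal (f y - f x + \<tau> / 2 * (norm ?v)\<^sup>2)" .
  moreover have "ereal (g \<bullet> ?v) \<le> clarke_dd f x ?v" using g by (simp add: clarke_subdiff_def)
  ultimately have "ereal (g \<bullet> ?v) \<le> ereal (f y - f x + \<tau> / 2 * (norm ?v)\<^sup>2)"
      by (rule order_trans[rotated])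
  then show ?thesis by simp
qed

text \<open>Testing the subgradient in its own direction and bounding the quotients by the Lipschitz
  constant gives a quadratic inequality for its norm.\<close>

lemma norm_clarke_subdiff_le:
  assumes x: "x \<in> interior \<Omega>" and g: "g \<in> clarke_subdiff f x"
  shows "norm g \<le> L"
proof -
  let ?F = "nhds x \<times>\<^sub>F at_right (0::real)"
  have z: "(fst \<longlongrightarrow> x) ?F" by (rule filterlim_fst)
  have s: "filterlim snd (at_right 0) ?F" by (rule filterlim_snd)
  then have t: "(snd \<longlongrightarrow> 0) ?F" by (rule filterlim_mono) (auto simp: at_within_le_nhds)
  have zt: "((\<lambda>p. fst p + snd p *\<^sub>R g) \<longlongrightarrow> x) ?F"
    using tendsto_add[OF z tendsto_scaleR[OF t tendsto_const[of g]]] by simp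
  have "eventually (\<lambda>t::real. 0 < t) (at_right 0)"
    by (rule eventually_at_right_less)
  then have "eventually (\<lambda>p. 0 < snd p) ?F"
    using s by (rule eventually_compose_filterlim)
  moreover have "eventually (\<lambda>p. fst p \<in> interior \<Omega>) ?F"
      "eventually (\<lambda>p. fst p + snd p *\<^sub>R g \<in> interior \<Omega>) ?F"
    using topological_tendstoD[OF z open_interior x] topological_tendstoD[OF zt open_interior x] by auto
  ultimately have "\<forall>\<^sub>F p in ?F. (case p of (z, t) \<Rightarrow> ereal ((f (z + t *\<^sub>R g) - f z) / t))
      \<le> ereal (L * norm g)"
  proof eventually_elim
    case (elim p)
    then have "dist (f (fst p + snd p *\<^sub>R g)) (f (fst p)) \<le> L * dist (fst p + snd p *\<^sub>R g) (fst p)"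
      using interior_subset by (intro lipschitz_onD[OF lipschitz]) auto
    then show ?case
      using elim by (auto simp: case_prod_unfold dist_real_def dist_norm[of _ "fst p"] abs_of_pos
          pos_divide_le_eq mult_ac)
  qed
  then have "clarke_dd f x g \<le> ereal (L * norm g)"
    unfolding clarke_dd_def by (rule Limsup_bounded)
  moreover have "ereal (g \<bullet> g) \<le> clarke_dd f x g" using g by (simp add: clarke_subdiff_def)
  ultimately have "ereal (g \<bullet> g) \<le> ereal (L * norm g)" by (rule order_trans[rotated])
  then have "norm g * norm g \<le> L * norm g"
    by (simp add: power2_norm_eq_inner flip: power2_eq_square)
  then show ?thesis
    using lipschitz_on_nonneg[OF lipschitz] by (cases "g = 0") auto
qed

text \<open>Converse of \<open>clarke_subdiff_ineq\<close>: along the ray from \<open>x\<close> the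
  quadratic term contributes a multiple of \<open>t\<close> and vanishes in the limit.\<close>

lemma clarke_subdiffI:
  assumes x: "x \<in> interior \<Omega>"
    and g: "\<And>y. y \<in> interior \<Omega> \<Longrightarrow> f x + g \<bullet> (y - x) \<le> f y + \<tau> / 2 * (norm (y - x))\<^sup>2"
  shows "g \<in> clarke_subdiff f x"
  unfolding clarke_subdiff_def
proof (intro CollectI allI)
  fix v
  have "((\<lambda>t. g \<bullet> v - \<tau> / 2 * t * (norm v)\<^sup>2) \<longlongrightarrow> g \<bullet> v - \<tau> / 2 * 0 * (norm v)\<^sup>2) (at_right 0)"
    by (intro tendsto_intros)
  then have lim: "((\<lambda>t. ereal (g \<bullet> v - \<tau> / 2 * t * (norm v)\<^sup>2)) \<longlongrightarrow> ereal (g \<bullet> v)) (at_right 0)"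
    by simp
  have "((\<lambda>t. x + t *\<^sub>R v) \<longlongrightarrow> x + 0 *\<^sub>R v) (at_right 0)"
    by (intro tendsto_intros)
  then have "\<forall>\<^sub>F t in at_right 0. x + t *\<^sub>R v \<in> interior \<Omega>"
    using topological_tendstoD[OF _ open_interior] x by simp
  then have "\<forall>\<^sub>F t in at_right 0. ereal (g \<bullet> v - \<tau> / 2 * t * (norm v)\<^sup>2)
     \<le> (case (x, t) of (y, t) \<Rightarrow> ereal ((f (y + t *\<^sub>R v) - f y) / t))"
    using eventually_at_right_less[of "0::real"]
  proof eventually_elim
    case (elim t)
    then have "t * (g \<bullet> v - \<tau> / 2 * t * (norm v)\<^sup>2) \<le> f (x + t *\<^sub>R v) - f x"
      using g[of "x + t *\<^sub>R v"] by (simp add: algebra_simps power2_eq_square)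
    then show ?case using elim by (simp add: pos_le_divide_eq mult.commute)
  qed
  then show "ereal (g \<bullet> v) \<le> clarke_dd f x v"
    unfolding clarke_dd_def by (rule Limsup_nhds_prod_at_right_ge[OF lim])
qed

text \<open>First-order optimality on an affine flat. The strict epigraph of the convexified
  function is separated from the flat at the height of the minimum; the normalized normal vector is
  a subgradient vanishing on \<open>T\<close>.\<close>

lemma ex_clarke_subdiff_orthogonal:
  assumes x: "x \<in> interior \<Omega>" and T: "subspace T"
    and min: "\<And>\<xi>. \<xi> \<in> T \<Longrightarrow> x + \<xi> \<in> \<Omega> \<Longrightarrow> f x \<le> f (x + \<xi>) + c * (norm \<xi>)\<^sup>2"
  obtains g where "g \<in> clarke_subdiff f x" "\<And>\<xi>. \<xi> \<in> T \<Longrightarrow> g \<bullet> \<xi> = 0"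
proof -
  define k where "k y = f y + \<tau> / 2 * (norm (y - x))\<^sup>2" for y
  have kx: "k x = f x" by (simp add: k_def)
  have k: "convex_on \<Omega> k" unfolding k_def by (rule convex_on_shifted)
  have x': "x \<in> \<Omega>" using x interior_subset by blast
  \<comment> \<open>Along a segment the slack in \<open>min\<close> scales like the square of
    \<open>t\<close>, while convexity contributes a linear gain; dividing by \<open>t\<close> and
    letting it vanish removes the slack.\<close>
  have kmin: "k x \<le> k (x + \<xi>)" if \<xi>: "\<xi> \<in> T" "x + \<xi> \<in> \<Omega>" for \<xi>
  proof -
    have ineq: "k x - k (x + \<xi>) \<le> t * ((c - \<tau> / 2) * (norm \<xi>)\<^sup>2)" if t: "0 < t" "t < 1" for t
    proof -
      have eq: "x + t *\<^sub>R \<xi> = (1 - t) *\<^sub>R x + t *\<^sub>R (x + \<xi>)" by (simp add: algebra_simps)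
      have "x + t *\<^sub>R \<xi> \<in> \<Omega>"
        unfolding eq using convexD_alt[OF convex x' \<xi>(2)] t by simp
      then have "f x \<le> f (x + t *\<^sub>R \<xi>) + c * (norm (t *\<^sub>R \<xi>))\<^sup>2"
        using min[OF subspace_scale[OF T \<xi>(1)]] by blast
      moreover have "k (x + t *\<^sub>R \<xi>) \<le> (1 - t) * k x + t * k (x + \<xi>)"
        unfolding eq using convex_onD[OF k, of t x "x + \<xi>"] t x' \<xi> by simp
      ultimately have "t * (k x - k (x + \<xi>)) \<le> t * (t * ((c - \<tau> / 2) * (norm \<xi>)\<^sup>2))"
        unfolding kx by (simp add: k_def[of "x + t *\<^sub>R \<xi>"] power_mult_distrib algebra_simps
            power2_eq_square)
      then show ?thesis using t by simp
    qed
    have "((\<lambda>t. t * ((c - \<tau> / 2) * (norm \<xi>)\<^sup>2)) \<longlongrightarrow> 0 * ((c - \<tau> / 2) * (norm \<xi>)\<^sup>2)) (at_right 0)"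
      by (intro tendsto_intros)
    moreover have "\<forall>\<^sub>F t in at_right 0. k x - k (x + \<xi>) \<le> t * ((c - \<tau> / 2) * (norm \<xi>)\<^sup>2)"
      unfolding eventually_at_right_field by (intro exI[of _ 1]) (auto intro: ineq)
    ultimately have "k x - k (x + \<xi>) \<le> 0 * ((c - \<tau> / 2) * (norm \<xi>)\<^sup>2)"
      by (rule tendsto_lowerbound) simp
    then show ?thesis by simp
  qed
  define A where "A = {(y, r). y \<in> interior \<Omega> \<and> k y < r}"
  define B where "B = (\<lambda>\<xi>. (x + \<xi>, k x)) ` T"
  have cA: "convex A"
    unfolding convex_alt
  proof (clarsimp simp: A_def, intro conjI)
    fix y z :: 'a and r s u :: real
    assume *: "y \<in> interior \<Omega>" "k y < r" "z \<in> interior \<Omega>" "k z < s" "0 \<le> u" "u \<le> 1"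
    show "(1 - u) *\<^sub>R y + u *\<^sub>R z \<in> interior \<Omega>"
      using convexD_alt[OF convex_interior[OF convex]] * by blast
    have "k ((1 - u) *\<^sub>R y + u *\<^sub>R z) \<le> (1 - u) * k y + u * k z"
      using convex_onD[OF k] * interior_subset by blast
    also have "\<dots> < (1 - u) * r + u * s"
    proof (cases "u = 0")
      case False
      then have "u * k z < u * s" using * by simp
      moreover have "(1 - u) * k y \<le> (1 - u) * r" using * by (intro mult_left_mono) auto
      ultimately show ?thesis by simp
    qed (use * in simp)
    finally show "k ((1 - u) *\<^sub>R y + u *\<^sub>R z) < (1 - u) * r + u * s" .
  qed
  have "B = (\<lambda>p. (x, k x) + p) ` ((\<lambda>\<xi>. (\<xi>, 0)) ` T)" unfolding B_def image_image by simp
  moreover have "convex ((\<lambda>\<xi>. (\<xi>, 0::real)) ` T)"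
    by (intro convex_linear_image subspace_imp_convex T) (auto intro: linearI)
  ultimately have cB: "convex B" by (simp add: convex_translation)
  have "A \<inter> B = {}"
    using kmin interior_subset by (fastforce simp: A_def B_def)
  moreover have "(x, k x + 1) \<in> A" "(x, k x) \<in> B"
    using x subspace_0[OF T] by (auto simp: A_def B_def image_iff intro: bexI[of _ 0])
  ultimately obtain p \<beta> where p: "p \<noteq> 0" "\<forall>q\<in>A. p \<bullet> q \<le> \<beta>" "\<forall>q\<in>B. p \<bullet> q \<ge> \<beta>"
    using separating_hyperplane_sets[OF cA cB] by blast
  obtain a b where ab: "p = (a, b)" by (cases p)
  have sep: "a \<bullet> y + b * r \<le> a \<bullet> x + a \<bullet> \<xi> + b * k x"
    if "y \<in> interior \<Omega>" "k y < r" "\<xi> \<in> T" for y r \<xi>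
  proof -
    have "(y, r) \<in> A" "(x + \<xi>, k x) \<in> B" using that by (auto simp: A_def B_def)
    then have "p \<bullet> (y, r) \<le> p \<bullet> (x + \<xi>, k x)" using p by force
    then show ?thesis by (simp add: ab inner_add_right)
  qed
  have T0: "a \<bullet> \<xi> = 0" if "\<xi> \<in> T" for \<xi>
  proof (rule ccontr)
    assume nz: "a \<bullet> \<xi> \<noteq> 0"
    \<comment> \<open>Scaled so that moving within \<open>T\<close> would outweigh the unit of
      height between \<open>k x + 1\<close> and \<open>k x\<close>.\<close>
    let ?s = "- (\<bar>b\<bar> + 1) / (a \<bullet> \<xi>)"
    have "a \<bullet> x + b * (k x + 1) \<le> a \<bullet> x + a \<bullet> (?s *\<^sub>R \<xi>) + b * k x"
      by (rule sep[OF x _ subspace_scale[OF T that]]) simp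
    moreover have "a \<bullet> (?s *\<^sub>R \<xi>) = - (\<bar>b\<bar> + 1)" using nz by simp
    ultimately have "b \<le> - (\<bar>b\<bar> + 1)" by (simp only:) (simp add: algebra_simps)
    then show False by linarith
  qed
  have sep0: "b * r \<le> b * k x - a \<bullet> (y - x)" if "y \<in> interior \<Omega>" "k y < r" for y r
    using sep[OF that subspace_0[OF T]] by (simp add: inner_diff_right)
  have "b \<le> 0" using sep0[OF x, of "k x + 1"] by (simp add: algebra_simps)
  \<comment> \<open>The separating hyperplane is not vertical: \<open>x\<close> is interior, so a
    small move along \<open>a\<close> would cross it.\<close>
  moreover have "b \<noteq> 0"
  proof
    assume b: "b = 0"
    then have "a \<noteq> 0" using p ab by (auto simp: zero_prod_def)
    obtain e where e: "e > 0" "ball x e \<subseteq> interior \<Omega>"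
      using x open_interior open_contains_ball by blast
    let ?y = "x + (e / 2 / norm a) *\<^sub>R a"
    have "?y \<in> interior \<Omega>" using e \<open>a \<noteq> 0\<close> by (intro subsetD[OF e(2)]) (simp add: dist_norm)
    from sep0[OF this, of "k ?y + 1"] have "e / 2 / norm a * (a \<bullet> a) \<le> 0" by (simp add: b)
    moreover have "0 < e / 2 / norm a * (a \<bullet> a)" using e \<open>a \<noteq> 0\<close>
        by (intro mult_pos_pos divide_pos_pos) auto
    ultimately show False by simp
  qed
  ultimately have b: "b < 0" by simp
  have sub: "k x + (- (1 / b) *\<^sub>R a) \<bullet> (y - x) \<le> k y" if "y \<in> interior \<Omega>" for y
  proof (rule dense_ge)
    fix r assume "k y < r"
    from sep0[OF that this] have "(b * k x - a \<bullet> (y - x)) / b \<le> r"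
      using b by (simp add: neg_divide_le_eq mult.commute)
    then show "k x + (- (1 / b) *\<^sub>R a) \<bullet> (y - x) \<le> r"
      using b by (simp add: diff_divide_distrib)
  qed
  have "- (1 / b) *\<^sub>R a \<in> clarke_subdiff f x"
    using sub by (intro clarke_subdiffI[OF x]) (simp add: k_def)
  then show thesis by (rule that) (simp add: T0)
qed

end

subsection \<open>The envelope and its gap\<close>

lemma closest_point_eq_zero_iff:
  fixes S :: "'a::euclidean_space set"
  assumes "subspace S"
  shows "closest_point S a = 0 \<longleftrightarrow> (\<forall>z\<in>S. a \<bullet> z = 0)"
proof
  assume "closest_point S a = 0"
  then show "\<forall>z\<in>S. a \<bullet> z = 0"
    using closest_point_subspace(2)[OF assms, of _ a] by simp
next
  assume "\<forall>z\<in>S. a \<bullet> z = 0"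
  then show "closest_point S a = 0"
    using closest_point_subspace(2)[OF assms closest_point_subspace(1)[OF assms], of a a]
      closest_point_subspace(1)[OF assms, of a] by simp
qed

lemma continuous_on_block_dist:
  "continuous_on S (\<lambda>p. block_dist l C (fst p :: real^'p^'n) (snd p))"
proof -
  have "continuous_on S (\<lambda>p. off_block l C (transpose (fst p :: real^'p^'n) ** snd p))"
    unfolding off_block_def
  proof (intro continuous_on_vec_lambda)
    fix i j
    show "continuous_on S (\<lambda>p. if block l C i
        = block l C j then 0 else (transpose (fst p :: real^'p^'n) ** snd p) $ i $ j)"
      by (cases "block l C i = block l C j") (auto intro!: continuous_intros)
  qed
  then show ?thesis
    unfolding block_dist_def by (intro continuous_intros)
qed

text \<open>At coinciding arguments both the distance and its gradient vanish, so only the quadratic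
  term of the expansion is left.\<close>

lemma block_dist_quadratic:
  assumes l: "2 \<le> l"
  shows "\<exists>K>0. \<forall>X\<in>(stiefel :: (real^'p^'n) set). \<forall>Y\<in>stiefel. block_dist l C X Y \<le> K * (norm (X - Y))\<^sup>2"
proof -
  let ?K = "real l / 2 * (1 + (real l - 2) * (norm (mat 1 :: real^'p^'p))\<^sup>2)"
  have "block_dist l C X Y \<le> ?K * (norm (X - Y))\<^sup>2" if "Y \<in> stiefel" for X Y :: "real^'p^'n"
  proof -
    have "block_dist_grad l C Y Y = 0"
      using that by (simp add: block_dist_grad_def stiefel_mult off_block_simps)
    then show ?thesis
      using block_dist_diff_le[OF l that, of C Y "X - Y"] block_dist_self[OF that, of l C] by simp
  qed
  moreover have "0 < ?K" using l by (simp add: add_pos_nonneg)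
  ultimately show ?thesis by blast
qed

locale weakly_convex_on_stiefel = weakly_convex_lipschitz f \<Omega> \<tau> L
  for f :: "real^'p^'n \<Rightarrow> real" and \<Omega> \<tau> L +
  fixes l :: nat and C :: "nat \<Rightarrow> 'p set"
  assumes tau: "0 \<le> \<tau>" and L: "0 < L"
    and stiefel_subset: "stiefel \<subseteq> interior \<Omega>"
    and l: "2 \<le> l" and part: "column_partition l C"
begin

lemma stiefel_subset': "stiefel \<subseteq> \<Omega>"
  using stiefel_subset interior_subset by blast

text \<open>For \<open>X\<close> on the manifold this is the objective minimized by
  \<open>prox\<close>, in a form whose dependence on \<open>X\<close> is easy to control.\<close>

definition penalized :: "real \<Rightarrow> real^'p^'n \<Rightarrow> real^'p^'n \<Rightarrow> real" where
  "penalized lam X Y = f Y + 1 / (2 * lam) * block_dist l C X Y"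

definition env :: "real \<Rightarrow> real^'p^'n \<Rightarrow> real" where
  "env lam X = penalized lam X (prox f l C lam X)"

definition gap :: "real \<Rightarrow> real^'p^'n \<Rightarrow> real" where
  "gap lam X = f X - env lam X"

text \<open>\<open>prox\<close> is defined by choice; compactness of the manifold and continuity
  provide a minimizer, so the chosen point is one.\<close>

lemma
  assumes X: "X \<in> stiefel"
  shows prox_in: "prox f l C lam X \<in> stiefel"
    and env_le: "Z \<in> stiefel \<Longrightarrow> env lam X \<le> penalized lam X Z"
proof -
  have obj: "(\<lambda>Y. f Y + 1 / (2 * lam) * (avg_inv_norm l C X (Y - X))\<^sup>2) = penalized lam X"
    by (simp add: fun_eq_iff penalized_def avg_inv_norm_sq[OF l part X])
  have "continuous_on stiefel (\<lambda>Y. block_dist l C X Y)"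
    using continuous_on_compose2[OF continuous_on_block_dist[of UNIV l C], of stiefel "\<lambda>Y. (X, Y)"]
    by (simp add: continuous_on_Pair)
  then have "continuous_on stiefel (penalized lam X)"
    unfolding penalized_def
    by (intro continuous_intros continuous_on_subset[OF continuous_on_f stiefel_subset'])
  then have "\<exists>Y\<in>stiefel. \<forall>Z\<in>stiefel. penalized lam X Y \<le> penalized lam X Z"
    using X by (intro continuous_attains_inf compact_stiefel) auto
  then have "\<exists>Y. is_arg_min (penalized lam X) (\<lambda>Y. Y \<in> stiefel) Y"
    by (auto simp: is_arg_min_linorder)
  then have "is_arg_min (penalized lam X) (\<lambda>Y. Y \<in> stiefel) (prox f l C lam X)"
    unfolding prox_def obj arg_min_def by (rule someI_ex)
  then show "prox f l C lam X \<in> stiefel" "Z \<in> stiefel \<Longrightarrow> env lam X \<le> penalized lam X Z"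
    by (auto simp: is_arg_min_linorder env_def)
qed

lemma gap_nonneg:
  assumes "X \<in> stiefel"
  shows "0 \<le> gap lam X"
  using env_le[OF assms assms, of lam] by (simp add: gap_def penalized_def block_dist_self[OF assms])

lemma f_lipschitz:
  assumes "X \<in> \<Omega>" "Y \<in> \<Omega>"
  shows "f X \<le> f Y + L * norm (X - Y)"
  using lipschitz_onD[OF lipschitz assms] by (simp add: dist_real_def dist_norm)

text \<open>The proximal point of \<open>X\<close> competes in the problem at \<open>X'\<close>;
  only the block distance to it changes.\<close>

lemma env_lipschitz:
  assumes lam: "0 < lam"
  shows "\<exists>K>0. \<forall>X\<in>stiefel. \<forall>X'\<in>stiefel. env lam X' \<le> env lam X + K * norm (X' - X)"
proof -
  obtain K where K: "K > 0" "\<And>X X' Y :: real^'p^'n. X \<in> stiefel \<Longrightarrow> X' \<in> stiefel \<Longrightarrow> Y \<in> stiefel \<Longrightarrow>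
     block_dist l C X' Y \<le> block_dist l C X Y + K * norm (X' - X)"
    using block_dist_lipschitz[OF l, where 'p='p and 'n='n] by blast
  have "env lam X' \<le> env lam X + K / (2 * lam) * norm (X' - X)"
    if "X \<in> stiefel" "X' \<in> stiefel" for X X'
  proof -
    note Y = prox_in[OF that(1), of lam]
    have "1 / (2 * lam) * block_dist l C X' (prox f l C lam X)
       \<le> 1 / (2 * lam) * (block_dist l C X (prox f l C lam X) + K * norm (X' - X))"
      using K(2)[OF that Y] lam by (intro mult_left_mono) auto
    then have "penalized lam X' (prox f l C lam X) \<le> env lam X + K / (2 * lam) * norm (X' - X)"
      by (simp add: penalized_def env_def distrib_left)
    with env_le[OF that(2) Y] show ?thesis by (rule order_trans)
  qed
  moreover have "0 < K / (2 * lam)" using K(1) lam by simp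
  ultimately show ?thesis by blast
qed

lemma gap_lipschitz:
  assumes lam: "0 < lam"
  shows "\<exists>K>0. \<forall>X\<in>stiefel. \<forall>X'\<in>stiefel. \<bar>gap lam X' - gap lam X\<bar> \<le> K * norm (X' - X)"
proof -
  obtain K where K: "K > 0" "\<And>X X'. X \<in> stiefel \<Longrightarrow> X' \<in> stiefel \<Longrightarrow> env lam X'
      \<le> env lam X + K * norm (X' - X)"
    using env_lipschitz[OF lam] by blast
  have "\<bar>gap lam X' - gap lam X\<bar> \<le> (K + L) * norm (X' - X)" if "X \<in> stiefel" "X' \<in> stiefel" for X X'
  proof -
    have "X \<in> \<Omega>" "X' \<in> \<Omega>" using that stiefel_subset' by auto
    then show ?thesis
      using K(2)[OF that] K(2)[OF that(2,1)] f_lipschitz[of X X'] f_lipschitz[of X' X]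
      unfolding gap_def distrib_right norm_minus_commute[of X X'] abs_le_iff by simp
  qed
  moreover have "0 < K + L" using K(1) L by simp
  ultimately show ?thesis by blast
qed

lemma env_bounded_below:
  assumes lam: "0 < lam"
  shows "\<exists>B. \<forall>X\<in>stiefel. 0 \<le> env lam X + B"
proof -
  have "compact (f ` stiefel)"
    by (intro compact_continuous_image compact_stiefel continuous_on_subset[OF continuous_on_f
        stiefel_subset'])
  then obtain B where B: "\<And>Y. Y \<in> stiefel \<Longrightarrow> \<bar>f Y\<bar> \<le> B"
    using compact_imp_bounded[of "f ` stiefel"] by (auto simp: bounded_iff)
  have "0 \<le> env lam X + B" if "X \<in> stiefel" for X
  proof -
    have "0 \<le> real l / 2 * (norm (X - prox f l C lam X))\<^sup>2" by simp
    then have "0 \<le> block_dist l C X (prox f l C lam X)"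
      using block_dist_ge[OF l] by (rule order_trans)
    then have "0 \<le> 1 / (2 * lam) * block_dist l C X (prox f l C lam X)" using lam by simp
    then show ?thesis
      using B[OF prox_in[OF that, of lam]] unfolding env_def penalized_def abs_le_iff by linarith
  qed
  then show ?thesis by blast
qed

text \<open>The proximal point \<open>Y\<close> of the current \<open>X\<close> competes at every
  possible successor, so the expected envelope is controlled by the expected block distance to the
  fixed \<open>Y\<close>.\<close>

lemma avg_env_step:
  "\<exists>lam>0. \<exists>K>0. \<forall>X\<in>stiefel. \<forall>V\<in>clarke_subdiff f X. \<forall>\<gamma>. 0 < \<gamma> \<and> \<gamma> < 1 / L \<longrightarrow>
     (\<Sum>P\<in>pairs l. env lam (rssm_step (pair_cols C P) \<gamma> V X)) / card (pairs l)
       \<le> env lam X - \<gamma> / lam * gap lam X + K * \<gamma>\<^sup>2"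
proof -
  obtain K where K: "K > 0" "\<And>(X :: real^'p^'n) Y V \<gamma>. X \<in> stiefel \<Longrightarrow> Y \<in> stiefel \<Longrightarrow> norm V \<le> L \<Longrightarrow> 0 < \<gamma>
      \<Longrightarrow> \<gamma> < 1 / L \<Longrightarrow>
     (\<Sum>P\<in>pairs l. block_dist l C (rssm_step (pair_cols C P) \<gamma> V X) Y) / card (pairs l)
       \<le> block_dist l C X Y + 2 * \<gamma> * (V \<bullet> (Y - X)) + K * \<gamma> * (norm (Y - X))\<^sup>2 + K * \<gamma>\<^sup>2"
    using avg_block_dist_step[OF l part L, where 'n='n] by blast
  obtain S where S: "\<And>(X :: real^'p^'n) D V \<gamma>. X \<in> stiefel \<Longrightarrow> rssm_step D \<gamma> V X \<in> stiefel"
    using rssm_step_near[where 'n='n and 'p='p] by blast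
  \<comment> \<open>With this choice the penalty dominates the weak convexity defect, with factor
    \<open>\<tau> / 2\<close>, together with the expected error, with factor \<open>K / 2\<close>;
    this is used in \<open>key\<close>.\<close>
  define lam where "lam = 1 / (\<tau> + K)"
  have lam: "0 < lam" using tau K(1) by (simp add: lam_def)
  let ?N = "real (card (pairs l))"
  have N: "?N > 0" using l by (simp add: card_pairs zero_less_binomial)
  have "(\<Sum>P\<in>pairs l. env lam (rssm_step (pair_cols C P) \<gamma> V X)) / ?N
       \<le> env lam X - \<gamma> / lam * gap lam X + K / (2 * lam) * \<gamma>\<^sup>2"
    if X: "X \<in> stiefel" and V: "V \<in> clarke_subdiff f X" and g: "0 < \<gamma>" "\<gamma> < 1 / L" for X V \<gamma>
  proof -
    define Y where "Y = prox f l C lam X"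
    have Y: "Y \<in> stiefel" unfolding Y_def by (rule prox_in[OF X])
    have XY: "X \<in> interior \<Omega>" "Y \<in> interior \<Omega>" using X Y stiefel_subset by auto
    let ?D = "block_dist l C X Y" and ?n = "(norm (Y - X))\<^sup>2"
    have nV: "norm V \<le> L" by (rule norm_clarke_subdiff_le[OF XY(1) V])
    have sub: "V \<bullet> (Y - X) \<le> f Y - f X + \<tau> / 2 * ?n"
      using clarke_subdiff_ineq[OF XY V] by simp
    have "?n \<le> ?D"
    proof -
      have "1 * ?n \<le> real l / 2 * ?n" using l by (intro mult_right_mono) auto
      then show ?thesis using block_dist_ge[OF l, of X Y C] by (simp add: norm_minus_commute)
    qed
    then have *: "(\<tau> + K) / 2 * ?n \<le> (\<tau> + K) / 2 * ?D"
      using tau K(1) by (intro mult_left_mono) auto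
    have key: "V \<bullet> (Y - X) + K / 2 * ?n \<le> - gap lam X"
    proof -
      have "gap lam X = f X - (f Y + 1 / (2 * lam) * ?D)"
        by (simp add: gap_def env_def penalized_def Y_def)
      also have "1 / (2 * lam) = (\<tau> + K) / 2" by (simp add: lam_def)
      finally show ?thesis using sub * by (simp add: algebra_simps add_divide_distrib)
    qed
    have "(\<Sum>P\<in>pairs l. env lam (rssm_step (pair_cols C P) \<gamma> V X))
       \<le> (\<Sum>P\<in>pairs l. f Y + 1 / (2 * lam) * block_dist l C (rssm_step (pair_cols C P) \<gamma> V X) Y)"
      by (intro sum_mono order_trans[OF env_le[OF S[OF X] Y]]) (simp add: penalized_def)
    also have "\<dots> = ?N * f Y
        + 1 / (2 * lam) * (\<Sum>P\<in>pairs l. block_dist l C (rssm_step (pair_cols C P) \<gamma> V X) Y)"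
      by (simp add: sum.distrib sum_distrib_left)
    finally have "(\<Sum>P\<in>pairs l. env lam (rssm_step (pair_cols C P) \<gamma> V X)) / ?N
       \<le> (?N * f Y + 1 / (2 * lam) * (\<Sum>P\<in>pairs l. block_dist l C (rssm_step (pair_cols C P) \<gamma> V X) Y))
           / ?N"
      using N by (intro divide_right_mono) auto
    also have "\<dots> = f Y
        + 1 / (2 * lam) * ((\<Sum>P\<in>pairs l. block_dist l C (rssm_step (pair_cols C P) \<gamma> V X) Y) / ?N)"
      using N by (simp add: add_divide_distrib)
    also have "\<dots> \<le> f Y + 1 / (2 * lam) * (?D + 2 * \<gamma> * (V \<bullet> (Y - X)) + K * \<gamma> * ?n + K * \<gamma>\<^sup>2)"
      using K(2)[OF X Y nV g] lam by (intro add_left_mono mult_left_mono) auto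
    also have "\<dots> = env lam X + \<gamma> / lam * (V \<bullet> (Y - X) + K / 2 * ?n) + K / (2 * lam) * \<gamma>\<^sup>2"
      using lam by (simp add: env_def penalized_def Y_def[symmetric] field_simps)
    also have "\<dots> \<le> env lam X + \<gamma> / lam * (- gap lam X) + K / (2 * lam) * \<gamma>\<^sup>2"
      using key lam g by (intro add_left_mono add_right_mono mult_left_mono) auto
    finally show ?thesis by simp
  qed
  moreover have "0 < K / (2 * lam)" using K(1) lam by simp
  ultimately show ?thesis using lam by blast
qed

text \<open>A zero gap makes \<open>X\<close> a minimizer of its own proximal problem. The penalty
  is quadratically small and the retraction error too, so \<open>X\<close> is optimal along tangent
  directions up to a quadratic slack, and some Clarke subgradient is normal.\<close>

lemma stationary_of_gap_zero:
  assumes X: "X \<in> stiefel" and lam: "0 < lam" and gap: "gap lam X = 0"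
  shows "stationary f X"
proof -
  obtain K where K: "K > 0" "\<And>\<xi>. \<xi> \<in> stiefel_tangent X \<Longrightarrow>
     \<exists>Y\<in>stiefel. norm (Y - (X + \<xi>)) \<le> K * (norm \<xi>)\<^sup>2 \<and> norm (Y - X) \<le> norm \<xi>"
    using stiefel_retraction[where 'p='p and 'n='n] X by blast
  obtain M where M: "M > 0" "\<And>Y. Y \<in> stiefel \<Longrightarrow> block_dist l C X Y \<le> M * (norm (X - Y))\<^sup>2"
    using block_dist_quadratic[OF l, where 'p='p and 'n='n] X by blast
  have "f X \<le> f (X + \<xi>) + (L * K + 1 / (2 * lam) * M) * (norm \<xi>)\<^sup>2"
    if \<xi>: "\<xi> \<in> stiefel_tangent X" "X + \<xi> \<in> \<Omega>" for \<xi>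
  proof -
    obtain Y where Y: "Y \<in> stiefel" "norm (Y - (X + \<xi>)) \<le> K * (norm \<xi>)\<^sup>2" "norm (Y - X) \<le> norm \<xi>"
      using K(2)[OF \<xi>(1)] by blast
    have "f X \<le> penalized lam X Y"
      using env_le[OF X Y(1), of lam] gap by (simp add: gap_def)
    also have "\<dots> \<le> (f (X + \<xi>) + L * norm (Y - (X + \<xi>))) + 1 / (2 * lam) * (M * (norm (X - Y))\<^sup>2)"
      unfolding penalized_def using M(2)[OF Y(1)] lam Y(1) \<xi>(2) stiefel_subset'
      by (intro add_mono mult_left_mono f_lipschitz) auto
    also have "\<dots> \<le> (f (X + \<xi>) + L * (K * (norm \<xi>)\<^sup>2)) + 1 / (2 * lam) * (M * (norm \<xi>)\<^sup>2)"
      using Y L M(1) lam by (intro add_mono mult_left_mono power_mono order_refl)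
          (auto simp: norm_minus_commute)
    finally show ?thesis by (simp add: algebra_simps)
  qed
  then obtain g where g: "g \<in> clarke_subdiff f X" "\<And>\<xi>. \<xi> \<in> stiefel_tangent X \<Longrightarrow> g \<bullet> \<xi> = 0"
    using ex_clarke_subdiff_orthogonal[of X "stiefel_tangent X"] X stiefel_subset
        subspace_stiefel_tangent by blast
  then have "closest_point (stiefel_tangent X) g = 0"
    by (simp add: closest_point_eq_zero_iff[OF subspace_stiefel_tangent])
  with g(1) X show ?thesis
    unfolding stationary_def stiefel_subdiff_def by force
qed

text \<open>A normal subgradient \<open>V\<close> sees only the quadratic correction of the secant,
  so \<open>f\<close> drops by at most \<open>(\<tau> + L) / 2\<close> times the squared distance.
  The penalty exceeds this when \<open>2 * lam * (\<tau> + L) < real l\<close>, which the range of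
  \<open>lam\<close> implies because \<open>2 * real l - 1\<close> is at least 1.\<close>

lemma stationary_strict_min:
  assumes X: "stationary f X" and Y: "Y \<in> stiefel"
    and lam: "0 < lam" "lam < real l / (2 * (\<tau> + (2 * real l - 1) * L))"
    and le: "penalized lam X Y \<le> f X"
  shows "Y = X"
proof (rule ccontr)
  assume "Y \<noteq> X"
  then have pos: "0 < (norm (Y - X))\<^sup>2" by simp
  have XS: "X \<in> stiefel" using X by (simp add: stationary_def)
  have XY: "X \<in> interior \<Omega>" "Y \<in> interior \<Omega>" using XS Y stiefel_subset by auto
  obtain V where V: "V \<in> clarke_subdiff f X" "closest_point (stiefel_tangent X) V = 0"
    using X by (force simp: stationary_def stiefel_subdiff_def)
  let ?W = "Y - X"
  let ?Q = "X ** (transpose ?W ** ?W)"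
  have nV: "norm V \<le> L" by (rule norm_clarke_subdiff_le[OF XY(1) V(1)])
  have "V \<bullet> (?W + (1/2) *\<^sub>R ?Q) = 0"
    using V(2) stiefel_tangent_secant[OF XS Y]
        by (simp add: closest_point_eq_zero_iff[OF subspace_stiefel_tangent])
  then have VW: "V \<bullet> ?W = - (1/2) * (V \<bullet> ?Q)" by (simp add: inner_add_right)
  have "V \<bullet> ?Q \<le> norm V * norm ?Q" by (rule norm_cauchy_schwarz)
  also have "\<dots> \<le> L * (norm ?W)\<^sup>2"
    using nV L norm_matrix_mult_le[of "transpose ?W" ?W]
    by (intro mult_mono) (auto simp: norm_stiefel_mult[OF XS] norm_transpose power2_eq_square)
  finally have "- (1/2) * (L * (norm ?W)\<^sup>2) \<le> V \<bullet> ?W" unfolding VW by simp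
  moreover have "f X + V \<bullet> ?W \<le> f Y + \<tau> / 2 * (norm ?W)\<^sup>2"
    by (rule clarke_subdiff_ineq[OF XY V(1)])
  moreover have "1 / (2 * lam) * (real l / 2 * (norm ?W)\<^sup>2) \<le> 1 / (2 * lam) * block_dist l C X Y"
    using block_dist_ge[OF l, of X Y C] lam by (intro mult_left_mono) (auto simp: norm_minus_commute)
  ultimately have "(real l / (2 * lam)) * (norm ?W)\<^sup>2 \<le> (\<tau> + L) * (norm ?W)\<^sup>2"
    using le by (simp add: penalized_def algebra_simps)
  then have "real l / (2 * lam) \<le> \<tau> + L" using pos by (rule mult_right_le_imp_le)
  then have "real l \<le> 2 * lam * (\<tau> + L)" using lam by (simp add: field_simps)
  also have "\<dots> \<le> 2 * lam * (\<tau> + (2 * real l - 1) * L)"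
    using lam L l by (intro mult_left_mono add_left_mono) auto
  also have "\<dots> < real l"
  proof -
    have "0 < \<tau> + (2 * real l - 1) * L" using tau L l by (intro add_nonneg_pos mult_pos_pos) auto
    then have "0 < 2 * (\<tau> + (2 * real l - 1) * L)" by simp
    from lam(2)[unfolded pos_less_divide_eq[OF this]] show ?thesis
        by (simp only: mult.assoc mult.left_commute[of lam])
  qed
  finally show False by simp
qed

text \<open>The gap is Lipschitz on the closed manifold, so it vanishes at accumulation
  points.\<close>

lemma gap_limit_stationary:
  assumes lam: "0 < lam" and x: "\<And>k. x k \<in> stiefel" and gap: "(\<lambda>k. gap lam (x k)) \<longlonglongrightarrow> 0"
    and acc: "accumulation_point x a"
  shows "stationary f a"
proof -
  obtain r where r: "strict_mono r" "(x \<circ> r) \<longlonglongrightarrow> a" using acc by (auto simp: accumulation_point_def)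
  have a: "a \<in> stiefel"
    by (rule closed_sequentially[OF compact_imp_closed[OF compact_stiefel] _ r(2)]) (simp add: x)
  obtain K where K: "K > 0" "\<And>X X'. X \<in> stiefel \<Longrightarrow> X' \<in> stiefel \<Longrightarrow> \<bar>gap lam X' - gap lam X\<bar>
      \<le> K * norm (X' - X)"
    using gap_lipschitz[OF lam] by blast
  have "(\<lambda>k. K * norm (x (r k) - a)) \<longlonglongrightarrow> K * norm (a - a)"
    using r(2) by (intro tendsto_intros) (simp add: o_def)
  then have lim: "(\<lambda>k. K * norm (x (r k) - a)) \<longlonglongrightarrow> 0" by simp
  have "(\<lambda>k. gap lam (x (r k)) - gap lam a) \<longlonglongrightarrow> 0"
    by (rule Lim_null_comparison[OF _ lim]) (simp add: K(2) a x)
  moreover have "(\<lambda>k. gap lam (x (r k))) \<longlonglongrightarrow> 0"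
    using LIMSEQ_subseq_LIMSEQ[OF gap r(1)] by (simp add: o_def)
  ultimately have "(\<lambda>k. gap lam (x (r k)) - (gap lam (x (r k)) - gap lam a)) \<longlonglongrightarrow> 0 - 0"
    by (intro tendsto_diff)
  then have "gap lam a = 0" by (simp add: LIMSEQ_const_iff)
  then show ?thesis by (rule stationary_of_gap_zero[OF a lam])
qed

text \<open>If the proximal displacement stayed away from zero, iterates and proximal points would
  have distinct limits along a common subsequence. The first limit is stationary, and passing to the
  limit in \<open>pen\<close> contradicts \<open>stationary_strict_min\<close>.\<close>

lemma Theta_tendsto_zero:
  assumes lam: "0 < lam" "lam < real l / (2 * (\<tau> + (2 * real l - 1) * L))"
    and x: "\<And>k. x k \<in> stiefel" and acc: "\<And>a. accumulation_point x a \<Longrightarrow> stationary f a"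
  shows "(\<lambda>k. Theta f l C lam (x k)) \<longlonglongrightarrow> 0"
proof -
  define y where "y k = prox f l C lam (x k)" for k
  have y: "y k \<in> stiefel" for k unfolding y_def by (rule prox_in[OF x])
  have pen: "penalized lam (x k) (y k) \<le> f (x k)" for k
    using gap_nonneg[OF x, of lam k] by (simp add: gap_def env_def y_def)
  have dist: "(\<lambda>k. x k - y k) \<longlonglongrightarrow> 0"
  proof (rule ccontr)
    assume "\<not> (\<lambda>k. x k - y k) \<longlonglongrightarrow> 0"
    then obtain e where e: "e > 0" "\<not> (\<forall>\<^sub>F k in sequentially. norm (x k - y k) < e)"
      by (auto simp: tendsto_iff dist_norm)
    obtain r :: "nat \<Rightarrow> nat" where r: "strict_mono r" "\<And>k. \<not> norm (x (r k) - y (r k)) < e"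
      using not_eventually_sequentiallyD[OF e(2)] by blast
    have "seq_compact ((stiefel :: (real^'p^'n) set) \<times> (stiefel :: (real^'p^'n) set))"
      by (intro compact_imp_seq_compact compact_Times compact_stiefel)
    then obtain ab s where ab: "ab \<in> stiefel \<times> stiefel" and s: "strict_mono s"
      "((\<lambda>k. (x (r k), y (r k))) \<circ> s) \<longlonglongrightarrow> ab"
      by (rule seq_compactE[where f = "\<lambda>k. (x (r k), y (r k))"]) (use x y in auto)
    obtain a b where "ab = (a, b)" by (cases ab)
    with ab s have a: "a \<in> stiefel" "b \<in> stiefel" and lim: "(\<lambda>k. (x (r (s k)), y (r (s k)))) \<longlonglongrightarrow> (a, b)"
      by (auto simp: o_def)
    have limx: "(\<lambda>k. x (r (s k))) \<longlonglongrightarrow> a" and limy: "(\<lambda>k. y (r (s k))) \<longlonglongrightarrow> b"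
      using tendsto_fst[OF lim] tendsto_snd[OF lim] by simp_all
    have "accumulation_point x a"
      unfolding accumulation_point_def
      by (rule exI[of _ "r \<circ> s"]) (use limx r(1) s(1) in \<open>simp add: o_def strict_mono_def\<close>)
    then have st: "stationary f a" by (rule acc)
    have "isCont f a" "isCont f b" using a stiefel_subset isCont_f by blast+
    then have fl: "(\<lambda>k. f (x (r (s k)))) \<longlonglongrightarrow> f a" "(\<lambda>k. f (y (r (s k)))) \<longlonglongrightarrow> f b"
      using isCont_tendsto_compose[OF _ limx, of f] isCont_tendsto_compose[OF _ limy, of f] by simp_all
    have "isCont (\<lambda>p. block_dist l C (fst p) (snd p)) (a, b)"
      using continuous_on_block_dist[of "UNIV :: ((real^'p^'n) \<times> (real^'p^'n)) set" l C]
      by (simp add: continuous_on_eq_continuous_at)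
    from isCont_tendsto_compose[OF this lim]
    have "(\<lambda>k. penalized lam (x (r (s k))) (y (r (s k)))) \<longlonglongrightarrow> penalized lam a b"
      unfolding penalized_def by (intro tendsto_intros fl) simp
    then have "penalized lam a b \<le> f a"
      by (rule LIMSEQ_le[OF _ fl(1)]) (use pen in auto)
    then have "b = a" by (rule stationary_strict_min[OF st a(2) lam])
    have "(\<lambda>k. norm (x (r (s k)) - y (r (s k)))) \<longlonglongrightarrow> norm (a - b)"
      by (intro tendsto_intros limx limy)
    then have "e \<le> norm (a - b)"
      by (rule LIMSEQ_le_const) (use r(2) in \<open>auto simp: not_less\<close>)
    then show False using e(1) \<open>b = a\<close> by simp
  qed
  obtain M where M: "M > 0" "\<And>X Y :: real^'p^'n. X \<in> stiefel \<Longrightarrow> Y \<in> stiefel \<Longrightarrow> block_dist l C X Y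
      \<le> M * (norm (X - Y))\<^sup>2"
    using block_dist_quadratic[OF l, where 'p='p and 'n='n] by blast
  have "norm (Theta f l C lam (x k)) \<le> 1 / lam * (sqrt M * norm (x k - y k))" for k
  proof -
    let ?A = "avg_inv_norm l C (x k) (y k - x k)"
    have "?A\<^sup>2 \<le> (sqrt M * norm (x k - y k))\<^sup>2"
      using M(1) M(2)[OF x[of k] y[of k]] unfolding avg_inv_norm_sq(1)[OF l part x[of k]]
      by (simp add: power_mult_distrib)
    then have "?A \<le> sqrt M * norm (x k - y k)"
      by (rule power2_le_imp_le) (use M(1) in simp)
    then show ?thesis
      using avg_inv_norm_sq(2)[OF l part x[of k], of "y k"] lam(1)
      by (simp add: Theta_def y_def divide_right_mono)
  qed
  moreover have "(\<lambda>k. 1 / lam * (sqrt M * norm (x k - y k))) \<longlonglongrightarrow> 0"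
    using tendsto_norm_zero[OF dist] by (intro tendsto_mult_right_zero)
  ultimately show ?thesis
    by (rule Lim_null_comparison[OF always_eventually[OF allI]])
qed

end

subsection \<open>Descent along uniform random draws\<close>

text \<open>The squares \<open>h\<^sub>k\<^sup>2\<close> have absolutely summable increments and therefore converge.\<close>

lemma tendsto_zero_of_summable_weighted:
  fixes h \<gamma> :: "nat \<Rightarrow> real"
  assumes h: "\<And>k. 0 \<le> h k" and g: "\<And>k. 0 < \<gamma> k"
    and diverge: "filterlim (\<lambda>N. \<Sum>k<N. \<gamma> k) at_top sequentially"
    and sq: "summable (\<lambda>k. (\<gamma> k)\<^sup>2)" and weighted: "summable (\<lambda>k. \<gamma> k * h k)"
    and step: "\<And>k. \<bar>h (Suc k) - h k\<bar> \<le> K * \<gamma> k"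
  shows "h \<longlonglongrightarrow> 0"
proof -
  have "0 \<le> K * \<gamma> 0" using step[of 0] by (rule order_trans[OF abs_ge_zero])
  then have K: "0 \<le> K" using g[of 0] by (simp add: zero_le_mult_iff)
  have bound: "norm ((h (Suc k))\<^sup>2 - (h k)\<^sup>2) \<le> 2 * K * (\<gamma> k * h k) + K\<^sup>2 * (\<gamma> k)\<^sup>2" for k
  proof -
    \<comment> \<open>The factor \<open>h (Suc k) + h k\<close> supplies the weight
      \<open>h k\<close> that makes the increments summable.\<close>
    have "(h (Suc k))\<^sup>2 - (h k)\<^sup>2 = (h (Suc k) - h k) * (h (Suc k) + h k)"
      by (simp add: power2_eq_square algebra_simps)
    then have "\<bar>(h (Suc k))\<^sup>2 - (h k)\<^sup>2\<bar> = \<bar>h (Suc k) - h k\<bar> * (h (Suc k) + h k)"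
      using h[of k] h[of "Suc k"] by (simp only: abs_mult abs_of_nonneg[OF add_nonneg_nonneg])
    also have "\<dots> \<le> (K * \<gamma> k) * (2 * h k + K * \<gamma> k)"
      using step[of k] h[of k] h[of "Suc k"] by (intro mult_mono) auto
    also have "\<dots> = 2 * K * (\<gamma> k * h k) + K\<^sup>2 * (\<gamma> k)\<^sup>2"
      by (simp add: power2_eq_square distrib_left)
    finally show ?thesis by simp
  qed
  have "summable (\<lambda>k. 2 * K * (\<gamma> k * h k) + K\<^sup>2 * (\<gamma> k)\<^sup>2)"
    by (rule summable_add[OF summable_mult[OF weighted] summable_mult[OF sq]])
  then have "summable (\<lambda>k. (h (Suc k))\<^sup>2 - (h k)\<^sup>2)"
    by (rule summable_comparison_test'[where N = 0, OF _ bound])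
  then have "convergent (\<lambda>N. (h N)\<^sup>2 - (h 0)\<^sup>2)"
    by (simp add: summable_iff_convergent sum_lessThan_telescope[of "\<lambda>k. (h k)\<^sup>2"])
  from convergent_add[OF this convergent_const[of "(h 0)\<^sup>2"]] have "convergent (\<lambda>N. (h N)\<^sup>2)"
    by simp
  then obtain c where c: "(\<lambda>k. (h k)\<^sup>2) \<longlonglongrightarrow> c" by (auto simp: convergent_def)
  then have "(\<lambda>k. sqrt ((h k)\<^sup>2)) \<longlonglongrightarrow> sqrt c" by (rule tendsto_real_sqrt)
  then have lim: "h \<longlonglongrightarrow> sqrt c" using h by simp
  \<comment> \<open>A positive limit would dominate \<open>\<gamma>\<close> by a multiple of the
    summable weighted sequence.\<close>
  have "sqrt c = 0"
  proof (rule ccontr)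
    assume nz: "sqrt c \<noteq> 0"
    have "0 \<le> sqrt c" by (rule LIMSEQ_le_const[OF lim]) (use h in auto)
    with nz have pos: "0 < sqrt c" by simp
    then have "\<forall>\<^sub>F k in sequentially. sqrt c / 2 < h k"
      by (intro order_tendstoD(1)[OF lim]) simp
    then have "\<forall>\<^sub>F k in sequentially. norm (\<gamma> k) \<le> 2 / sqrt c * (\<gamma> k * h k)"
    proof eventually_elim
      case (elim k)
      then have "\<gamma> k * (sqrt c / 2) \<le> \<gamma> k * h k" using g[of k] by (intro mult_left_mono) auto
      then show ?case using pos g[of k] by (simp add: field_simps)
    qed
    then have "summable \<gamma>"
      by (rule summable_comparison_test_ev) (rule summable_mult[OF weighted])
    then have "(\<lambda>N. \<Sum>k<N. \<gamma> k) \<longlonglongrightarrow> suminf \<gamma>" by (rule summable_LIMSEQ)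
    with diverge show False
      using not_tendsto_and_filterlim_at_infinity[of sequentially "\<lambda>N. \<Sum>k<N. \<gamma> k"]
      by (simp add: filterlim_at_top_imp_at_infinity)
  qed
  with lim show ?thesis by simp
qed

text \<open>Adaptedness as plain dependence on the first \<open>k\<close> draws, so that arbitrary
  subgradient selections are covered.\<close>

definition nonanticipating :: "'a set \<Rightarrow> nat \<Rightarrow> ((nat \<Rightarrow> 'a) \<Rightarrow> 'b) \<Rightarrow> bool" where
  "nonanticipating A k g \<longleftrightarrow> (\<forall>\<omega>\<in>UNIV \<rightarrow> A. \<forall>\<omega>'\<in>UNIV \<rightarrow> A. (\<forall>j<k. \<omega> j = \<omega>' j) \<longrightarrow> g \<omega> = g \<omega>')"

lemma nonanticipating_compose:
  assumes "nonanticipating A k g"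
  shows "nonanticipating A k (\<lambda>\<omega>. F (g \<omega>))"
  unfolding nonanticipating_def
  by (intro ballI impI arg_cong[where f = F] assms[unfolded nonanticipating_def, rule_format]) auto

locale uniform_draws =
  fixes A :: "'a set" and S :: "(nat \<Rightarrow> 'a) measure"
  assumes fin: "finite A" and ne: "A \<noteq> {}"
  defines "S \<equiv> \<Pi>\<^sub>M k\<in>UNIV. uniform_count_measure A"
begin

sublocale U: prob_space "uniform_count_measure A"
  using fin ne by (rule prob_space_uniform_count_measure)

sublocale seq: sequence_space "uniform_count_measure A" ..

lemma space_S: "space S = UNIV \<rightarrow> A"
  by (auto simp: S_def space_PiM space_uniform_count_measure PiE_def)

lemma prob_space_S: "prob_space S"
  unfolding S_def by (rule seq.prob_space_axioms)

text \<open>With finitely many possible prefixes of length \<open>k\<close>, the function is a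
  finite combination of indicators of cylinder sets.\<close>

lemma nonanticipating_measurable:
  fixes g :: "(nat \<Rightarrow> 'a) \<Rightarrow> real"
  assumes g: "nonanticipating A k g"
  shows "g \<in> borel_measurable S"
proof -
  obtain a where a: "a \<in> A" using ne by blast
  \<comment> \<open>The prefix is padded with an arbitrary element \<open>a\<close> of
    \<open>A\<close>, to which \<open>g\<close> is insensitive.\<close>
  define G where "G xs = g (\<lambda>j. if j < k then xs ! j else a)" for xs
  let ?I = "{xs. set xs \<subseteq> A \<and> length xs = k}"
  define E where "E xs = {\<omega> \<in> space S. \<forall>j<k. \<omega> j = xs ! j}" for xs
  have E: "E xs \<in> sets S" if "xs \<in> ?I" for xs
  proof -
    have "E xs = {\<omega> \<in> space S. \<forall>j\<in>{..<k}. \<omega> j \<in> {xs ! j}}" by (auto simp: E_def)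
    also have "\<dots> \<in> sets S"
    proof (rule sets.sets_Collect_finite_All)
      fix j assume "j \<in> {..<k}"
      then have "{xs ! j} \<in> sets (uniform_count_measure A)"
        using that by (auto simp: sets_uniform_count_measure)
      then show "{\<omega> \<in> space S. \<omega> j \<in> {xs ! j}} \<in> sets S"
        unfolding S_def by (intro sets_Collect_single) auto
    qed auto
    finally show ?thesis .
  qed
  have fI: "finite ?I" using fin by (rule finite_lists_length_eq)
  have "g \<omega> = (\<Sum>xs\<in>?I. G xs * indicator (E xs) \<omega>)" if "\<omega> \<in> space S" for \<omega>
  proof -
    have w: "\<omega> \<in> UNIV \<rightarrow> A" using that by (simp add: space_S)
    let ?xs = "map \<omega> [0..<k]"
    have xs: "?xs \<in> ?I" using w by auto
    have "(\<Sum>xs\<in>?I. G xs * indicator (E xs) \<omega>) = (\<Sum>xs\<in>?I. if xs = ?xs then G xs else 0)"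
      using that by (intro sum.cong refl) (auto simp: E_def indicator_def list_eq_iff_nth_eq)
    also have "\<dots> = G ?xs" using fI xs by simp
    also have "\<dots> = g \<omega>"
      unfolding G_def using w a by (intro g[unfolded nonanticipating_def, rule_format]) auto
    finally show ?thesis by simp
  qed
  moreover have "(\<lambda>\<omega>. \<Sum>xs\<in>?I. G xs * indicator (E xs) \<omega>) \<in> borel_measurable S"
    using E by (intro borel_measurable_sum borel_measurable_times borel_measurable_indicator) auto
  ultimately show ?thesis
    by (subst measurable_cong) auto
qed

lemma nonanticipating_resample:
  assumes g: "nonanticipating A (Suc k) g" and a: "a \<in> A"
  shows "nonanticipating A k (\<lambda>\<omega>. g (fun_upd \<omega> k a))"
  unfolding nonanticipating_def
proof (intro ballI impI)
  fix \<omega> \<omega>' assume w: "\<omega> \<in> UNIV \<rightarrow> A" "\<omega>' \<in> UNIV \<rightarrow> A" "\<forall>j<k. \<omega> j = \<omega>' j"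
  show "g (fun_upd \<omega> k a) = g (fun_upd \<omega>' k a)"
    using w a by (intro g[unfolded nonanticipating_def, rule_format]) (auto simp: less_Suc_eq)
qed

text \<open>Takes the place of conditional expectation. Joining the first \<open>k\<close> draws of
  one sequence with an independent second sequence preserves the measure; position \<open>k\<close>
  is then a fresh uniform draw, which is integrated first.\<close>

lemma nn_integral_resample:
  fixes g :: "(nat \<Rightarrow> 'a) \<Rightarrow> real"
  assumes g: "nonanticipating A (Suc k) g" and nn: "\<And>\<omega>. 0 \<le> g \<omega>"
  shows "(\<integral>\<^sup>+\<omega>. ennreal (g \<omega>) \<partial>S) = (\<integral>\<^sup>+\<omega>. ennreal ((\<Sum>a\<in>A. g (fun_upd \<omega> k a)) / card A) \<partial>S)"
proof -
  interpret prob_space S by (rule prob_space_S)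
  let ?U = "uniform_count_measure A"
  have gm: "g \<in> borel_measurable S" by (rule nonanticipating_measurable[OF g])
  have comb: "(\<lambda>(\<omega>, \<omega>'). comb_seq k \<omega> \<omega>') \<in> measurable (S \<Otimes>\<^sub>M S) S"
    unfolding S_def by (rule measurable_comb_seq)
  have D: "distr (S \<Otimes>\<^sub>M S) S (\<lambda>(\<omega>, \<omega>'). comb_seq k \<omega> \<omega>') = S"
    unfolding S_def by (rule seq.PiM_comb_seq)
  have c0: "(\<lambda>\<omega>. \<omega> 0) \<in> measurable S ?U" unfolding S_def by (rule measurable_component_singleton) simp
  have D0: "distr S ?U (\<lambda>\<omega>. \<omega> 0) = ?U"
    unfolding S_def by (rule distr_PiM_component) (auto intro: U.prob_space_axioms)
  have "(\<integral>\<^sup>+\<omega>. ennreal (g \<omega>) \<partial>S) = (\<integral>\<^sup>+\<omega>. ennreal (g \<omega>) \<partial>distr (S \<Otimes>\<^sub>M S) S (\<lambda>(\<omega>, \<omega>'). comb_seq k \<omega> \<omega>'))"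
    by (simp only: D)
  also have "\<dots> = (\<integral>\<^sup>+p. ennreal (g (case p of (\<omega>, \<omega>') \<Rightarrow> comb_seq k \<omega> \<omega>')) \<partial>(S \<Otimes>\<^sub>M S))"
    by (rule nn_integral_distr[OF comb]) (use gm in measurable)
  also have "\<dots> = (\<integral>\<^sup>+\<omega>. \<integral>\<^sup>+\<omega>'. ennreal (g (comb_seq k \<omega> \<omega>')) \<partial>S \<partial>S)"
  proof -
    have "(\<lambda>p. ennreal (g (case p of (\<omega>, \<omega>') \<Rightarrow> comb_seq k \<omega> \<omega>'))) \<in> borel_measurable (S \<Otimes>\<^sub>M S)"
      using measurable_compose[OF comb gm] by simp
    from nn_integral_fst[OF this] show ?thesis by simp
  qed
  also have "\<dots> = (\<integral>\<^sup>+\<omega>. ennreal ((\<Sum>a\<in>A. g (fun_upd \<omega> k a)) / card A) \<partial>S)"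
  proof (rule nn_integral_cong)
    fix \<omega> assume "\<omega> \<in> space S"
    then have w: "\<omega> \<in> UNIV \<rightarrow> A" by (simp add: space_S)
    \<comment> \<open>The joined sequence has \<open>\<omega>' 0\<close> at position
      \<open>k\<close>, and \<open>g\<close> reads nothing beyond that position.\<close>
    have "(\<integral>\<^sup>+\<omega>'. ennreal (g (comb_seq k \<omega> \<omega>')) \<partial>S) = (\<integral>\<^sup>+\<omega>'. ennreal (g (fun_upd \<omega> k (\<omega>' 0))) \<partial>S)"
    proof (rule nn_integral_cong)
      fix \<omega>' assume "\<omega>' \<in> space S"
      then have w': "\<omega>' \<in> UNIV \<rightarrow> A" by (simp add: space_S)
      have "g (comb_seq k \<omega> \<omega>') = g (fun_upd \<omega> k (\<omega>' 0))"
        using w w' by (intro g[unfolded nonanticipating_def, rule_format]) (auto simp: comb_seq_def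
            less_Suc_eq Pi_iff)
      then show "ennreal (g (comb_seq k \<omega> \<omega>')) = ennreal (g (fun_upd \<omega> k (\<omega>' 0)))" by simp
    qed
    also have "\<dots> = (\<integral>\<^sup>+a. ennreal (g (fun_upd \<omega> k a)) \<partial>distr S ?U (\<lambda>\<omega>. \<omega> 0))"
      by (rule nn_integral_distr[symmetric, OF c0]) (auto simp: measurable_def
          sets_uniform_count_measure space_uniform_count_measure)
    also have "\<dots> = (\<integral>\<^sup>+a. ennreal (g (fun_upd \<omega> k a)) \<partial>?U)" by (simp only: D0)
    also have "\<dots> = (\<Sum>a\<in>A. ennreal (1 / card A) * ennreal (g (fun_upd \<omega> k a)))"
      unfolding uniform_count_measure_def using fin ne
      by (subst nn_integral_point_measure_finite) (auto simp: card_gt_0_iff mult.commute)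
    also have "\<dots> = ennreal ((\<Sum>a\<in>A. g (fun_upd \<omega> k a)) / card A)"
      using nn by (simp add: sum_divide_distrib flip: ennreal_mult)
    finally show "(\<integral>\<^sup>+\<omega>'. ennreal (g (comb_seq k \<omega> \<omega>')) \<partial>S)
        = ennreal ((\<Sum>a\<in>A. g (fun_upd \<omega> k a)) / card A)" .
  qed
  finally show ?thesis .
qed

text \<open>Integrating the descent inequality and telescoping bounds the sum of the expectations of
  \<open>\<eta>\<close>. Monotone convergence makes the random series integrable, hence finite
  almost surely.\<close>

lemma AE_summable_of_avg_descent:
  fixes \<phi> \<eta> :: "nat \<Rightarrow> (nat \<Rightarrow> 'a) \<Rightarrow> real" and e :: "nat \<Rightarrow> real"
  assumes \<phi>: "\<And>k. nonanticipating A k (\<phi> k)" "\<And>k \<omega>. 0 \<le> \<phi> k \<omega>"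
    and \<eta>: "\<And>k. nonanticipating A k (\<eta> k)" "\<And>k \<omega>. 0 \<le> \<eta> k \<omega>"
    and e: "\<And>k. 0 \<le> e k" "summable e"
    and descent: "\<And>k \<omega>. \<omega> \<in> UNIV \<rightarrow> A \<Longrightarrow>
      (\<Sum>a\<in>A. \<phi> (Suc k) (fun_upd \<omega> k a)) / card A + \<eta> k \<omega> \<le> \<phi> k \<omega> + e k"
  shows "AE \<omega> in S. summable (\<lambda>k. \<eta> k \<omega>)"
proof -
  interpret prob_space S by (rule prob_space_S)
  have \<phi>m: "\<phi> k \<in> borel_measurable S" and \<eta>m: "\<eta> k \<in> borel_measurable S" for k
    using \<phi> \<eta> nonanticipating_measurable by blast+
  let ?\<Phi> = "\<lambda>k. \<integral>\<^sup>+\<omega>. ennreal (\<phi> k \<omega>) \<partial>S" and ?H = "\<lambda>k. \<integral>\<^sup>+\<omega>. ennreal (\<eta> k \<omega>) \<partial>S"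
  have step: "?\<Phi> (Suc k) + ?H k \<le> ?\<Phi> k + ennreal (e k)" for k
  proof -
    let ?m = "\<lambda>\<omega>. (\<Sum>a\<in>A. \<phi> (Suc k) (fun_upd \<omega> k a)) / card A"
    have m: "?m \<in> borel_measurable S"
      using nonanticipating_measurable[OF nonanticipating_resample[OF \<phi>(1)]] by measurable
    have m0: "0 \<le> ?m \<omega>" for \<omega> using \<phi>(2) by (intro divide_nonneg_nonneg sum_nonneg) auto
    have "?\<Phi> (Suc k) + ?H k = (\<integral>\<^sup>+\<omega>. ennreal (?m \<omega>) \<partial>S) + ?H k"
      by (simp only: nn_integral_resample[OF \<phi>])
    also have "\<dots> = (\<integral>\<^sup>+\<omega>. ennreal (?m \<omega>) + ennreal (\<eta> k \<omega>) \<partial>S)"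
      using m \<eta>m by (intro nn_integral_add[symmetric]) auto
    also have "\<dots> \<le> (\<integral>\<^sup>+\<omega>. ennreal (\<phi> k \<omega>) + ennreal (e k) \<partial>S)"
    proof (rule nn_integral_mono)
      fix \<omega> assume "\<omega> \<in> space S"
      then have "?m \<omega> + \<eta> k \<omega> \<le> \<phi> k \<omega> + e k" by (intro descent) (simp add: space_S)
      then show "ennreal (?m \<omega>) + ennreal (\<eta> k \<omega>) \<le> ennreal (\<phi> k \<omega>) + ennreal (e k)"
        using m0[of \<omega>] \<eta>(2)[of k \<omega>] \<phi>(2)[of k \<omega>] e(1)[of k] by (simp add: ennreal_leI flip: ennreal_plus)
    qed
    also have "\<dots> = ?\<Phi> k + ennreal (e k)"
      using \<phi>m by (subst nn_integral_add) (auto simp: emeasure_space_1)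
    finally show ?thesis .
  qed
  have sum: "?\<Phi> N + (\<Sum>k<N. ?H k) \<le> ?\<Phi> 0 + (\<Sum>k<N. ennreal (e k))" for N
  proof (induction N)
    case (Suc N)
    have "?\<Phi> (Suc N) + (\<Sum>k<Suc N. ?H k) = (?\<Phi> (Suc N) + ?H N) + (\<Sum>k<N. ?H k)"
      by (simp add: ac_simps)
    also have "\<dots> \<le> (?\<Phi> N + ennreal (e N)) + (\<Sum>k<N. ?H k)" by (intro add_right_mono step)
    also have "\<dots> = (?\<Phi> N + (\<Sum>k<N. ?H k)) + ennreal (e N)" by (simp add: ac_simps)
    also have "\<dots> \<le> (?\<Phi> 0 + (\<Sum>k<N. ennreal (e k))) + ennreal (e N)" by (intro add_right_mono Suc)
    finally show ?case by (simp add: ac_simps)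
  qed simp
  obtain a where a: "a \<in> A" using ne by blast
  \<comment> \<open>Before any draw the potential is constant, so its initial expectation is
    finite.\<close>
  have "\<phi> 0 \<omega> = \<phi> 0 (\<lambda>_. a)" if "\<omega> \<in> space S" for \<omega>
    using that a by (intro \<phi>(1)[of 0, unfolded nonanticipating_def, rule_format]) (auto simp: space_S)
  then have "?\<Phi> 0 = (\<integral>\<^sup>+\<omega>. ennreal (\<phi> 0 (\<lambda>_. a)) \<partial>S)"
    by (intro nn_integral_cong) simp
  then have \<Phi>0: "?\<Phi> 0 = ennreal (\<phi> 0 (\<lambda>_. a))" by (simp add: emeasure_space_1)
  have "(\<Sum>k<N. ?H k) \<le> ennreal (\<phi> 0 (\<lambda>_. a) + suminf e)" for N
  proof -
    have "(\<Sum>k<N. ?H k) \<le> ?\<Phi> N + (\<Sum>k<N. ?H k)" by simp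
    also have "\<dots> \<le> ?\<Phi> 0 + (\<Sum>k<N. ennreal (e k))" by (rule sum)
    also have "?\<Phi> 0 + (\<Sum>k<N. ennreal (e k)) = ennreal (\<phi> 0 (\<lambda>_. a) + (\<Sum>k<N. e k))"
      using e(1) \<phi>(2) by (simp add: \<Phi>0 sum_nonneg)
    also have "\<dots> \<le> ennreal (\<phi> 0 (\<lambda>_. a) + suminf e)"
      using e by (intro ennreal_leI add_left_mono sum_le_suminf) auto
    finally show ?thesis .
  qed
  then have "(\<Sum>k. ?H k) \<le> ennreal (\<phi> 0 (\<lambda>_. a) + suminf e)"
    by (rule suminf_le_const[rotated]) simp
  moreover have "(\<Sum>k. ?H k) = (\<integral>\<^sup>+\<omega>. (\<Sum>k. ennreal (\<eta> k \<omega>)) \<partial>S)"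
    using \<eta>m by (intro nn_integral_suminf[symmetric]) auto
  ultimately have "(\<integral>\<^sup>+\<omega>. (\<Sum>k. ennreal (\<eta> k \<omega>)) \<partial>S) \<noteq> \<infinity>"
    by (auto simp: top_unique)
  then have "AE \<omega> in S. (\<Sum>k. ennreal (\<eta> k \<omega>)) \<noteq> \<infinity>"
    using \<eta>m by (intro nn_integral_PInf_AE) auto
  then show ?thesis
  proof eventually_elim
    case (elim \<omega>)
    then show ?case using \<eta>(2) by (intro summable_suminf_not_top) auto
  qed
qed

end

subsection \<open>Almost sure convergence\<close>

theorem theorem4p10:
  fixes f :: "real^'p^'n \<Rightarrow> real"
    and \<Omega> :: "(real^'p^'n) set"
    and \<tau> L :: real
    and l :: nat
    and C :: "nat \<Rightarrow> 'p set"
    and \<gamma> :: "nat \<Rightarrow> real"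
    and X0 :: "real^'p^'n"
    and V X :: "nat \<Rightarrow> (nat \<Rightarrow> nat set) \<Rightarrow> real^'p^'n"
  assumes dims: "CARD('p) \<le> CARD('n)"
    and params: "0 \<le> \<tau>" "0 < L"
    and nbhd: "bounded \<Omega>" "convex \<Omega>" "stiefel \<subseteq> interior \<Omega>"
    and weakly_convex: "convex_on \<Omega> (\<lambda>Y. f Y + \<tau> / 2 * (norm Y)\<^sup>2)"
    and lipschitz: "L-lipschitz_on \<Omega> f"
    and partition: "2 \<le> l" "column_partition l C"
    and stepsizes: "\<And>k. 0 < \<gamma> k" "\<And>k. \<gamma> k < 1 / L"
    and steps_diverge: "filterlim (\<lambda>N. \<Sum>k<N. \<gamma> k) at_top sequentially"
    and steps_square: "summable (\<lambda>k. (\<gamma> k)\<^sup>2)"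
    and algorithm: "rssm f l C \<gamma> X0 V X"
  shows "(\<forall>lam. 0 < lam \<and> lam < real l / (2 * (\<tau> + (2 * real l - 1) * L)) \<longrightarrow>
            (AE \<omega> in draws l. (\<lambda>k. Theta f l C lam (X k \<omega>)) \<longlonglongrightarrow> 0)) \<and>
         (AE \<omega> in draws l. \<forall>Xbar. accumulation_point (\<lambda>k. X k \<omega>) Xbar \<longrightarrow> stationary f Xbar)"
proof -
  interpret weakly_convex_on_stiefel f \<Omega> \<tau> L l C
    by unfold_locales (use assms in auto)
  have "pairs l \<noteq> {}"
    using partition(1) card_pairs[of l] finite_pairs[of l] by (auto simp: binomial_eq_0_iff)
  then interpret uniform_draws "pairs l" "draws l"
    by unfold_locales (simp_all add: finite_pairs draws_def)
  let ?A = "pairs l" and ?step = "\<lambda>P k \<omega>. rssm_step (pair_cols C P) (\<gamma> k) (V k \<omega>) (X k \<omega>)"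
  have X0: "X0 \<in> stiefel" and XX0: "\<And>\<omega>. \<omega> \<in> UNIV \<rightarrow> ?A \<Longrightarrow> X 0 \<omega> = X0"
    and V: "\<And>k \<omega>. \<omega> \<in> UNIV \<rightarrow> ?A \<Longrightarrow> V k \<omega> \<in> clarke_subdiff f (X k \<omega>)"
    and V_na: "\<And>k. nonanticipating ?A k (V k)"
    and XS: "\<And>k \<omega>. \<omega> \<in> UNIV \<rightarrow> ?A \<Longrightarrow> X (Suc k) \<omega> = ?step (\<omega> k) k \<omega>"
    using algorithm unfolding rssm_def space_S nonanticipating_def by blast+
  obtain Ks where Ks: "Ks > 0" "\<And>(Y :: real^'p^'n) D W \<gamma>. Y \<in> stiefel \<Longrightarrow> norm W \<le> L \<Longrightarrow> 0 < \<gamma> \<Longrightarrow> \<gamma> < 1 / L \<Longrightarrow>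
     rssm_step D \<gamma> W Y \<in> stiefel \<and> norm (rssm_step D \<gamma> W Y - Y) \<le> Ks * \<gamma>"
    using rssm_step_dist[OF params(2), where 'p='p and 'n='n] by blast
  have V_norm: "norm W \<le> L" if "Y \<in> stiefel" "W \<in> clarke_subdiff f Y" for Y W
    using norm_clarke_subdiff_le[OF _ that(2)] that(1) nbhd(3) by blast
  have X_in: "X k \<omega> \<in> stiefel" if \<omega>: "\<omega> \<in> UNIV \<rightarrow> ?A" for k \<omega>
  proof (induction k)
    case 0
    show ?case using X0 XX0[OF \<omega>] by simp
  next
    case (Suc k)
    then show ?case
      using Ks(2)[OF Suc V_norm[OF Suc V[OF \<omega>]] stepsizes] by (simp add: XS[OF \<omega>])
  qed
  have X_na: "nonanticipating ?A k (X k)" for k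
  proof (induction k)
    case 0
    show ?case by (simp add: nonanticipating_def XX0)
  next
    case (Suc k)
    show ?case
      unfolding nonanticipating_def
    proof (intro ballI impI)
      fix \<omega> \<omega>' assume w: "\<omega> \<in> UNIV \<rightarrow> ?A" "\<omega>' \<in> UNIV \<rightarrow> ?A" "\<forall>j<Suc k. \<omega> j = \<omega>' j"
      then have "X k \<omega> = X k \<omega>'" "V k \<omega> = V k \<omega>'" "\<omega> k = \<omega>' k"
        by (auto intro!: Suc[unfolded nonanticipating_def, rule_format]
          V_na[unfolded nonanticipating_def, rule_format])
      then show "X (Suc k) \<omega> = X (Suc k) \<omega>'" by (simp add: XS w)
    qed
  qed
  \<comment> \<open>This auxiliary \<open>lam\<close> is fixed for the descent argument and is
    independent of the parameter in the conclusion.\<close>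
  obtain lam K where lam: "0 < lam" and K: "0 < K" "\<And>Y W \<gamma>. Y \<in> stiefel \<Longrightarrow> W \<in> clarke_subdiff f Y
      \<Longrightarrow> 0 < \<gamma> \<Longrightarrow> \<gamma> < 1 / L \<Longrightarrow>
     (\<Sum>P\<in>?A. env lam (rssm_step (pair_cols C P) \<gamma> W Y)) / card ?A \<le> env lam Y - \<gamma> / lam * gap lam Y +
         K * \<gamma>\<^sup>2"
    using avg_env_step by blast
  obtain B where B: "\<And>Y. Y \<in> stiefel \<Longrightarrow> 0 \<le> env lam Y + B"
    using env_bounded_below[OF lam] by blast
  obtain Kg where Kg: "Kg > 0" "\<And>Y Y'. Y \<in> stiefel \<Longrightarrow> Y' \<in> stiefel \<Longrightarrow> \<bar>gap lam Y' - gap lam Y\<bar>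
      \<le> Kg * norm (Y' - Y)"
    using gap_lipschitz[OF lam] by blast
  have "AE \<omega> in draws l. summable (\<lambda>k. \<gamma> k / lam * \<bar>gap lam (X k \<omega>)\<bar>)"
  \<comment> \<open>The shift by \<open>B\<close> makes the envelope nonnegative along iterates. The
    absolute values extend nonnegativity to \<open>\<omega>\<close> outside the sample space, where
    nothing is known about \<open>X\<close>.\<close>
  proof (rule AE_summable_of_avg_descent[where \<phi> = "\<lambda>k \<omega>. \<bar>env lam (X k \<omega>) + B\<bar>" and e =
      "\<lambda>k. K * (\<gamma> k)\<^sup>2"])
    show "nonanticipating ?A k (\<lambda>\<omega>. \<bar>env lam (X k \<omega>) + B\<bar>)"
      "nonanticipating ?A k (\<lambda>\<omega>. \<gamma> k / lam * \<bar>gap lam (X k \<omega>)\<bar>)" for k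
      by (rule nonanticipating_compose[OF X_na])+
    show "0 \<le> \<gamma> k / lam * \<bar>gap lam (X k \<omega>)\<bar>" for k \<omega>
      using stepsizes(1)[of k] lam by simp
    show "summable (\<lambda>k. K * (\<gamma> k)\<^sup>2)" using steps_square by (rule summable_mult)
    show "0 \<le> K * (\<gamma> k)\<^sup>2" for k using K(1) by simp
    fix k :: nat and \<omega> :: "nat \<Rightarrow> nat set" assume \<omega>: "\<omega> \<in> UNIV \<rightarrow> ?A"
    note S = X_in[OF \<omega>, of k]
    \<comment> \<open>Replacing draw \<open>k\<close> leaves the iterate and the subgradient of
      iteration \<open>k\<close> unchanged, so resampling runs through all possible single
      steps.\<close>
    have "\<bar>env lam (X (Suc k) (fun_upd \<omega> k P)) + B\<bar> = env lam (?step P k \<omega>) + B" if "P \<in> ?A" for P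
    proof -
      have w: "fun_upd \<omega> k P \<in> UNIV \<rightarrow> ?A" using \<omega> that by auto
      have "X k (fun_upd \<omega> k P) = X k \<omega>"
        by (rule X_na[unfolded nonanticipating_def, rule_format, OF w \<omega>]) simp
      moreover have "V k (fun_upd \<omega> k P) = V k \<omega>"
        by (rule V_na[unfolded nonanticipating_def, rule_format, OF w \<omega>]) simp
      ultimately have "X (Suc k) (fun_upd \<omega> k P) = ?step P k \<omega>" by (simp add: XS[OF w])
      then show ?thesis using B[OF X_in[OF w, of "Suc k"]] by simp
    qed
    then have "(\<Sum>P\<in>?A. \<bar>env lam (X (Suc k) (fun_upd \<omega> k P)) + B\<bar>) / card ?A
        = (\<Sum>P\<in>?A. env lam (?step P k \<omega>)) / card ?A + B"
      using fin ne by (simp add: sum.distrib add_divide_distrib)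
    then show "(\<Sum>P\<in>?A. \<bar>env lam (X (Suc k) (fun_upd \<omega> k P)) + B\<bar>) / card ?A
        + \<gamma> k / lam * \<bar>gap lam (X k \<omega>)\<bar> \<le> \<bar>env lam (X k \<omega>) + B\<bar> + K * (\<gamma> k)\<^sup>2"
      using K(2)[OF S V[OF \<omega>] stepsizes[of k]] B[OF S] gap_nonneg[OF S, of lam] by simp
  qed simp
  moreover have "AE \<omega> in draws l. \<omega> \<in> UNIV \<rightarrow> ?A"
    using AE_space[of "draws l"] by (simp add: space_S)
  ultimately have good: "AE \<omega> in draws l. \<omega> \<in> UNIV \<rightarrow> ?A \<and>
      (\<forall>Xbar. accumulation_point (\<lambda>k. X k \<omega>) Xbar \<longrightarrow> stationary f Xbar)"
  proof eventually_elim
    case (elim \<omega>)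
    then have \<omega>: "\<omega> \<in> UNIV \<rightarrow> ?A" and sum: "summable (\<lambda>k. \<gamma> k / lam * \<bar>gap lam (X k \<omega>)\<bar>)" by auto
    note S = X_in[OF \<omega>]
    have "(\<lambda>k. gap lam (X k \<omega>)) \<longlonglongrightarrow> 0"
    proof (rule tendsto_zero_of_summable_weighted[OF _ stepsizes(1) steps_diverge steps_square])
      show "0 \<le> gap lam (X k \<omega>)" for k by (rule gap_nonneg[OF S])
      show "summable (\<lambda>k. \<gamma> k * gap lam (X k \<omega>))"
        using summable_mult[OF sum, of lam] lam gap_nonneg[OF S] by simp
      show "\<bar>gap lam (X (Suc k) \<omega>) - gap lam (X k \<omega>)\<bar> \<le> (Kg * Ks) * \<gamma> k" for k
      proof -
        have "norm (X (Suc k) \<omega> - X k \<omega>) \<le> Ks * \<gamma> k"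
          using Ks(2)[OF S V_norm[OF S V[OF \<omega>]] stepsizes] by (simp add: XS[OF \<omega>])
        then have "Kg * norm (X (Suc k) \<omega> - X k \<omega>) \<le> Kg * (Ks * \<gamma> k)"
          using Kg(1) by (intro mult_left_mono) auto
        with Kg(2)[OF S S, of "Suc k" k] show ?thesis by (simp add: mult.assoc)
      qed
    qed
    then show ?case using gap_limit_stationary[where x = "\<lambda>k. X k \<omega>", OF lam S] \<omega> by blast
  qed
  show ?thesis
  proof (intro conjI allI impI)
    fix lam assume "0 < lam \<and> lam < real l / (2 * (\<tau> + (2 * real l - 1) * L))"
    then have lam: "0 < lam" "lam < real l / (2 * (\<tau> + (2 * real l - 1) * L))" by auto
    \<comment> \<open>The event \<open>good\<close>, obtained from the auxiliary parameter, works
      for every admissible \<open>lam\<close>.\<close>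
    show "AE \<omega> in draws l. (\<lambda>k. Theta f l C lam (X k \<omega>)) \<longlonglongrightarrow> 0"
      using good
    proof eventually_elim
      case (elim \<omega>)
      then show ?case
        by (intro Theta_tendsto_zero[OF lam]) (auto intro: X_in)
    qed
  next
    show "AE \<omega> in draws l. \<forall>Xbar. accumulation_point (\<lambda>k. X k \<omega>) Xbar \<longrightarrow> stationary f Xbar"
      using good by eventually_elim blast
  qed
qed

end
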